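(* Let $\lambda$ be a partition with at most $n$ parts. The map $T\mapsto T^{Ev}=P(cr(T)^\star)$ is a realization of the type $C_n$ Lusztig involution on the crystal $\mathfrak B^\lambda$. That is, it is an involution of $\mathcal{KN}(\lambda,n)$ such that for all $T\in\mathcal{KN}(\lambda,n)$ and $i\in[n]$: (1) $wt(T^{Ev})=-wt(T)$; (2) $e_i(T^{Ev})=(f_i(T))^{Ev}$ and $f_i(T^{Ev})=(e_i(T))^{Ev}$ (with $0^{Ev}=0$); (3) $\varepsilon_i(T^{Ev})=\varphi_i(T)$ and $\varphi_i(T^{Ev})=\varepsilon_i(T)$.
   Context: Fix $n\ge 1$ and let $[\pm n]=\{1<\dots<n<\overline n<\dots<\overline 1\}$, where $\overline i=-i$ and $\overline{\overline i}=i$. Columns. A column is a strictly increasing (top to bottom) sequence in $[\pm n]$, identified with its set of letters. A column $C$ is admissible if for every $i\in[n]$ such that $i$ and $\overline i$ both occur in $C$, with $i$ in the $a$-th row from the top and $\overline i$ in the $b$-th row from the bottom, $a+b\le i$. Let $C$ be admissible and let $I=\{z_1>\dots>z_r\}$ be the set of $z\in[n]$ with $z,\overline z\in C$. Then there is $J=\{t_1>\dots>t_r\}\subseteq[n]$ where $t_1$ is the greatest letter of $[n]$ with $t_1<z_1$, $t_1\notin C$, $\overline{t_1}\notin C$, and for $i\ge2$, $t_i$ is the greatest letter of $[n]$ with $t_i<\min(t_{i-1},z_i)$, $t_i\notin C$, $\overline{t_i}\notin C$. The right column $r(C)$ is obtained from $C$ by replacing each $\overline{z_i}$ by $\overline{t_i}$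 and reordering; the left column $\ell(C)$ is obtained by replacing each $z_i$ by $t_i$ and reordering. Tableaux. A semistandard tableau of shape $\lambda$ on $[\pm n]$ is a filling of the Young diagram (English notation) strictly increasing down columns and weakly increasing along rows. It is a KN (Kashiwara-Nakashima) tableau if all its columns are admissible and its split form, obtained by replacing each column $C$ by the two columns $\ell(C)\,r(C)$, is semistandard. $\mathcal{KN}(\lambda,n)$ is the set of KN tableaux of shape $\lambda$. The column reading word $cr(T)$ is read down columns, columns from right to left. The weight of a word is the vector in $\mathbb Z^n$ whose $i$-th entry is the number of $i$'s minus the number of $\overline i$'s; $wt(T)=wt(cr(T))$. Crystal. For a word $w$ in $[\pm n]$ and $i\in[n]$: if $i<n$, give sign $+$ to letters $i,\overline{i+1}$ and sign $-$ to letters $i+1,\overline i$; if $i=n$, give sign $+$ to $n$ and $-$ to $\overline n$. Repeatedly delete pairs consisting of a $+$ and a $-$ to its right with no undeleted sign between them, leaving $-^a+^b$. Put $\varepsilon_i(w)=a$, $\varphi_i(w)=b$. If $b>0$, $f_i(w)$ is obtained by changing the letter of the leftmost remaining $+$ ($i\mapsto i+1$, $\overline{i+1}\mapsto\overline i$, or $n\mapsto\overline n$ when $i=n$); otherwise $f_i(w)=0$. If $a>0$, $e_i(w)$ is obtained by changing the letter of the rightmost remaining $-$ by the inverse substitution; otherwise $e_i(w)=0$. This gives a crystal graph on all words. The crystal $\mathfrak B^\lambda$ has underlying set $\mathcal{KN}(\lambda,n)$, with $f_i,e_i,\varepsilon_i,\varphi_i$ defined through $cr$ (if $f_i(cr(T))\ne0$,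 it is $cr$ of a unique tableau $f_i(T)$ of shape $\lambda$; same for $e_i$). For a word $w$, $P(w)$ is the unique KN tableau $T$ (of partition shape with at most $n$ rows) such that there is a weight-preserving isomorphism of crystals from the connected component of $w$ to that of $cr(T)$ sending $w$ to $cr(T)$. For a word $w=w_1\cdots w_k$, $w^\star=\overline{w_k}\cdots\overline{w_1}$. *)

theory Defs
  imports Main
begin

section \<open>Letters, words and columns\<close>

text \<open>
  The letter \<open>i\<close> barred is the integer \<open>- i\<close>; words and columns are integer lists.
  The alphabet is listed in increasing order.
\<close>

definition letters :: "nat \<Rightarrow> int list" where
  "letters n = [1..int n] @ [- int n..- 1]"

definition letter_less :: "int \<Rightarrow> int \<Rightarrow> bool" where
  "letter_less x y \<longleftrightarrow> (0 < x \<and> y < 0) \<or> (0 < x \<and> 0 < y \<and> x < y) \<or> (x < 0 \<and> y < 0 \<and> x < y)"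

definition letter_le :: "int \<Rightarrow> int \<Rightarrow> bool" where
  "letter_le x y \<longleftrightarrow> letter_less x y \<or> x = y"

lemma letters_increasing: "sorted_wrt letter_less (letters n)"
proof -
  have up: "sorted_wrt letter_less [a..b]" if "0 < a \<or> b < 0" for a b
  proof (rule sorted_wrt_mono_rel)
    show "sorted_wrt (<) [a..b]" by simp
    show "letter_less x y" if "x \<in> set [a..b]" "y \<in> set [a..b]" "x < y" for x y
      using that \<open>0 < a \<or> b < 0\<close> unfolding letter_less_def set_upto atLeastAtMost_iff by linarith
  qed
  have "letter_less x y" if "x \<in> set [1..int n]" "y \<in> set [- int n..- 1]" for x y
    using that unfolding letter_less_def set_upto atLeastAtMost_iff by linarith
  then show ?thesis
    unfolding letters_def sorted_wrt_append using up[of 1 "int n"] up[of "- int n" "-1"] by auto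
qed

definition is_column :: "nat \<Rightarrow> int list \<Rightarrow> bool" where
  "is_column n C \<longleftrightarrow> set C \<subseteq> set (letters n) \<and> sorted_wrt letter_less C"

text \<open>List positions count from 0, whereas the rows in the admissibility condition count from 1.\<close>

definition admissible :: "nat \<Rightarrow> int list \<Rightarrow> bool" where
  "admissible n C \<longleftrightarrow> is_column n C \<and>
     (\<forall>i\<in>{1..int n}. \<forall>p<length C. \<forall>q<length C.
        C ! p = i \<and> C ! q = - i \<longrightarrow> int (p + 1) + int (length C - q) \<le> i)"

definition column_of :: "nat \<Rightarrow> int set \<Rightarrow> int list" where
  "column_of n S = filter (\<lambda>x. x \<in> S) (letters n)"

definition doubled :: "nat \<Rightarrow> int list \<Rightarrow> int list" where
  "doubled n C = rev (filter (\<lambda>z. z \<in> set C \<and> - z \<in> set C) [1..int n])"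

text \<open>
  In \<open>partners_below C b [z\<^sub>i, z\<^sub>i\<^sub>+\<^sub>1, \<dots>]\<close> the bound \<open>b\<close> is the previous \<open>t\<close>. It starts at
  \<open>n + 1\<close>, which exceeds every \<open>z\<close> and hence imposes nothing on the first \<open>t\<close>.
  The sets below are nonempty whenever \<open>C\<close> is admissible.
\<close>

fun partners_below :: "int list \<Rightarrow> int \<Rightarrow> int list \<Rightarrow> int list" where
  "partners_below C b [] = []"
| "partners_below C b (z # zs) =
     (let t = Max {t. 1 \<le> t \<and> t < min b z \<and> t \<notin> set C \<and> - t \<notin> set C}
      in t # partners_below C t zs)"

definition partners :: "nat \<Rightarrow> int list \<Rightarrow> int list" where
  "partners n C = partners_below C (int n + 1) (doubled n C)"

definition right_column :: "nat \<Rightarrow> int list \<Rightarrow> int list" where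
  "right_column n C =
     column_of n (set C - uminus ` set (doubled n C) \<union> uminus ` set (partners n C))"

definition left_column :: "nat \<Rightarrow> int list \<Rightarrow> int list" where
  "left_column n C = column_of n (set C - set (doubled n C) \<union> set (partners n C))"


section \<open>Kashiwara--Nakashima tableaux\<close>

text \<open>A partition is the list of its positive parts.\<close>

definition partition_upto :: "nat \<Rightarrow> nat list \<Rightarrow> bool" where
  "partition_upto n \<mu> \<longleftrightarrow> sorted_wrt (\<ge>) \<mu> \<and> 0 \<notin> set \<mu> \<and> length \<mu> \<le> n"

definition column_lengths :: "nat list \<Rightarrow> nat list" where
  "column_lengths \<mu> =
     map (\<lambda>j. length (filter (\<lambda>p. j < p) \<mu>)) [0..<(case \<mu> of [] \<Rightarrow> 0 | p # _ \<Rightarrow> p)]"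

text \<open>A tableau is the list of its columns from left to right, each read from top to bottom.\<close>

type_synonym tableau = "int list list"

definition has_shape :: "nat list \<Rightarrow> tableau \<Rightarrow> bool" where
  "has_shape \<mu> T \<longleftrightarrow> map length T = column_lengths \<mu>"

definition semistandard :: "nat \<Rightarrow> tableau \<Rightarrow> bool" where
  "semistandard n T \<longleftrightarrow>
     (\<forall>C\<in>set T. is_column n C) \<and>
     sorted_wrt (\<lambda>C D. length D \<le> length C \<and> (\<forall>i<length D. letter_le (C ! i) (D ! i))) T"

definition split_form :: "nat \<Rightarrow> tableau \<Rightarrow> tableau" where
  "split_form n T = concat (map (\<lambda>C. [left_column n C, right_column n C]) T)"

definition KN :: "nat \<Rightarrow> nat list \<Rightarrow> tableau set" where
  "KN n \<mu> = {T. has_shape \<mu> T \<and> semistandard n T \<and>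
                (\<forall>C\<in>set T. admissible n C) \<and> semistandard n (split_form n T)}"

definition cr :: "tableau \<Rightarrow> int list" where
  "cr T = concat (rev T)"

text \<open>Only the entries with index in \<open>{1..n}\<close> are relevant.\<close>

definition wt :: "int list \<Rightarrow> int \<Rightarrow> int" where
  "wt w i = int (count_list w i) - int (count_list w (- i))"


section \<open>The crystal of words\<close>

datatype sign = Plus | Minus

definition letter_sign :: "nat \<Rightarrow> int \<Rightarrow> int \<Rightarrow> sign option" where
  "letter_sign n i x =
     (if i < int n then
        if x = i \<or> x = - (i + 1) then Some Plus
        else if x = i + 1 \<or> x = - i then Some Minus
        else None
      else
        if x = int n then Some Plus
        else if x = - int n then Some Minus
        else None)"

text \<open>The signed letters of a word, together with their positions.\<close>

definition signature :: "nat \<Rightarrow> int \<Rightarrow> int list \<Rightarrow> (nat \<times> sign) list" where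
  "signature n i w =
     List.map_filter (\<lambda>p. map_option (Pair p) (letter_sign n i (w ! p))) [0..<length w]"

inductive cancel :: "(nat \<times> sign) list \<Rightarrow> (nat \<times> sign) list \<Rightarrow> bool" where
  "cancel (xs @ [(p, Plus), (q, Minus)] @ ys) (xs @ ys)"

text \<open>
  The cancellation process, run from the right. By the two lemmas below, the result is indeed
  reached by cancellations and has the form \<open>-\<^sup>a +\<^sup>b\<close>.
\<close>

fun reduce :: "(nat \<times> sign) list \<Rightarrow> (nat \<times> sign) list" where
  "reduce [] = []"
| "reduce ((p, Minus) # xs) = (p, Minus) # reduce xs"
| "reduce ((p, Plus) # xs) =
     (case reduce xs of
        (q, Minus) # ys \<Rightarrow> ys
      | ys \<Rightarrow> (p, Plus) # ys)"

definition minuses :: "(nat \<times> sign) list \<Rightarrow> (nat \<times> sign) list" where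
  "minuses xs = filter (\<lambda>x. snd x = Minus) xs"

definition pluses :: "(nat \<times> sign) list \<Rightarrow> (nat \<times> sign) list" where
  "pluses xs = filter (\<lambda>x. snd x = Plus) xs"

lemma cancel_Cons: "cancel xs ys \<Longrightarrow> cancel (x # xs) (x # ys)"
proof (induction rule: cancel.induct)
  case (1 xs p q ys)
  show ?case using cancel.intros[of "x # xs" p q ys] by simp
qed

lemma cancels_Cons: "cancel\<^sup>*\<^sup>* xs ys \<Longrightarrow> cancel\<^sup>*\<^sup>* (x # xs) (x # ys)"
proof (induction rule: rtranclp_induct)
  case (step y z)
  show ?case using step.IH cancel_Cons[OF step.hyps(2)] by (rule rtranclp.rtrancl_into_rtrancl)
qed simp

lemma reduce_cancels: "cancel\<^sup>*\<^sup>* xs (reduce xs)"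
proof (induction xs rule: reduce.induct)
  case (3 p xs)
  have *: "cancel\<^sup>*\<^sup>* ((p, Plus) # xs) ((p, Plus) # reduce xs)"
    using 3 by (rule cancels_Cons)
  show ?case
  proof (cases "\<exists>q ys. reduce xs = (q, Minus) # ys")
    case True
    then obtain q ys where r: "reduce xs = (q, Minus) # ys" by blast
    have "cancel ((p, Plus) # (q, Minus) # ys) ys"
      using cancel.intros[of "[]" p q ys] by simp
    then have "cancel\<^sup>*\<^sup>* ((p, Plus) # xs) ys"
      using * unfolding r by (rule rtranclp.rtrancl_into_rtrancl[rotated])
    then show ?thesis using r by simp
  next
    case False
    then have "reduce ((p, Plus) # xs) = (p, Plus) # reduce xs"
      by (auto split: list.split sign.split)
    then show ?thesis using * by simp
  qed
qed (auto intro: cancels_Cons)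

lemma reduce_form: "reduce xs = minuses (reduce xs) @ pluses (reduce xs)"
proof (induction xs rule: reduce.induct)
  case (3 p xs)
  show ?case
  proof (cases "reduce xs")
    case Nil
    then show ?thesis by (simp add: minuses_def pluses_def)
  next
    case (Cons x ys)
    obtain q s where x: "x = (q, s)" by (cases x)
    show ?thesis
    proof (cases s)
      case Plus
      have "filter (\<lambda>x. snd x = Minus) ys = []"
      proof (rule ccontr)
        assume "filter (\<lambda>x. snd x = Minus) ys \<noteq> []"
        then obtain y zs where y: "filter (\<lambda>x. snd x = Minus) ys = y # zs"
          by (cases "filter (\<lambda>x. snd x = Minus) ys") auto
        then have "y = (q, Plus)" using 3 Cons x Plus by (simp add: minuses_def)
        moreover have "snd y = Minus" using y by (auto dest: filter_eq_ConsD)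
        ultimately show False by simp
      qed
      then show ?thesis using 3 Cons x Plus by (simp add: minuses_def pluses_def)
    next
      case Minus
      then show ?thesis using 3 Cons x by (simp add: minuses_def pluses_def)
    qed
  qed
qed (simp_all add: minuses_def pluses_def)

definition eps :: "nat \<Rightarrow> int \<Rightarrow> int list \<Rightarrow> nat" where
  "eps n i w = length (minuses (reduce (signature n i w)))"

definition phi :: "nat \<Rightarrow> int \<Rightarrow> int list \<Rightarrow> nat" where
  "phi n i w = length (pluses (reduce (signature n i w)))"

definition f_letter :: "nat \<Rightarrow> int \<Rightarrow> int \<Rightarrow> int" where
  "f_letter n i x = (if i < int n then (if x = i then i + 1 else - i) else - int n)"

definition e_letter :: "nat \<Rightarrow> int \<Rightarrow> int \<Rightarrow> int" where
  "e_letter n i x = (if i < int n then (if x = i + 1 then i else - (i + 1)) else int n)"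

text \<open>The value 0 of a crystal operator is \<^const>\<open>None\<close>.\<close>

definition f_word :: "nat \<Rightarrow> int \<Rightarrow> int list \<Rightarrow> int list option" where
  "f_word n i w =
     (if phi n i w > 0
      then let p = fst (hd (pluses (reduce (signature n i w)))) in Some (w[p := f_letter n i (w ! p)])
      else None)"

definition e_word :: "nat \<Rightarrow> int \<Rightarrow> int list \<Rightarrow> int list option" where
  "e_word n i w =
     (if eps n i w > 0
      then let p = fst (last (minuses (reduce (signature n i w)))) in Some (w[p := e_letter n i (w ! p)])
      else None)"

definition component :: "nat \<Rightarrow> int list \<Rightarrow> int list set" where
  "component n w =
     {u. (\<lambda>x y. \<exists>i\<in>{1..int n}. f_word n i x = Some y \<or> e_word n i x = Some y)\<^sup>*\<^sup>* w u}"

definition crystal_iso :: "nat \<Rightarrow> int list set \<Rightarrow> int list set \<Rightarrow> (int list \<Rightarrow> int list) \<Rightarrow> bool" where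
  "crystal_iso n A B \<psi> \<longleftrightarrow>
     bij_betw \<psi> A B \<and>
     (\<forall>u\<in>A. \<forall>i\<in>{1..int n}.
        wt (\<psi> u) i = wt u i \<and>
        eps n i (\<psi> u) = eps n i u \<and>
        phi n i (\<psi> u) = phi n i u \<and>
        f_word n i (\<psi> u) = map_option \<psi> (f_word n i u) \<and>
        e_word n i (\<psi> u) = map_option \<psi> (e_word n i u))"


section \<open>The crystal of tableaux and the map Ev\<close>

definition f_tab :: "nat \<Rightarrow> nat list \<Rightarrow> int \<Rightarrow> tableau \<Rightarrow> tableau option" where
  "f_tab n \<mu> i T = map_option (\<lambda>w. THE T'. T' \<in> KN n \<mu> \<and> cr T' = w) (f_word n i (cr T))"

definition e_tab :: "nat \<Rightarrow> nat list \<Rightarrow> int \<Rightarrow> tableau \<Rightarrow> tableau option" where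
  "e_tab n \<mu> i T = map_option (\<lambda>w. THE T'. T' \<in> KN n \<mu> \<and> cr T' = w) (e_word n i (cr T))"

definition P :: "nat \<Rightarrow> int list \<Rightarrow> tableau" where
  "P n w = (THE T. (\<exists>\<nu>. partition_upto n \<nu> \<and> T \<in> KN n \<nu>) \<and>
     (\<exists>\<psi>. crystal_iso n (component n w) (component n (cr T)) \<psi> \<and> \<psi> w = cr T))"

definition star :: "int list \<Rightarrow> int list" where
  "star w = map uminus (rev w)"

definition Ev :: "nat \<Rightarrow> tableau \<Rightarrow> tableau" where
  "Ev n T = P n (star (cr T))"

end

theory Submission imports Defs
begin

text \<open>
  The map \<open>w \<mapsto> w\<^sup>\<star>\<close> swaps \<open>e\<^sub>i\<close> and \<open>f\<^sub>i\<close>, so everything reduces to showing that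
  \<open>cr(T)\<^sup>\<star>\<close> and the word of a unique tableau, of the same shape, generate isomorphic components.
  Tableaux of a shape are stable under the crystal operators: on the split form, \<open>f\<^sub>i\<close> acts by the
  reflection \<open>s\<^sub>i\<close> on \<open>\<ell>(C)\<close> or \<open>r(C)\<close> or both, and the comparison \<open>r(C) \<le> \<ell>(D)\<close> survives by
  the lifting property of the Bruhat order. There is one highest and one lowest weight tableau
  of each shape. The word of the lowest one is mapped by \<open>\<star>\<close> to the concatenation of columns
  \<open>1 2 \<dots> a\<close> of weakly decreasing lengths, that of the highest one is the same with increasing
  lengths, and the two are related by plactic relations, which are crystal isomorphisms.
\<close>

section \<open>The tensor product rule\<close>

text \<open>\<open>P\<close> is a definite description, so a value must be shown to exist and to be
  unique. Existence is shown for the words \<open>star (cr T)\<close>: at a lowest weight tableau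
  such a word is explicit, and the claim then moves up through the crystal because
  \<open>star\<close> reverses every edge. Uniqueness comes from climbing from two tableaux along
  the same operators to their highest weights, where the weight reveals the shape.

  The obstacle in the stability of tableaux is that an operator changes one column while its
  neighbours stay fixed. The bracketing rule supplies what the lifting property asks for: a right
  column can change under \<open>f\<^sub>i\<close> only if the column has \<open>eps\<close> equal
  to 0, and then the next column has \<open>phi\<close> equal to 0.

  The columns \<open>1 2 ... a\<close> are permuted by ordinary Knuth moves on unbarred letters. An
  isomorphism must however be followed through the whole component, where barred letters appear.
  This is why the plactic relation includes barred pairs: it has to be closed under all
  \<open>e\<^sub>i\<close> and \<open>f\<^sub>i\<close>.\<close>

lemma signature_Nil [simp]: "signature n i [] = []"
  by (simp add: signature_def)

lemma signature_append:
  "signature n i (u @ v) = signature n i u @ map (apfst ((+) (length u))) (signature n i v)"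
proof -
  have *: "[0..<length (u @ v)] = [0..<length u] @ map ((+) (length u)) [0..<length v]"
    by (rule nth_equalityI) (auto simp: nth_append)
  have a: "List.map_filter (\<lambda>p. map_option (Pair p) (letter_sign n i ((u @ v) ! p))) [0..<length u]
     = signature n i u"
    by (auto simp: signature_def List.map_filter_def nth_append intro!: map_cong filter_cong)
  have b: "List.map_filter (\<lambda>p. map_option (Pair p) (letter_sign n i ((u @ v) ! p)))
      (map ((+) (length u)) [0..<length v])
     = map (apfst ((+) (length u))) (signature n i v)"
    by (simp add: signature_def List.map_filter_def filter_map comp_def apfst_def map_prod_def
        option.map_sel split: option.splits)
  show ?thesis
    unfolding a[symmetric] b[symmetric] by (simp only: signature_def * List.map_filter_def filter_append map_append)
qed

lemma minuses_simps [simp]: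
  "minuses [] = []" "minuses ((p, Minus) # xs) = (p, Minus) # minuses xs"
  "minuses ((p, Plus) # xs) = minuses xs" "minuses (map (apfst g) ys) = map (apfst g) (minuses ys)"
  by (auto simp: minuses_def filter_map comp_def)

lemma pluses_simps [simp]:
  "pluses [] = []" "pluses ((p, Minus) # xs) = pluses xs"
  "pluses ((p, Plus) # xs) = (p, Plus) # pluses xs"
  "pluses (map (apfst g) ys) = map (apfst g) (pluses ys)"
  by (auto simp: pluses_def filter_map comp_def)

text \<open>As \<open>reduce xs\<close> is a block of minuses followed by a block of pluses, a new
  leading plus cancels the first minus, or joins the pluses if there is none. In this form nothing
  depends on the head of the list any more.\<close>

lemma reduce_Plus:
  "minuses (reduce ((p, Plus) # xs)) = tl (minuses (reduce xs))"
  "pluses (reduce ((p, Plus) # xs)) =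
     (if minuses (reduce xs) = [] then (p, Plus) # pluses (reduce xs) else pluses (reduce xs))"
proof -
  obtain M Q where r: "reduce xs = M @ Q" and M: "M = minuses (reduce xs)" and Q: "Q = pluses (reduce xs)"
    using reduce_form by blast
  have s: "\<forall>x\<in>set M. snd x = Minus" "\<forall>x\<in>set Q. snd x = Plus"
    by (auto simp: M Q minuses_def pluses_def)
  have "minuses (reduce ((p, Plus) # xs)) = tl M \<and>
     pluses (reduce ((p, Plus) # xs)) = (if M = [] then (p, Plus) # Q else Q)"
  proof (cases M)
    case Nil
    have *: "reduce ((p, Plus) # xs) = (p, Plus) # Q"
    proof (cases Q)
      case (Cons a list)
      then show ?thesis using s(2) r Nil by (cases a) auto
    qed (use r Nil in auto)
    have "minuses Q = []" "pluses Q = Q" using s(2) by (auto simp: minuses_def pluses_def)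
    then show ?thesis unfolding * using Nil by simp
  next
    case (Cons a M')
    then obtain q where a: "a = (q, Minus)" using s(1) by (cases a) auto
    have *: "reduce ((p, Plus) # xs) = M' @ Q" using r Cons a by simp
    have "minuses Q = []" "pluses Q = Q" "minuses M' = M'" "pluses M' = []"
      using s Cons by (auto simp: minuses_def pluses_def)
    then show ?thesis unfolding * using Cons by (simp add: minuses_def pluses_def)
  qed
  then show "minuses (reduce ((p, Plus) # xs)) = tl (minuses (reduce xs))"
    "pluses (reduce ((p, Plus) # xs)) =
     (if minuses (reduce xs) = [] then (p, Plus) # pluses (reduce xs) else pluses (reduce xs))"
    unfolding M Q by simp_all
qed

declare reduce.simps(3) [simp del]

text \<open>The surviving pluses on the left meet the surviving minuses on the right: the last
  pluses go with the first minuses, hence \<open>take\<close> and \<open>drop\<close>. The lists,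
  and not only their lengths, are recorded because the operators need the positions.\<close>

lemma reduce_append:
  "minuses (reduce (xs @ ys)) =
     minuses (reduce xs) @ drop (length (pluses (reduce xs))) (minuses (reduce ys)) \<and>
   pluses (reduce (xs @ ys)) =
     take (length (pluses (reduce xs)) - length (minuses (reduce ys))) (pluses (reduce xs)) @
     pluses (reduce ys)"
proof (induction xs rule: reduce.induct)
  case (3 p xs)
  show ?case
    using 3 by (auto simp: reduce_Plus tl_append tl_drop drop_Suc Suc_diff_le split: list.splits)
qed auto

lemma reduce_map_apfst: "reduce (map (apfst g) xs) = map (apfst g) (reduce xs)"
proof (induction xs rule: reduce.induct)
  case (3 p xs)
  then show ?case by (auto simp: reduce.simps(3) split: list.splits sign.splits)
qed auto

lemma eps_append: "eps n i (u @ v) = eps n i u + (eps n i v - phi n i u)"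
  by (simp add: eps_def phi_def signature_append reduce_append reduce_map_apfst)

lemma phi_append: "phi n i (u @ v) = phi n i v + (phi n i u - eps n i v)"
  by (simp add: eps_def phi_def signature_append reduce_append reduce_map_apfst)

lemma reduce_subset: "set (reduce xs) \<subseteq> set xs"
proof (induction xs rule: reduce.induct)
  case (3 p xs)
  then show ?case by (auto simp: reduce.simps(3) split: list.splits sign.splits)
qed auto

lemma signature_pos: "(p, s) \<in> set (signature n i w) \<Longrightarrow> p < length w \<and> letter_sign n i (w ! p) = Some s"
  by (auto simp: signature_def List.map_filter_def)

lemma hd_pluses_pos:
  assumes "phi n i w > 0"
  shows "fst (hd (pluses (reduce (signature n i w)))) < length w"
proof -
  have "hd (pluses (reduce (signature n i w))) \<in> set (pluses (reduce (signature n i w)))"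
    using assms by (simp add: phi_def)
  then have "hd (pluses (reduce (signature n i w))) \<in> set (signature n i w)"
    using reduce_subset by (auto simp: pluses_def)
  then show ?thesis using signature_pos by (metis prod.collapse)
qed

lemma last_minuses_pos:
  assumes "eps n i w > 0"
  shows "fst (last (minuses (reduce (signature n i w)))) < length w"
proof -
  have "last (minuses (reduce (signature n i w))) \<in> set (minuses (reduce (signature n i w)))"
    using assms by (simp add: eps_def)
  then have "last (minuses (reduce (signature n i w))) \<in> set (signature n i w)"
    using reduce_subset by (auto simp: minuses_def)
  then show ?thesis using signature_pos by (metis prod.collapse)
qed

lemma f_word_append:
  "f_word n i (u @ v) =
     (if phi n i u > eps n i v then map_option (\<lambda>u'. u' @ v) (f_word n i u)
      else map_option ((@) u) (f_word n i v))"
proof (cases "phi n i u > eps n i v")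
  case True
  let ?R = "\<lambda>w. pluses (reduce (signature n i w))"
  have pos: "phi n i u > 0" using True by simp
  have "hd (?R (u @ v)) = hd (?R u)"
    using True by (cases "?R u") (auto simp: eps_def phi_def signature_append reduce_append
        reduce_map_apfst Suc_diff_le)
  then show ?thesis
    using True hd_pluses_pos[OF pos]
    by (auto simp: f_word_def phi_append Let_def nth_append list_update_append)
next
  case False
  let ?R = "\<lambda>w. pluses (reduce (signature n i w))"
  have R: "?R (u @ v) = map (apfst ((+) (length u))) (?R v)"
    using False by (auto simp: eps_def phi_def signature_append reduce_append reduce_map_apfst)
  have "fst (hd (?R (u @ v))) = length u + fst (hd (?R v))" if "phi n i v > 0"
    using that unfolding R by (auto simp: phi_def hd_map)
  then show ?thesis
    using False by (auto simp: f_word_def phi_append Let_def nth_append list_update_append)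
qed

lemma e_word_append:
  "e_word n i (u @ v) =
     (if eps n i v > phi n i u then map_option ((@) u) (e_word n i v)
      else map_option (\<lambda>u'. u' @ v) (e_word n i u))"
proof (cases "eps n i v > phi n i u")
  case True
  let ?R = "\<lambda>w. minuses (reduce (signature n i w))"
  have "last (?R (u @ v)) = apfst ((+) (length u)) (last (?R v))"
    using True by (auto simp: eps_def phi_def signature_append reduce_append reduce_map_apfst
        last_drop drop_map)
       (subst last_map; force)
  then show ?thesis
    using True by (auto simp: e_word_def eps_append Let_def nth_append list_update_append)
next
  case False
  let ?R = "\<lambda>w. minuses (reduce (signature n i w))"
  have R: "?R (u @ v) = ?R u"
    using False by (auto simp: eps_def phi_def signature_append reduce_append reduce_map_apfst)
  then show ?thesis
    using False last_minuses_pos[of n i u]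
    by (auto simp: e_word_def eps_append Let_def nth_append list_update_append)
qed

lemma eps_Nil [simp]: "eps n i [] = 0" and phi_Nil [simp]: "phi n i [] = 0"
  and f_word_Nil [simp]: "f_word n i [] = None" and e_word_Nil [simp]: "e_word n i [] = None"
  by (simp_all add: eps_def phi_def f_word_def e_word_def)

lemma signature_single:
  "signature n i [x] = (case letter_sign n i x of None \<Rightarrow> [] | Some s \<Rightarrow> [(0, s)])"
  by (simp add: signature_def List.map_filter_def split: option.splits)

lemma eps_single: "eps n i [x] = (if letter_sign n i x = Some Minus then 1 else 0)"
  and phi_single: "phi n i [x] = (if letter_sign n i x = Some Plus then 1 else 0)"
proof -
  have *: "reduce [(0, Plus)] = [(0, Plus)]" by (simp add: reduce.simps(3))
  show "eps n i [x] = (if letter_sign n i x = Some Minus then 1 else 0)"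
    and "phi n i [x] = (if letter_sign n i x = Some Plus then 1 else 0)"
    by (cases "letter_sign n i x"; cases "the (letter_sign n i x)";
        simp add: eps_def phi_def signature_single *)+
qed

lemma f_word_single:
  "f_word n i [x] = (if letter_sign n i x = Some Plus then Some [f_letter n i x] else None)"
  using hd_pluses_pos[of n i "[x]"] phi_single[of n i x] by (auto simp: f_word_def Let_def)

lemma e_word_single:
  "e_word n i [x] = (if letter_sign n i x = Some Minus then Some [e_letter n i x] else None)"
  using last_minuses_pos[of n i "[x]"] eps_single[of n i x] by (auto simp: e_word_def Let_def)

lemma eps_Cons: "eps n i (x # v) = eps n i [x] + (eps n i v - phi n i [x])"
  using eps_append[of n i "[x]" v] by simp

lemma phi_Cons: "phi n i (x # v) = phi n i v + (phi n i [x] - eps n i v)"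
  using phi_append[of n i "[x]" v] by simp

lemma f_word_Cons:
  "f_word n i (x # v) =
     (if phi n i [x] > eps n i v then Some (f_letter n i x # v) else map_option ((#) x) (f_word n i v))"
  using f_word_append[of n i "[x]" v] by (auto simp: f_word_single phi_single cong: map_option_cong)

lemma e_word_Cons:
  "e_word n i (x # v) =
     (if eps n i v > phi n i [x] then map_option ((#) x) (e_word n i v)
      else if letter_sign n i x = Some Minus then Some (e_letter n i x # v) else None)"
  using e_word_append[of n i "[x]" v] by (auto simp: e_word_single cong: map_option_cong)

lemma f_word_None: "f_word n i w = None \<longleftrightarrow> phi n i w = 0"
  by (simp add: f_word_def Let_def)

lemma e_word_None: "e_word n i w = None \<longleftrightarrow> eps n i w = 0"
  by (simp add: e_word_def Let_def)

lemma letter_sign_f_letter: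
  assumes "i \<in> {1..int n}" "letter_sign n i x = Some Plus"
  shows "letter_sign n i (f_letter n i x) = Some Minus" "e_letter n i (f_letter n i x) = x"
  using assms by (auto simp: letter_sign_def f_letter_def e_letter_def split: if_splits)

lemma letter_sign_e_letter:
  assumes "i \<in> {1..int n}" "letter_sign n i x = Some Minus"
  shows "letter_sign n i (e_letter n i x) = Some Plus" "f_letter n i (e_letter n i x) = x"
  using assms by (auto simp: letter_sign_def f_letter_def e_letter_def split: if_splits)

text \<open>The effect on \<open>eps\<close> and \<open>phi\<close> belongs to the induction: the
  new \<open>eps\<close> of the tail decides whether \<open>e\<^sub>i\<close> acts on the tail or on
  the head.\<close>

lemma f_word_inverse:
  assumes "i \<in> {1..int n}" "f_word n i w = Some w'"
  shows "e_word n i w' = Some w \<and> eps n i w' = Suc (eps n i w) \<and> Suc (phi n i w') = phi n i w"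
  using assms(2)
proof (induction w arbitrary: w')
  case (Cons x v)
  show ?case
  proof (cases "phi n i [x] > eps n i v")
    case True
    then have x: "letter_sign n i x = Some Plus" by (auto simp: phi_single split: if_splits)
    then show ?thesis
      using True Cons.prems letter_sign_f_letter[OF assms(1) x]
      by (auto simp: f_word_Cons e_word_Cons eps_Cons[of _ _ _ v] phi_Cons[of _ _ _ v] phi_single eps_single)
  next
    case False
    then obtain v' where v: "f_word n i v = Some v'" "w' = x # v'"
      using Cons.prems by (auto simp: f_word_Cons)
    show ?thesis using Cons.IH[OF v(1)] v(2) False
      by (auto simp: e_word_Cons eps_Cons[of _ _ _ v] phi_Cons[of _ _ _ v] eps_Cons[of _ _ _ v'] phi_Cons[of _ _ _ v'])
  qed
qed simp

lemma e_word_inverse: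
  assumes "i \<in> {1..int n}" "e_word n i w = Some w'"
  shows "f_word n i w' = Some w"
  using assms(2)
proof (induction w arbitrary: w')
  case (Cons x v)
  show ?case
  proof (cases "eps n i v > phi n i [x]")
    case True
    then obtain v' where v: "e_word n i v = Some v'" "w' = x # v'"
      using Cons.prems by (auto simp: e_word_Cons)
    have "f_word n i v' = Some v" by (rule Cons.IH[OF v(1)])
    then show ?thesis using f_word_inverse[OF assms(1)] True v(2)
      by (fastforce simp: f_word_Cons)
  next
    case False
    then have x: "letter_sign n i x = Some Minus" and w': "w' = e_letter n i x # v"
      using Cons.prems by (auto simp: e_word_Cons split: if_splits)
    then show ?thesis
      using False letter_sign_e_letter[OF assms(1) x]
      by (auto simp: f_word_Cons phi_single)
  qed
qed simp

section \<open>The star involution\<close>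

lemma star_star [simp]: "star (star w) = w"
  by (simp add: star_def rev_map comp_def)

lemma star_append: "star (u @ v) = star v @ star u"
  by (simp add: star_def)

lemma star_Nil [simp]: "star [] = []" and star_single [simp]: "star [x] = [- x]"
  by (simp_all add: star_def)

lemma wt_star: "wt (star w) i = - wt w i"
proof -
  have "count_list (map uminus u) y = count_list u (- y)" for u :: "int list" and y
    by (induction u) auto
  then show ?thesis by (simp add: wt_def star_def)
qed

lemma letter_sign_uminus:
  assumes "i \<in> {1..int n}"
  shows "letter_sign n i (- x) = Some Minus \<longleftrightarrow> letter_sign n i x = Some Plus"
    and "letter_sign n i (- x) = Some Plus \<longleftrightarrow> letter_sign n i x = Some Minus"
  using assms by (auto simp: letter_sign_def)

text \<open>Barring exchanges the two signs and reversal exchanges left and right, so a pair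
  plus-minus becomes such a pair again, and surviving pluses become surviving minuses.\<close>

lemma eps_phi_star:
  assumes "i \<in> {1..int n}"
  shows "eps n i (star w) = phi n i w \<and> phi n i (star w) = eps n i w"
proof (induction w)
  case (Cons x v)
  have "star (x # v) = star v @ [- x]" using star_append[of "[x]" v] by simp
  then show ?case using Cons
    by (auto simp: eps_append phi_append eps_Cons[of _ _ x v] phi_Cons[of _ _ x v] eps_single phi_single
        letter_sign_uminus[OF assms] split: sign.splits)
qed simp

lemma eps_star: "i \<in> {1..int n} \<Longrightarrow> eps n i (star w) = phi n i w"
  and phi_star: "i \<in> {1..int n} \<Longrightarrow> phi n i (star w) = eps n i w"
  using eps_phi_star by simp_all

lemma f_word_star:
  assumes "i \<in> {1..int n}"
  shows "f_word n i (star w) = map_option star (e_word n i w)"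
proof (induction w)
  case (Cons x v)
  have s: "star (x # u) = star u @ [- x]" for x u using star_append[of "[x]" u] by simp
  have "f_letter n i (- x) = - e_letter n i x" if "letter_sign n i x = Some Minus"
    using that assms by (auto simp: f_letter_def e_letter_def letter_sign_def split: if_splits)
  then show ?case using Cons unfolding s
    by (auto simp: f_word_append e_word_Cons eps_single phi_single f_word_single eps_star[OF assms]
        phi_star[OF assms] s letter_sign_uminus[OF assms] option.map_comp comp_def
        split: sign.splits option.splits)
qed simp

lemma e_word_star:
  assumes "i \<in> {1..int n}"
  shows "e_word n i (star w) = map_option star (f_word n i w)"
proof -
  have "f_word n i w = map_option star (e_word n i (star w))"
    using f_word_star[OF assms, of "star w"] by simp
  then show ?thesis by (simp add: option.map_comp comp_def option.map_ident)
qed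

lemma wt_append: "wt (u @ v) j = wt u j + wt v j"
  by (simp add: wt_def)

lemma wt_Nil [simp]: "wt [] j = 0"
  by (simp add: wt_def)

lemma wt_single: "wt [x] j = (if x = j then 1 else 0) - (if x = - j then 1 else 0)"
  by (simp add: wt_def)

lemma wt_Cons: "wt (x # v) j = wt [x] j + wt v j"
  using wt_append[of "[x]" v] by simp

text \<open>The right side is the pairing of the weight with the simple coroot of type C: the
  difference of two coordinates for \<open>i < n\<close>, the last coordinate alone for
  \<open>i = n\<close>.\<close>

lemma phi_minus_eps:
  assumes "i \<in> {1..int n}"
  shows "int (phi n i w) - int (eps n i w) = wt w i - (if i < int n then wt w (i + 1) else 0)"
proof (induction w)
  case (Cons x v)
  have "int (phi n i [x]) - int (eps n i [x]) = wt [x] i - (if i < int n then wt [x] (i + 1) else 0)"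
    using assms by (auto simp: phi_single eps_single wt_single letter_sign_def)
  then show ?case using Cons by (auto simp: phi_Cons[of _ _ x v] eps_Cons[of _ _ x v] wt_Cons[of x v])
qed simp

section \<open>Split columns by parenthesis matching\<close>

text \<open>
  Reading the positions \<open>n, \<dots>, 1\<close>, a doubled position opens a parenthesis and an empty position
  closes one if any is open. \<open>pend\<close> counts the open ones, and the closing positions are the
  partners \<open>t\<^sub>1 > t\<^sub>2 > \<dots>\<close>. This set is local: it changes only near the positions that change.
\<close>

fun pend :: "int set \<Rightarrow> nat \<Rightarrow> int list \<Rightarrow> nat" where
  "pend S c [] = c"
| "pend S c (k # ks) =
     (if k \<in> S \<and> - k \<in> S then pend S (Suc c) ks
      else if k \<notin> S \<and> - k \<notin> S then pend S (c - 1) ks else pend S c ks)"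

fun taken :: "int set \<Rightarrow> nat \<Rightarrow> int list \<Rightarrow> int list" where
  "taken S c [] = []"
| "taken S c (k # ks) =
     (if k \<in> S \<and> - k \<in> S then taken S (Suc c) ks
      else if k \<notin> S \<and> - k \<notin> S \<and> c > 0 then k # taken S (c - 1) ks else taken S c ks)"

abbreviation desc :: "int \<Rightarrow> int list" where
  "desc k \<equiv> rev [1..k]"

abbreviation dbl :: "int set \<Rightarrow> int \<Rightarrow> bool" where
  "dbl S z \<equiv> z \<in> S \<and> - z \<in> S"

abbreviation vac :: "int set \<Rightarrow> int \<Rightarrow> bool" where
  "vac S z \<equiv> z \<notin> S \<and> - z \<notin> S"

lemma desc_rec: "1 \<le> k \<Longrightarrow> desc k = k # desc (k - 1)"
  using upto_rec2[of 1 k] by simp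

lemma desc_Suc: "desc (int (Suc k)) = int (Suc k) # desc (int k)"
  using desc_rec[of "int (Suc k)"] by simp

lemma pend_append: "pend S c (xs @ ys) = pend S (pend S c xs) ys"
  by (induction xs arbitrary: c) auto

lemma taken_append: "taken S c (xs @ ys) = taken S c xs @ taken S (pend S c xs) ys"
  by (induction xs arbitrary: c) (auto split: if_splits)

lemma taken_set: "set (taken S c ks) \<subseteq> {k \<in> set ks. vac S k}"
  by (induction ks arbitrary: c) (auto split: if_splits)

lemma distinct_taken: "distinct ks \<Longrightarrow> distinct (taken S c ks)"
  using taken_set by (induction ks arbitrary: c) fastforce+

lemma length_taken: "length (taken S c ks) + pend S c ks = c + length (filter (dbl S) ks)"
  by (induction ks arbitrary: c) (auto split: if_splits)

lemma all_le_Suc: "(\<forall>j\<le>Suc k. R j) \<longleftrightarrow> (\<forall>j\<le>k. R j) \<and> R (Suc k)"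
  by (auto simp: le_Suc_eq)

text \<open>A counter truncated at 0 ends at the maximum of its untruncated final value and of the
  excesses over all suffixes of the input. The suffixes of a descending reading are the lists
  \<open>desc j\<close>, so ending at 0 means that no excess is positive.\<close>

lemma pend_zero_iff:
  "pend S c (desc (int k)) = 0 \<longleftrightarrow>
     c + length (filter (dbl S) (desc (int k))) \<le> length (filter (vac S) (desc (int k))) \<and>
     (\<forall>j\<le>k. length (filter (dbl S) (desc (int j))) \<le> length (filter (vac S) (desc (int j))))"
proof (induction k arbitrary: c)
  case (Suc k)
  let ?d = "\<lambda>j. length (filter (dbl S) (desc (int j)))"
  let ?v = "\<lambda>j. length (filter (vac S) (desc (int j)))"
  define Q where "Q \<longleftrightarrow> (\<forall>j\<le>k. ?d j \<le> ?v j)"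
  have all_Suc: "(\<forall>j\<le>Suc k. ?d j \<le> ?v j) \<longleftrightarrow> Q \<and> ?d (Suc k) \<le> ?v (Suc k)"
    unfolding Q_def by (rule all_le_Suc)
  have last: "Q \<Longrightarrow> ?d k \<le> ?v k" unfolding Q_def by blast
  have IH: "pend S c (desc (int k)) = 0 \<longleftrightarrow> c + ?d k \<le> ?v k \<and> Q" for c
    unfolding Q_def by (rule Suc)
  consider (D) "dbl S (int (Suc k))" | (V) "vac S (int (Suc k))"
    | (N) "\<not> dbl S (int (Suc k))" "\<not> vac S (int (Suc k))" by blast
  then show ?case
  proof cases
    case D
    then have "?d (Suc k) = Suc (?d k)" "?v (Suc k) = ?v k"
      "pend S c (desc (int (Suc k))) = pend S (Suc c) (desc (int k))"
      unfolding desc_Suc by simp_all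
    then show ?thesis unfolding all_Suc using IH[of "Suc c"] by auto
  next
    case V
    then have "?d (Suc k) = ?d k" "?v (Suc k) = Suc (?v k)"
      "pend S c (desc (int (Suc k))) = pend S (c - 1) (desc (int k))"
      unfolding desc_Suc by auto
    then show ?thesis unfolding all_Suc using IH[of "c - 1"] last by auto
  next
    case N
    then have "?d (Suc k) = ?d k" "?v (Suc k) = ?v k"
      "pend S c (desc (int (Suc k))) = pend S c (desc (int k))"
      unfolding desc_Suc by auto
    then show ?thesis unfolding all_Suc using IH[of c] last by auto
  qed
qed simp

text \<open>Invariant of the scan: \<open>ps\<close> is the queue of doubled positions already
  passed and still without partner, \<open>b\<close> is the last partner found, and no position
  between \<open>k\<close> and \<open>min b (hd ps)\<close> is vacant. So the maximum is the next
  vacant position to come. The queue is first in first out and parentheses are last in first out,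
  but which positions close depends only on the number \<open>c\<close> of open ones. A final count
  of 0 ensures that no maximum of an empty set is taken.\<close>

lemma partners_below_taken:
  assumes "pend S c (desc (int k)) = 0" "S = set C" "length ps = c" "\<forall>p\<in>set ps. int k < p" "int k < b"
    and "\<And>t. ps \<noteq> [] \<Longrightarrow> int k < t \<Longrightarrow> t < min b (hd ps) \<Longrightarrow> \<not> vac S t"
  shows "partners_below C b (ps @ filter (dbl S) (desc (int k))) = taken S c (desc (int k))"
  using assms
proof (induction k arbitrary: b ps c)
  case (Suc k)
  let ?k = "int (Suc k)"
  consider (D) "dbl S ?k" | (V) "vac S ?k" "c > 0" | (N) "\<not> dbl S ?k" "vac S ?k \<longrightarrow> c = 0" by blast
  then show ?case
  proof cases
    case D
    have "partners_below C b ((ps @ [?k]) @ filter (dbl S) (desc (int k))) = taken S (Suc c) (desc (int k))"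
    proof (rule Suc.IH)
      show "pend S (Suc c) (desc (int k)) = 0" using Suc.prems(1) D by (simp add: desc_Suc del: of_nat_Suc)
      show "\<forall>p\<in>set (ps @ [?k]). int k < p" "int k < b" using Suc.prems(4,5) by auto
      show "\<not> vac S t" if "ps @ [?k] \<noteq> []" "int k < t" "t < min b (hd (ps @ [?k]))" for t
      proof (cases "ps = [] \<or> t = ?k")
        case False
        then show ?thesis using Suc.prems(6)[of t] that by auto
      qed (use that D in auto)
    qed (use Suc.prems in auto)
    then show ?thesis using D by (simp add: desc_Suc del: of_nat_Suc)
  next
    case V
    then obtain p qs where ps: "ps = p # qs" using Suc.prems(3) by (cases ps) auto
    have fin: "finite {t. 1 \<le> t \<and> t < min b p \<and> t \<notin> set C \<and> - t \<notin> set C}"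
      by (rule finite_subset[of _ "{1..b}"]) auto
    have m: "Max {t. 1 \<le> t \<and> t < min b p \<and> t \<notin> set C \<and> - t \<notin> set C} = ?k"
    proof (rule Max_eqI[OF fin])
      show "?k \<in> {t. 1 \<le> t \<and> t < min b p \<and> t \<notin> set C \<and> - t \<notin> set C}"
        using Suc.prems(2,4,5) V ps by auto
      show "t \<le> ?k" if "t \<in> {t. 1 \<le> t \<and> t < min b p \<and> t \<notin> set C \<and> - t \<notin> set C}" for t
        using Suc.prems(6)[of t] that ps Suc.prems(2) by (cases "t \<le> ?k") auto
    qed
    have "partners_below C ?k (qs @ filter (dbl S) (desc (int k))) = taken S (c - 1) (desc (int k))"
    proof (rule Suc.IH)
      show "pend S (c - 1) (desc (int k)) = 0" using Suc.prems(1) V by (simp add: desc_Suc del: of_nat_Suc)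
      show "\<forall>p\<in>set qs. int k < p" using Suc.prems(4) ps by auto
    qed (use Suc.prems ps in auto)
    then show ?thesis using V ps m by (simp add: desc_Suc del: of_nat_Suc)
  next
    case N
    have "partners_below C b (ps @ filter (dbl S) (desc (int k))) = taken S c (desc (int k))"
    proof (rule Suc.IH)
      show "pend S c (desc (int k)) = 0" using Suc.prems(1) N by (auto simp: desc_Suc simp del: of_nat_Suc split: if_splits)
      show "\<forall>p\<in>set ps. int k < p" "int k < b" using Suc.prems(4,5) by auto
      show "\<not> vac S t" if "ps \<noteq> []" "int k < t" "t < min b (hd ps)" for t
      proof (cases "t = ?k")
        case False
        then show ?thesis using Suc.prems(6)[of t] that by auto
      qed (use that N Suc.prems(3) in auto)
    qed (use Suc.prems in auto)
    then show ?thesis using N by (auto simp: desc_Suc simp del: of_nat_Suc)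
  qed
qed simp

definition partner_set :: "nat \<Rightarrow> int set \<Rightarrow> int set" where
  "partner_set n S = set (taken S 0 (desc (int n)))"

definition balanced :: "nat \<Rightarrow> int set \<Rightarrow> bool" where
  "balanced n S \<longleftrightarrow> pend S 0 (desc (int n)) = 0"

lemma partners_eq: "balanced n (set C) \<Longrightarrow> set (partners n C) = partner_set n (set C)"
  using partners_below_taken[of "set C" 0 n C "[]" "int n + 1"]
  by (simp add: partners_def doubled_def balanced_def partner_set_def rev_filter)

section \<open>Columns as sets of letters, and admissibility as balance\<close>

lemma set_letters: "set (letters n) = {x. x \<noteq> 0 \<and> \<bar>x\<bar> \<le> int n}"
  by (auto simp: letters_def)

lemma is_column_column_of: "is_column n (column_of n S)"
  by (auto simp: is_column_def column_of_def sorted_wrt_filter letters_increasing)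

lemma letter_less_irrefl: "\<not> letter_less x x"
  by (simp add: letter_less_def)

lemma letter_less_asym: "letter_less x y \<Longrightarrow> \<not> letter_less y x"
  by (auto simp: letter_less_def)

lemma sorted_letter_less_unique:
  "sorted_wrt letter_less xs \<Longrightarrow> sorted_wrt letter_less ys \<Longrightarrow> set xs = set ys \<Longrightarrow> xs = ys"
proof (induction xs arbitrary: ys)
  case (Cons x xs)
  then obtain y zs where ys: "ys = y # zs" by (cases ys) auto
  have xy: "x = y"
    using Cons.prems letter_less_asym unfolding ys by (metis list.set_intros(1) set_ConsD sorted_wrt.simps(2))
  moreover have "x \<notin> set xs" "y \<notin> set zs" using Cons.prems letter_less_irrefl unfolding ys by auto
  then have "set xs = set zs" using Cons.prems(3) xy unfolding ys by auto
  ultimately show ?case using Cons unfolding ys by auto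
qed simp

lemma is_column_iff: "is_column n C \<longleftrightarrow> set C \<subseteq> set (letters n) \<and> column_of n (set C) = C"
proof
  assume C: "is_column n C"
  show "set C \<subseteq> set (letters n) \<and> column_of n (set C) = C"
  proof
    show "column_of n (set C) = C"
      by (rule sorted_letter_less_unique)
         (use C in \<open>auto simp: is_column_def column_of_def sorted_wrt_filter letters_increasing\<close>)
  qed (use C in \<open>simp add: is_column_def\<close>)
qed (metis is_column_column_of)

lemma set_column_of: "S \<subseteq> set (letters n) \<Longrightarrow> set (column_of n S) = S"
  by (auto simp: column_of_def)

lemma distinct_letters: "distinct (letters n)"
  by (auto simp: letters_def)

text \<open>In an increasing column the row of \<open>i\<close> from the top counts the letters up
  to \<open>i\<close>, and the row of \<open>- i\<close> from the bottom counts the letters from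
  \<open>- i\<close> on. With positions starting at 0 these rows are \<open>p + 1\<close> and
  \<open>length C - q\<close>.\<close>

lemma rank_sum:
  assumes "is_column n C" "i \<in> {1..int n}" "p < length C" "q < length C" "C ! p = i" "C ! q = - i"
  shows "p + 1 + (length C - q) =
    length (filter (\<lambda>y. y \<in> set C) [1..i]) + length (filter (\<lambda>y. - y \<in> set C) [1..i])"
proof -
  let ?f = "filter (\<lambda>y. y \<in> set C)"
  have l: "letters n = [1..i-1] @ [i] @ [i+1..int n] @ [- int n..- i - 1] @ [- i] @ [- i + 1..- 1]"
    using assms(2) upto_split2[of 1 i "int n"] upto_split3[of "- int n" "- i" "- 1"] upto_rec2[of 1 i]
    by (simp add: letters_def)
  have i: "i \<in> set C" "- i \<in> set C" using assms nth_mem by metis+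
  define A B Z where "A = ?f [1..i-1]" and "B = ?f [i+1..int n] @ ?f [- int n..- i - 1]"
    and "Z = ?f [- i + 1..- 1]"
  have C: "C = A @ [i] @ B @ [- i] @ Z"
    using assms(1) i unfolding is_column_iff column_of_def l A_def B_def Z_def by simp
  have d: "distinct C" using assms(1) by (metis column_of_def distinct_filter distinct_letters is_column_iff)
  have "C ! length A = i" "length A < length C" by (simp_all add: C)
  then have p: "p = length A" using d assms by (metis nth_eq_iff_index_eq)
  have "C ! (Suc (length A + length B)) = - i" "Suc (length A + length B) < length C"
    by (simp_all add: C nth_append)
  then have q: "q = Suc (length A + length B)" using d assms by (metis nth_eq_iff_index_eq)
  have len: "length C - q = Suc (length Z)" by (simp add: C q)
  have m: "[- i + 1..- 1] = map uminus (desc (i - 1))"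
  proof (rule nth_equalityI)
    fix k assume "k < length [- i + 1..- 1]"
    then have "int k < i - 1" by simp
    then have "[1..i - 1] ! (nat (i - 1) - Suc k) = 1 + int (nat (i - 1) - Suc k)" by (intro nth_upto) linarith
    then show "[- i + 1..- 1] ! k = map uminus (desc (i - 1)) ! k"
      using \<open>int k < i - 1\<close> by (simp add: rev_nth)
  qed simp
  have "length Z = length (rev (filter (\<lambda>y. - y \<in> set C) [1..i - 1]))"
    unfolding Z_def m rev_filter filter_map by (simp add: comp_def)
  then have z: "length Z = length (filter (\<lambda>y. - y \<in> set C) [1..i - 1])" by simp
  have u: "[1..i] = [1..i - 1] @ [i]" using assms(2) upto_rec2[of 1 i] by simp
  have "length (filter (\<lambda>y. y \<in> set C) [1..i]) = Suc (length A)"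
    "length (filter (\<lambda>y. - y \<in> set C) [1..i]) = Suc (length Z)"
    unfolding u z A_def using i by simp_all
  then show ?thesis using len p by simp
qed

text \<open>Each \<open>y\<close> in \<open>[1..i]\<close> contributes 2, 1 or 0 to the sum of the
  two rows, so this sum is \<open>i\<close> plus the number of doubled minus the number of vacant
  positions up to \<open>i\<close>. The row condition thus says that the vacant ones are at least as
  many. At a position that is not doubled this follows from the position before, so it may be asked
  everywhere, and this is the criterion of \<open>pend_zero_iff\<close>.\<close>

lemma admissible_iff: "admissible n C \<longleftrightarrow> is_column n C \<and> balanced n (set C)"
proof (cases "is_column n C")
  case col: True
  let ?S = "set C"
  let ?d = "\<lambda>j. length (filter (dbl ?S) (desc j))"
  let ?v = "\<lambda>j. length (filter (vac ?S) (desc j))"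
  have cnt: "length (filter (\<lambda>y. y \<in> ?S) [1..int j]) + length (filter (\<lambda>y. - y \<in> ?S) [1..int j]) + ?v (int j)
     = j + ?d (int j)" for j
  proof -
    have "length (filter (\<lambda>y. y \<in> ?S) (desc (int j))) + length (filter (\<lambda>y. - y \<in> ?S) (desc (int j)))
        + ?v (int j) = j + ?d (int j)"
    proof (induction j)
      case (Suc j)
      then show ?case unfolding desc_Suc by auto
    qed simp
    then show ?thesis unfolding rev_filter[symmetric] length_rev .
  qed
  have "admissible n C \<longleftrightarrow> (\<forall>i\<in>{1..int n}. dbl ?S i \<longrightarrow> ?d i \<le> ?v i)"
  proof -
    have "(int (p + 1) + int (length C - q) \<le> i) = (?d i \<le> ?v i)"
      if "i \<in> {1..int n}" "p < length C" "q < length C" "C ! p = i" "C ! q = - i" for i p q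
      using rank_sum[OF col that] cnt[of "nat i"] that(1) by auto
    then have "admissible n C \<longleftrightarrow> (\<forall>i\<in>{1..int n}. (\<exists>p<length C. C ! p = i) \<and> (\<exists>q<length C. C ! q = - i) \<longrightarrow> ?d i \<le> ?v i)"
      unfolding admissible_def using col by blast
    then show ?thesis by (simp add: in_set_conv_nth)
  qed
  also have "\<dots> \<longleftrightarrow> (\<forall>j\<le>n. ?d (int j) \<le> ?v (int j))"
  proof
    assume *: "\<forall>i\<in>{1..int n}. dbl ?S i \<longrightarrow> ?d i \<le> ?v i"
    have "?d (int j) \<le> ?v (int j)" if "j \<le> n" for j
      using that
    proof (induction j)
      case (Suc j)
      show ?case
      proof (cases "dbl ?S (int (Suc j))")
        case True
        have "int (Suc j) \<in> {1..int n}" using Suc.prems by simp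
        then show ?thesis using * True by blast
      next
        case False
        then have "?d (int (Suc j)) = ?d (int j)" "?v (int j) \<le> ?v (int (Suc j))"
          unfolding desc_Suc by simp_all
        then show ?thesis using Suc by linarith
      qed
    qed simp
    then show "\<forall>j\<le>n. ?d (int j) \<le> ?v (int j)" by blast
  next
    assume *: "\<forall>j\<le>n. ?d (int j) \<le> ?v (int j)"
    show "\<forall>i\<in>{1..int n}. dbl ?S i \<longrightarrow> ?d i \<le> ?v i"
    proof (intro ballI impI)
      fix i assume "i \<in> {1..int n}"
      then show "?d i \<le> ?v i" using spec[OF *, of "nat i"] by (simp add: nat_le_iff)
    qed
  qed
  also have "\<dots> \<longleftrightarrow> balanced n ?S"
    unfolding balanced_def pend_zero_iff by auto
  finally show ?thesis using col by simp
qed (simp add: admissible_def)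

section \<open>The left and the right column as sets\<close>

definition rset :: "nat \<Rightarrow> int set \<Rightarrow> int set" where
  "rset n S = {x \<in> S. \<not> (x < 0 \<and> - x \<in> S)} \<union> uminus ` partner_set n S"

definition lset :: "nat \<Rightarrow> int set \<Rightarrow> int set" where
  "lset n S = {x \<in> S. \<not> (0 < x \<and> - x \<in> S)} \<union> partner_set n S"

lemma partner_set_subset: "partner_set n S \<subseteq> {z \<in> {1..int n}. vac S z}"
  using taken_set[of S 0 "desc (int n)"] by (auto simp: partner_set_def)

lemma rset_subset: "S \<subseteq> set (letters n) \<Longrightarrow> rset n S \<subseteq> set (letters n)"
  using partner_set_subset[of n S] by (auto simp: rset_def set_letters)

lemma lset_subset: "S \<subseteq> set (letters n) \<Longrightarrow> lset n S \<subseteq> set (letters n)"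
  using partner_set_subset[of n S] by (auto simp: lset_def set_letters)

lemma set_doubled: "set (doubled n C) = {z \<in> {1..int n}. dbl (set C) z}"
  by (auto simp: doubled_def)

lemma right_column_eq: "admissible n C \<Longrightarrow> right_column n C = column_of n (rset n (set C))"
proof -
  assume *: "admissible n C"
  then have s: "set C \<subseteq> set (letters n)" by (simp add: admissible_iff is_column_def)
  have "set C - uminus ` set (doubled n C) = {x \<in> set C. \<not> (x < 0 \<and> - x \<in> set C)}"
  proof -
    have "x \<in> uminus ` set (doubled n C) \<longleftrightarrow> x < 0 \<and> - x \<in> set C" if "x \<in> set C" for x
    proof
      assume "x < 0 \<and> - x \<in> set C"
      then have "- x \<in> set (doubled n C)" using that s by (auto simp: set_doubled set_letters)
      then show "x \<in> uminus ` set (doubled n C)" by (metis image_eqI minus_minus)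
    qed (auto simp: set_doubled)
    then show ?thesis by blast
  qed
  then show ?thesis using * by (simp add: right_column_def rset_def partners_eq admissible_iff)
qed

lemma left_column_eq: "admissible n C \<Longrightarrow> left_column n C = column_of n (lset n (set C))"
proof -
  assume *: "admissible n C"
  then have s: "set C \<subseteq> set (letters n)" by (simp add: admissible_iff is_column_def)
  have "set C - set (doubled n C) = {x \<in> set C. \<not> (0 < x \<and> - x \<in> set C)}"
    using s unfolding set_doubled set_letters by auto
  then show ?thesis using * by (simp add: left_column_def lset_def partners_eq admissible_iff)
qed

section \<open>Entrywise comparison of columns by counting\<close>

definition rank :: "nat \<Rightarrow> int \<Rightarrow> int" where
  "rank n x = (if 0 < x then x else 2 * int n + 1 + x)"

definition cnt :: "nat \<Rightarrow> int set \<Rightarrow> int \<Rightarrow> nat" where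
  "cnt n A r = card {y \<in> A. rank n y \<le> r}"

lemma letter_less_rank:
  "x \<in> set (letters n) \<Longrightarrow> y \<in> set (letters n) \<Longrightarrow> letter_less x y \<longleftrightarrow> rank n x < rank n y"
  by (auto simp: letter_less_def rank_def set_letters)

lemma letter_le_rank:
  "x \<in> set (letters n) \<Longrightarrow> y \<in> set (letters n) \<Longrightarrow> letter_le x y \<longleftrightarrow> rank n x \<le> rank n y"
  by (auto simp: letter_le_def letter_less_def rank_def set_letters)

lemma rank_inj: "x \<in> set (letters n) \<Longrightarrow> y \<in> set (letters n) \<Longrightarrow> rank n x = rank n y \<Longrightarrow> x = y"
  by (auto simp: rank_def set_letters split: if_splits)

lemma rank_bounds: "x \<in> set (letters n) \<Longrightarrow> 1 \<le> rank n x \<and> rank n x \<le> 2 * int n"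
  by (auto simp: rank_def set_letters)

lemma finite_letters: "S \<subseteq> set (letters n) \<Longrightarrow> finite S"
  by (rule finite_subset) auto

lemma distinct_column: "is_column n C \<Longrightarrow> distinct C"
  by (metis column_of_def distinct_filter distinct_letters is_column_iff)

text \<open>The letters of rank at most \<open>r\<close> form an initial segment of the column; this
  translates between positions and counts.\<close>

lemma rank_nth_le_iff:
  assumes "is_column n C" "i < length C"
  shows "rank n (C ! i) \<le> r \<longleftrightarrow> i < cnt n (set C) r"
proof -
  let ?I = "{j. j < length C \<and> rank n (C ! j) \<le> r}"
  have sub: "set C \<subseteq> set (letters n)" and srt: "sorted_wrt letter_less C"
    using assms(1) by (auto simp: is_column_def)
  have mono: "rank n (C ! j) < rank n (C ! k)" if "j < k" "k < length C" for j k
  proof -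
    have "C ! j \<in> set (letters n)" "C ! k \<in> set (letters n)"
      using sub that nth_mem[of j C] nth_mem[of k C] by auto
    then show ?thesis using sorted_wrt_nth_less[OF srt that] letter_less_rank by blast
  qed
  have "distinct C" by (rule distinct_column[OF assms(1)])
  then have inj: "inj_on ((!) C) ?I" by (auto simp: inj_on_def nth_eq_iff_index_eq)
  have "{y \<in> set C. rank n y \<le> r} = (!) C ` ?I" by (auto simp: in_set_conv_nth)
  then have c: "cnt n (set C) r = card ?I" unfolding cnt_def using card_image[OF inj] by simp
  show ?thesis
  proof
    assume le: "rank n (C ! i) \<le> r"
    have "{..i} \<subseteq> ?I"
    proof
      fix j assume j: "j \<in> {..i}"
      then show "j \<in> ?I" using mono[of j i] assms(2) le by (cases "j = i") auto
    qed
    then have "card {..i} \<le> card ?I" by (intro card_mono) auto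
    then show "i < cnt n (set C) r" using c by simp
  next
    assume less: "i < cnt n (set C) r"
    show "rank n (C ! i) \<le> r"
    proof (rule ccontr)
      assume *: "\<not> rank n (C ! i) \<le> r"
      have "?I \<subseteq> {..<i}"
      proof
        fix j assume j: "j \<in> ?I"
        have "\<not> i < j" "j \<noteq> i" using mono[of i j] j * by auto
        then show "j \<in> {..<i}" by simp
      qed
      then have "card ?I \<le> i" using card_mono[of "{..<i}" ?I] by simp
      then show False using c less by simp
    qed
  qed
qed

lemma cnt_all:
  assumes "A \<subseteq> set (letters n)" "2 * int n \<le> r"
  shows "cnt n A r = card A"
proof -
  have "rank n y \<le> r" if "y \<in> A" for y using assms rank_bounds[of y n] that by auto
  then have "{y \<in> A. rank n y \<le> r} = A" by blast
  then show ?thesis by (simp add: cnt_def)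
qed

lemma cnt_le_length:
  assumes "is_column n C"
  shows "cnt n (set C) r \<le> length C"
  using card_mono[of "set C" "{y \<in> set C. rank n y \<le> r}"] distinct_card[OF distinct_column[OF assms]]
  by (simp add: cnt_def)

text \<open>For sets of equal size this is the Bruhat order on subsets; counting also compares
  columns of different lengths. The dominating set is the column on the left, with the smaller
  entries.\<close>

definition dominates :: "nat \<Rightarrow> int set \<Rightarrow> int set \<Rightarrow> bool" where
  "dominates n A B \<longleftrightarrow> (\<forall>r. cnt n B r \<le> cnt n A r)"

lemma dominates_trans [trans]: "dominates n A B \<Longrightarrow> dominates n B C \<Longrightarrow> dominates n A C"
  unfolding dominates_def by (blast intro: le_trans)

lemma entrywise_iff:
  assumes C: "is_column n C" and D: "is_column n D"
  shows "length D \<le> length C \<and> (\<forall>i<length D. letter_le (C ! i) (D ! i)) \<longleftrightarrow>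
    dominates n (set C) (set D)"
proof -
  have sub: "set C \<subseteq> set (letters n)" "set D \<subseteq> set (letters n)"
    using C D by (auto simp: is_column_def)
  have le: "letter_le (C ! i) (D ! i) \<longleftrightarrow> rank n (C ! i) \<le> rank n (D ! i)" if "i < length C" "i < length D" for i
    using letter_le_rank[of "C ! i" n "D ! i"] sub that nth_mem by blast
  show ?thesis
  proof
    assume *: "length D \<le> length C \<and> (\<forall>i<length D. letter_le (C ! i) (D ! i))"
    show "dominates n (set C) (set D)"
      unfolding dominates_def
    proof
      fix r
      show "cnt n (set D) r \<le> cnt n (set C) r"
      proof (rule ccontr)
        assume **: "\<not> ?thesis"
        let ?i = "cnt n (set C) r"
        have i: "?i < length D" using ** cnt_le_length[OF D, of r] by linarith
        then have "rank n (D ! ?i) \<le> r" using rank_nth_le_iff[OF D i, of r] ** by simp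
        then have "rank n (C ! ?i) \<le> r" using * i le[of ?i] by fastforce
        then show False using rank_nth_le_iff[OF C, of ?i r] i * by simp
      qed
    qed
  next
    assume *: "dominates n (set C) (set D)"
    have len: "length D \<le> length C"
      using spec[OF *[unfolded dominates_def], of "2 * int n"] cnt_all[OF sub(1)] cnt_all[OF sub(2)]
        distinct_card[OF distinct_column[OF C]] distinct_card[OF distinct_column[OF D]] by simp
    have "rank n (C ! i) \<le> rank n (D ! i)" if "i < length D" for i
    proof -
      have "i < cnt n (set D) (rank n (D ! i))" using rank_nth_le_iff[OF D that] by blast
      then have "i < cnt n (set C) (rank n (D ! i))" using * unfolding dominates_def by (meson order_less_le_trans)
      then show ?thesis using rank_nth_le_iff[OF C] that len by simp
    qed
    then show "length D \<le> length C \<and> (\<forall>i<length D. letter_le (C ! i) (D ! i))"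
      using len le by simp
  qed
qed

section \<open>A column lies between its left and its right column\<close>

definition dset :: "nat \<Rightarrow> int set \<Rightarrow> int set" where
  "dset n S = {z \<in> {1..int n}. dbl S z}"

text \<open>Cut the scan at \<open>k\<close>. The partners up to \<open>k\<close> close the
  parentheses opened there and also those still open on arrival, so the surplus of partners is the
  value of \<open>pend\<close> on the upper part.\<close>

lemma partners_below_dset:
  assumes "balanced n S"
  shows "card {z \<in> dset n S. z \<le> k} \<le> card {z \<in> partner_set n S. z \<le> k}"
    and "card (dset n S) = card (partner_set n S)"
proof -
  have main: "card {z \<in> dset n S. z \<le> k} + pend S 0 (rev [k+1..int n]) = card {z \<in> partner_set n S. z \<le> k}"
    if "0 \<le> k" "k \<le> int n" for k
  proof -
    let ?c = "pend S 0 (rev [k+1..int n])"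
    have "[1..int n] = [1..k] @ [k+1..int n]" using that upto_split2[of 1 k "int n"] by (cases "k = 0") auto
    then have d: "desc (int n) = rev [k+1..int n] @ desc k" by simp
    have p0: "pend S ?c (desc k) = 0" using assms by (simp add: balanced_def d pend_append)
    have "{z \<in> partner_set n S. z \<le> k} = set (taken S ?c (desc k))"
      using taken_set[of S 0 "rev [k+1..int n]"] taken_set[of S ?c "desc k"]
      by (auto simp: partner_set_def d taken_append)
    then have "card {z \<in> partner_set n S. z \<le> k} = length (taken S ?c (desc k))"
      by (simp add: distinct_card distinct_taken)
    moreover have "{z \<in> dset n S. z \<le> k} = set (filter (dbl S) (desc k))"
      using that by (auto simp: dset_def)
    then have "card {z \<in> dset n S. z \<le> k} = length (filter (dbl S) (desc k))"
      by (metis distinct_card distinct_filter distinct_rev distinct_upto)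
    ultimately show ?thesis using length_taken[of S ?c "desc k"] p0 by simp
  qed
  have sub: "dset n S \<subseteq> {1..int n}" "partner_set n S \<subseteq> {1..int n}"
    using partner_set_subset[of n S] by (auto simp: dset_def)
  then have n: "{z \<in> dset n S. z \<le> k} = dset n S" "{z \<in> partner_set n S. z \<le> k} = partner_set n S"
    if "int n \<le> k" for k using that by auto
  show card: "card (dset n S) = card (partner_set n S)"
    using main[of "int n"] by (simp add: n)
  consider "k < 0" | "0 \<le> k" "k \<le> int n" | "int n \<le> k" by linarith
  then show "card {z \<in> dset n S. z \<le> k} \<le> card {z \<in> partner_set n S. z \<le> k}"
  proof cases
    case 1
    then have "{z \<in> dset n S. z \<le> k} = {}" using sub by auto
    then show ?thesis by (metis card.empty le0)
  next
    case 2
    then show ?thesis using main[of k] by simp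
  qed (simp add: n card)
qed

lemma finite_dset [simp]: "finite (dset n S)" "finite (partner_set n S)"
  by (auto simp: partner_set_def dset_def intro: finite_subset[of _ "{1..int n}"])

lemma lset_dominates:
  assumes "S \<subseteq> set (letters n)" "balanced n S"
  shows "dominates n (lset n S) S"
  unfolding dominates_def
proof
  fix r
  let ?A = "{y \<in> S. rank n y \<le> r}" and ?D = "{z \<in> dset n S. z \<le> r}" and ?J = "{z \<in> partner_set n S. z \<le> r}"
  have fin: "finite ?A" using finite_letters[OF assms(1)] by simp
  have eq: "{y \<in> lset n S. rank n y \<le> r} = (?A - ?D) \<union> ?J"
    using assms(1) partner_set_subset[of n S] by (auto simp: lset_def rank_def set_letters dset_def)
  have "(?A - ?D) \<inter> ?J = {}" using partner_set_subset[of n S] by auto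
  then have "cnt n (lset n S) r = card (?A - ?D) + card ?J"
    unfolding cnt_def eq using fin by (intro card_Un_disjoint) auto
  moreover have "card ?A \<le> card (?A - ?D) + card ?D"
    using card_Un_le[of "?A - ?D" ?D] card_mono[of "?A - ?D \<union> ?D" ?A] fin by fastforce
  ultimately show "cnt n S r \<le> cnt n (lset n S) r" using partners_below_dset(1)[OF assms(2), of r] by (simp add: cnt_def)
qed

lemma dominates_rset:
  assumes "S \<subseteq> set (letters n)" "balanced n S"
  shows "dominates n S (rset n S)"
  unfolding dominates_def
proof
  fix r
  \<comment> \<open>For positive \<open>z\<close> the letter \<open>- z\<close> has rank
    \<open>2 * int n + 1 - z\<close>, which is at most \<open>r\<close> exactly when
    \<open>z > 2 * int n - r\<close>. On barred letters the count therefore runs over the complement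
    of an initial segment, which is why equality of the total numbers enters as well.\<close>
  let ?k = "2 * int n - r"
  let ?A = "{y \<in> S. rank n y \<le> r}" and ?D = "uminus ` (dset n S - {z \<in> dset n S. z \<le> ?k})"
    and ?J = "uminus ` (partner_set n S - {z \<in> partner_set n S. z \<le> ?k})"
  have fin: "finite ?A" using finite_letters[OF assms(1)] by simp
  have sub: "?D \<subseteq> ?A" by (auto simp: dset_def rank_def)
  have J: "- x \<in> partner_set n S \<Longrightarrow> x < 0 \<and> - int n \<le> x \<and> x \<notin> S \<and> - x \<notin> S" for x
    using subsetD[OF partner_set_subset, of "- x" n S] by simp
  have eq: "{y \<in> rset n S. rank n y \<le> r} \<subseteq> (?A - ?D) \<union> ?J"
  proof
    fix y assume y: "y \<in> {y \<in> rset n S. rank n y \<le> r}"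
    show "y \<in> (?A - ?D) \<union> ?J"
    proof (cases "- y \<in> partner_set n S")
      case True
      then have "- y \<in> partner_set n S - {z \<in> partner_set n S. z \<le> ?k}"
        using y J[of y] by (auto simp: rank_def)
      then have "- (- y) \<in> ?J" by (rule imageI)
      then show ?thesis by simp
    next
      case False
      have "y \<notin> uminus ` partner_set n S" using False by (metis imageE minus_minus)
      then have "y \<in> S" "\<not> (y < 0 \<and> - y \<in> S)" using y by (auto simp: rset_def)
      moreover from this have "y \<notin> ?D" by (auto simp: dset_def)
      ultimately show ?thesis using y by blast
    qed
  qed
  have inj: "inj_on uminus X" for X :: "int set" by simp
  have "cnt n (rset n S) r \<le> card ((?A - ?D) \<union> ?J)"
    unfolding cnt_def using fin by (intro card_mono[OF _ eq]) auto
  also have "\<dots> \<le> card (?A - ?D) + card ?J" by (rule card_Un_le)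
  also have "card (?A - ?D) = card ?A - card ?D" using sub by (intro card_Diff_subset) auto
  also have "card ?J = card (partner_set n S) - card {z \<in> partner_set n S. z \<le> ?k}"
    unfolding card_image[OF inj] by (rule card_Diff_subset) auto
  finally have 1: "cnt n (rset n S) r \<le> card ?A - card ?D + (card (partner_set n S) - card {z \<in> partner_set n S. z \<le> ?k})" .
  have D: "card ?D = card (dset n S) - card {z \<in> dset n S. z \<le> ?k}"
    unfolding card_image[OF inj] by (rule card_Diff_subset) auto
  have "card ?D \<le> card ?A" using fin sub by (intro card_mono)
  then have "cnt n (rset n S) r \<le> card ?A"
    using 1 D partners_below_dset(2)[OF assms(2)] partners_below_dset(1)[OF assms(2), of ?k] by linarith
  then show "cnt n (rset n S) r \<le> cnt n S r" by (simp add: cnt_def)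
qed

section \<open>Kashiwara-Nakashima tableaux through pairs of split columns\<close>

definition KN_pair :: "nat \<Rightarrow> int list \<Rightarrow> int list \<Rightarrow> bool" where
  "KN_pair n C D \<longleftrightarrow> dominates n (rset n (set C)) (lset n (set D))"

lemma admissibleD:
  "admissible n C \<Longrightarrow> is_column n C" "admissible n C \<Longrightarrow> set C \<subseteq> set (letters n)"
  "admissible n C \<Longrightarrow> balanced n (set C)"
  by (auto simp: admissible_iff is_column_def)

lemma set_split_columns:
  assumes "admissible n C"
  shows "set (right_column n C) = rset n (set C)" "set (left_column n C) = lset n (set C)"
  using assms admissibleD(2)[OF assms] by (simp_all add: right_column_eq left_column_eq set_column_of lset_subset rset_subset)

lemma is_column_split:
  assumes "admissible n C"
  shows "is_column n (right_column n C)" "is_column n (left_column n C)"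
  using assms by (simp_all add: right_column_eq left_column_eq is_column_column_of)

lemma column_dominates:
  assumes "admissible n C"
  shows "dominates n (lset n (set C)) (set C)" "dominates n (set C) (rset n (set C))"
    "dominates n (lset n (set C)) (rset n (set C))"
  using lset_dominates[OF admissibleD(2,3)[OF assms]] dominates_rset[OF admissibleD(2,3)[OF assms]]
    dominates_trans by metis+

text \<open>Always \<open>lset\<close> dominates the column and the column dominates
  \<open>rset\<close>. Hence among all comparisons in the split form, and those in the tableau
  itself, the only genuine one is between the right column of \<open>C\<close> and the left column
  of \<open>D\<close>; the others follow by transitivity.\<close>

lemma KN_iff:
  "T \<in> KN n \<mu> \<longleftrightarrow> has_shape \<mu> T \<and> (\<forall>C\<in>set T. admissible n C) \<and> sorted_wrt (KN_pair n) T"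
proof (cases "\<forall>C\<in>set T. admissible n C")
  case adm: True
  let ?R = "\<lambda>C D. length D \<le> length C \<and> (\<forall>i<length D. letter_le (C ! i) (D ! i))"
  have c: "is_column n D" if "D \<in> set (split_form n T)" for D
    using that adm is_column_split by (auto simp: split_form_def)
  have split_Cons: "split_form n (C # U) = left_column n C # right_column n C # split_form n U" for C U
    by (simp add: split_form_def)
  have set_split: "set (split_form n U) = (\<Union>C\<in>set U. {left_column n C, right_column n C})" for U
    by (auto simp: split_form_def)
  have split: "sorted_wrt ?R (split_form n U) \<longleftrightarrow> sorted_wrt (KN_pair n) U"
    if "\<forall>C\<in>set U. admissible n C" for U
    using that
  proof (induction U)
    case (Cons C U)
    have a: "admissible n C" "\<forall>D\<in>set U. admissible n D" using Cons.prems by auto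
    have lr: "?R (left_column n C) (right_column n C)"
      unfolding entrywise_iff[OF is_column_split(2)[OF a(1)] is_column_split(1)[OF a(1)]] set_split_columns[OF a(1)]
      by (rule column_dominates(3)[OF a(1)])
    have four: "(?R (left_column n C) (left_column n D) \<and> ?R (right_column n C) (left_column n D)) \<and>
        ?R (left_column n C) (right_column n D) \<and> ?R (right_column n C) (right_column n D) \<longleftrightarrow> KN_pair n C D"
      if "D \<in> set U" for D
    proof -
      have d: "admissible n D" using a(2) that by blast
      show ?thesis
        unfolding KN_pair_def
        unfolding entrywise_iff[OF is_column_split(2)[OF a(1)] is_column_split(1)[OF d]]
          entrywise_iff[OF is_column_split(2)[OF a(1)] is_column_split(2)[OF d]]
          entrywise_iff[OF is_column_split(1)[OF a(1)] is_column_split(1)[OF d]]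
          entrywise_iff[OF is_column_split(1)[OF a(1)] is_column_split(2)[OF d]]
          set_split_columns[OF a(1)] set_split_columns[OF d]
        using column_dominates(3)[OF a(1)] column_dominates(3)[OF d] dominates_trans by blast
    qed
    have "(\<forall>D\<in>set (split_form n U). ?R (left_column n C) D \<and> ?R (right_column n C) D) \<longleftrightarrow>
      (\<forall>D\<in>set U. (?R (left_column n C) (left_column n D) \<and> ?R (right_column n C) (left_column n D)) \<and>
        ?R (left_column n C) (right_column n D) \<and> ?R (right_column n C) (right_column n D))"
      unfolding set_split by (simp only: ball_UN ball_simps simp_thms)
    also have "\<dots> \<longleftrightarrow> (\<forall>D\<in>set U. KN_pair n C D)"
      by (rule ball_cong[OF refl four])
    finally show ?case using Cons.IH[OF a(2)] lr unfolding split_Cons sorted_wrt.simps list.set by blast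
  qed (simp add: split_form_def)
  have "sorted_wrt ?R T" if "sorted_wrt (KN_pair n) T"
  proof (rule sorted_wrt_mono_rel[OF _ that])
    fix C D assume *: "C \<in> set T" "D \<in> set T" "KN_pair n C D"
    then have a: "admissible n C" "admissible n D" using adm by auto
    have "dominates n (set C) (set D)"
      using column_dominates(2)[OF a(1)] column_dominates(1)[OF a(2)] *(3) dominates_trans
      unfolding KN_pair_def by blast
    then show "?R C D" using entrywise_iff[OF admissibleD(1)[OF a(1)] admissibleD(1)[OF a(2)]] by blast
  qed
  then show ?thesis
    unfolding KN_def semistandard_def mem_Collect_eq split[OF adm]
    using adm c admissibleD(1) by blast
qed (auto simp: KN_def)

lemma KN_pair_trans: "KN_pair n C D \<Longrightarrow> KN_pair n D E \<Longrightarrow> admissible n D \<Longrightarrow> KN_pair n C E"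
  using column_dominates(3) dominates_trans unfolding KN_pair_def by blast

section \<open>Crystal operators on a column\<close>

lemma neutral_word:
  assumes "\<forall>x\<in>set A. letter_sign n i x = None"
  shows "eps n i A = 0 \<and> phi n i A = 0"
  using assms
proof (induction A)
  case (Cons x A)
  then show ?case using eps_Cons[of n i x A] phi_Cons[of n i x A] by (simp add: eps_single phi_single)
qed simp

lemma pair_word:
  "eps n i [x, y] = eps n i [x] + (eps n i [y] - phi n i [x])"
  "phi n i [x, y] = phi n i [y] + (phi n i [x] - eps n i [y])"
  "f_word n i [x, y] = (if phi n i [x] > eps n i [y] then Some [f_letter n i x, y]
     else map_option ((#) x) (f_word n i [y]))"
  using eps_append[of n i "[x]" "[y]"] phi_append[of n i "[x]" "[y]"] f_word_Cons[of n i x "[y]"] by simp_all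

text \<open>In increasing order the signed letters are \<open>i\<close>, \<open>i + 1\<close>,
  \<open>- (i + 1)\<close>, \<open>- i\<close>, so the signature of a column is a subword of plus
  minus plus minus. The predicate \<open>Q\<close> selects the letters present, which leaves sixteen
  cases.\<close>

lemma block_word:
  assumes "letter_sign n i a = Some Plus" "letter_sign n i b = Some Minus"
    "letter_sign n i c = Some Plus" "letter_sign n i d = Some Minus"
    and "\<forall>x\<in>set A. letter_sign n i x = None" "\<forall>x\<in>set B. letter_sign n i x = None"
    "\<forall>x\<in>set Z. letter_sign n i x = None"
  shows "f_word n i (A @ filter Q [a, b] @ B @ filter Q [c, d] @ Z) =
      (if Q a \<and> \<not> Q b \<and> \<not> (Q d \<and> \<not> Q c) then Some (A @ [f_letter n i a] @ B @ filter Q [c, d] @ Z)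
       else if Q c \<and> \<not> Q d then Some (A @ filter Q [a, b] @ B @ [f_letter n i c] @ Z) else None)"
    and "eps n i (A @ filter Q [a, b] @ B @ filter Q [c, d] @ Z) = 0 \<longleftrightarrow>
      \<not> (Q b \<and> \<not> Q a) \<and> \<not> (Q d \<and> \<not> Q c \<and> \<not> (Q a \<and> \<not> Q b))"
proof -
  note N = neutral_word[OF assms(5)] neutral_word[OF assms(6)] neutral_word[OF assms(7)]
  have F: "f_word n i A = None" "f_word n i B = None" "f_word n i Z = None"
    using N f_word_None by blast+
  note S = eps_single phi_single f_word_single pair_word assms(1-4) N F
  show "f_word n i (A @ filter Q [a, b] @ B @ filter Q [c, d] @ Z) =
      (if Q a \<and> \<not> Q b \<and> \<not> (Q d \<and> \<not> Q c) then Some (A @ [f_letter n i a] @ B @ filter Q [c, d] @ Z)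
       else if Q c \<and> \<not> Q d then Some (A @ filter Q [a, b] @ B @ [f_letter n i c] @ Z) else None)"
    unfolding f_word_append eps_append phi_append
    by (cases "Q a"; cases "Q b"; cases "Q c"; cases "Q d") (simp_all add: S)
  show "eps n i (A @ filter Q [a, b] @ B @ filter Q [c, d] @ Z) = 0 \<longleftrightarrow>
      \<not> (Q b \<and> \<not> Q a) \<and> \<not> (Q d \<and> \<not> Q c \<and> \<not> (Q a \<and> \<not> Q b))"
    unfolding f_word_append eps_append phi_append
    by (cases "Q a"; cases "Q b"; cases "Q c"; cases "Q d") (simp_all add: S)
qed

lemma block_word_last:
  assumes "letter_sign n i a = Some Plus" "letter_sign n i b = Some Minus"
    and "\<forall>x\<in>set A. letter_sign n i x = None" "\<forall>x\<in>set Z. letter_sign n i x = None"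
  shows "f_word n i (A @ filter Q [a, b] @ Z) =
      (if Q a \<and> \<not> Q b then Some (A @ [f_letter n i a] @ Z) else None)"
    and "eps n i (A @ filter Q [a, b] @ Z) = 0 \<longleftrightarrow> \<not> (Q b \<and> \<not> Q a)"
proof -
  note N = neutral_word[OF assms(3)] neutral_word[OF assms(4)]
  have F: "f_word n i A = None" "f_word n i Z = None"
    using N f_word_None by blast+
  note S = eps_single phi_single f_word_single pair_word assms(1,2) N F
  show "f_word n i (A @ filter Q [a, b] @ Z) =
      (if Q a \<and> \<not> Q b then Some (A @ [f_letter n i a] @ Z) else None)"
    unfolding f_word_append eps_append phi_append
    by (cases "Q a"; cases "Q b") (simp_all add: S)
  show "eps n i (A @ filter Q [a, b] @ Z) = 0 \<longleftrightarrow> \<not> (Q b \<and> \<not> Q a)"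
    unfolding f_word_append eps_append phi_append
    by (cases "Q a"; cases "Q b") (simp_all add: S)
qed

lemma letters_mid:
  assumes "1 \<le> i" "i < int n"
  shows "letters n = [1..i - 1] @ [i, i + 1] @ ([i + 2..int n] @ [- int n..- i - 2]) @
    [- (i + 1), - i] @ [- i + 1..- 1]"
proof -
  have "[1..int n] = [1..i - 1] @ i # (i + 1) # [i + 2..int n]"
    using assms upto_split3[of 1 i "int n"] upto_rec1[of "i + 1" "int n"] by (simp add: add.commute)
  moreover have "[- int n..- 1] = [- int n..- i - 1] @ - i # [- i + 1..- 1]"
    using assms upto_split3[of "- int n" "- i" "- 1"] by simp
  moreover have "[- int n..- i - 1] = [- int n..- i - 2] @ [- (i + 1)]"
  proof -
    have "(- i - 1) - 1 = - i - 2" "- (i + 1) = - i - 1" by simp_all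
    moreover have "[- int n..- i - 1] = [- int n..(- i - 1) - 1] @ [- i - 1]"
      by (rule upto_rec2) (use assms in simp)
    ultimately show ?thesis by metis
  qed
  ultimately show ?thesis by (simp add: letters_def)
qed

lemma letters_last:
  assumes "1 \<le> n"
  shows "letters n = [1..int n - 1] @ [int n, - int n] @ [- int n + 1..- 1]"
proof -
  have "[1..int n] = [1..int n - 1] @ [int n]" using assms upto_rec2[of 1 "int n"] by simp
  moreover have "[- int n..- 1] = - int n # [- int n + 1..- 1]" using assms upto_rec1[of "- int n" "- 1"] by simp
  ultimately show ?thesis by (simp add: letters_def)
qed

definition f_set :: "nat \<Rightarrow> int \<Rightarrow> int set \<Rightarrow> int set option" where
  "f_set n i S =
     (if i < int n then
        if i \<in> S \<and> i + 1 \<notin> S \<and> \<not> (- i \<in> S \<and> - (i + 1) \<notin> S) then Some (insert (i + 1) (S - {i}))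
        else if - (i + 1) \<in> S \<and> - i \<notin> S then Some (insert (- i) (S - {- (i + 1)}))
        else None
      else if i \<in> S \<and> - i \<notin> S then Some (insert (- i) (S - {i})) else None)"

lemma filter_agree: "(\<And>x. x \<in> set xs \<Longrightarrow> x \<in> S' \<longleftrightarrow> x \<in> S) \<Longrightarrow> filter (\<lambda>x. x \<in> S') xs = filter (\<lambda>x. x \<in> S) xs"
  by (rule filter_cong) auto

lemma letter_sign_values:
  assumes "1 \<le> i" "i < int n"
  shows "letter_sign n i i = Some Plus" "letter_sign n i (i + 1) = Some Minus"
    "letter_sign n i (- (i + 1)) = Some Plus" "letter_sign n i (- i) = Some Minus"
    "f_letter n i i = i + 1" "f_letter n i (- (i + 1)) = - i"
    "x \<noteq> i \<Longrightarrow> x \<noteq> i + 1 \<Longrightarrow> x \<noteq> - i \<Longrightarrow> x \<noteq> - (i + 1) \<Longrightarrow> letter_sign n i x = None"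
  using assms by (auto simp: letter_sign_def f_letter_def)

lemma f_eps_column:
  assumes i: "i \<in> {1..int n}"
  shows "f_word n i (column_of n S) = map_option (column_of n) (f_set n i S)" (is ?f)
    and "eps n i (column_of n S) = 0 \<longleftrightarrow>
      (if i < int n then \<not> (i + 1 \<in> S \<and> i \<notin> S) \<and>
         \<not> (- i \<in> S \<and> - (i + 1) \<notin> S \<and> \<not> (i \<in> S \<and> i + 1 \<notin> S))
       else \<not> (- i \<in> S \<and> i \<notin> S))" (is ?e)
proof -
  have "?f \<and> ?e"
  proof (cases "i < int n")
    case True
    have i1: "1 \<le> i" using i by simp
    let ?A = "[1..i - 1]" and ?B = "[i + 2..int n] @ [- int n..- i - 2]" and ?Z = "[- i + 1..- 1]"
    let ?F = "\<lambda>S xs. filter (\<lambda>x. x \<in> S) xs"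
    \<comment> \<open>Stated for every \<open>U\<close> that agrees with \<open>S\<close> off the
      four letters, so that the columns before and after the move share the same neutral
      segments.\<close>
    have col: "column_of n U = ?F S ?A @ ?F U [i, i + 1] @ ?F S ?B @ ?F U [- (i + 1), - i] @ ?F S ?Z"
      if "\<And>x. x \<notin> {i, i + 1, - i, - (i + 1)} \<Longrightarrow> x \<in> U \<longleftrightarrow> x \<in> S" for U
    proof -
      have "?F U ?A = ?F S ?A" by (rule filter_agree, rule that) (use True i1 in auto)
      moreover have "?F U ?B = ?F S ?B" by (rule filter_agree, rule that) (use True i1 in auto)
      moreover have "?F U ?Z = ?F S ?Z" by (rule filter_agree, rule that) (use True i1 in auto)
      ultimately show ?thesis unfolding column_of_def letters_mid[OF i1 True] filter_append by simp
    qed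
    have N: "\<forall>x\<in>set (?F S ?A). letter_sign n i x = None" "\<forall>x\<in>set (?F S ?B). letter_sign n i x = None"
      "\<forall>x\<in>set (?F S ?Z). letter_sign n i x = None"
      using True i1 by (auto intro!: letter_sign_values(7))
    note B = block_word[OF letter_sign_values(1-4)[OF i1 True] N, of "\<lambda>x. x \<in> S", folded col[of S, OF refl]]
    have ne: "i \<noteq> i + 1" "i \<noteq> - i" "i \<noteq> - (i + 1)" "i + 1 \<noteq> - i" "i + 1 \<noteq> - (i + 1)" "- i \<noteq> - (i + 1)"
      using i1 by auto
    have c1: "column_of n (insert (i + 1) (S - {i})) = ?F S ?A @ [i + 1] @ ?F S ?B @ ?F S [- (i + 1), - i] @ ?F S ?Z"
      if "i + 1 \<notin> S"
      by (subst col) (use ne in auto)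
    have c2: "column_of n (insert (- i) (S - {- (i + 1)})) = ?F S ?A @ ?F S [i, i + 1] @ ?F S ?B @ [- i] @ ?F S ?Z"
      if "- i \<notin> S"
      by (subst col) (use ne in auto)
    have ?f
      unfolding f_set_def B(1) letter_sign_values(5,6)[OF i1 True]
      using True c1 c2 by simp
    moreover have ?e unfolding B(2) using True by simp
    ultimately show ?thesis ..
  next
    case False
    then have n: "i = int n" "1 \<le> n" using i by auto
    let ?A = "[1..int n - 1]" and ?Z = "[- int n + 1..- 1]"
    let ?F = "\<lambda>S xs. filter (\<lambda>x. x \<in> S) xs"
    have col: "column_of n U = ?F S ?A @ ?F U [int n, - int n] @ ?F S ?Z"
      if "\<And>x. x \<notin> {int n, - int n} \<Longrightarrow> x \<in> U \<longleftrightarrow> x \<in> S" for U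
    proof -
      have "?F U ?A = ?F S ?A" by (rule filter_agree, rule that) (use n in auto)
      moreover have "?F U ?Z = ?F S ?Z" by (rule filter_agree, rule that) (use n in auto)
      ultimately show ?thesis unfolding column_of_def letters_last[OF n(2)] filter_append by simp
    qed
    have sg: "letter_sign n i (int n) = Some Plus" "letter_sign n i (- int n) = Some Minus" "f_letter n i (int n) = - int n"
      using n by (auto simp: letter_sign_def f_letter_def)
    have N: "\<forall>x\<in>set (?F S ?A). letter_sign n i x = None" "\<forall>x\<in>set (?F S ?Z). letter_sign n i x = None"
      using n by (auto simp: letter_sign_def)
    note B = block_word_last[OF sg(1,2) N, of "\<lambda>x. x \<in> S", folded col[of S, OF refl]]
    have c1: "column_of n (insert (- int n) (S - {int n})) = ?F S ?A @ [- int n] @ ?F S ?Z"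
      by (subst col) (use n in auto)
    have ?f unfolding f_set_def B(1) sg(3) using c1 n(1) by simp
    moreover have ?e unfolding B(2) using n(1) by simp
    ultimately show ?thesis ..
  qed
  then show ?f ?e by blast+
qed

section \<open>Crystal operators on split columns\<close>

text \<open>For neighbouring letters this is the 0-Hecke action: the transposition of
  \<open>a\<close> and \<open>s\<close> is applied if it increases the column, otherwise nothing
  happens.\<close>

definition move :: "int \<Rightarrow> int \<Rightarrow> int set \<Rightarrow> int set" where
  "move a s A = (if a \<in> A \<and> s \<notin> A then insert s (A - {a}) else A)"

lemma cnt_at:
  assumes "A \<subseteq> set (letters n)" "a \<in> set (letters n)"
  shows "cnt n A (rank n a) = cnt n A (rank n a - 1) + (if a \<in> A then 1 else 0)"
proof -
  let ?L = "{y \<in> A. rank n y \<le> rank n a - 1}"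
  have "{y \<in> A. rank n y \<le> rank n a} = ?L \<union> (if a \<in> A then {a} else {})" (is "?U = _")
  proof -
    have "rank n y < rank n a" if "y \<in> A" "rank n y \<le> rank n a" "y \<noteq> a" for y
      using that assms rank_inj[of y n a] by force
    then show ?thesis by auto
  qed
  then show ?thesis using finite_letters[OF assms(1)] by (simp add: cnt_def)
qed

lemma cnt_move:
  assumes "A \<subseteq> set (letters n)" "a \<in> set (letters n)" "s \<in> set (letters n)" "rank n s = rank n a + 1"
  shows "cnt n A r = cnt n (move a s A) r + (if a \<in> A \<and> s \<notin> A \<and> r = rank n a then 1 else 0)"
proof (cases "a \<in> A \<and> s \<notin> A")
  case True
  have fin: "finite {y \<in> A. rank n y \<le> r}" using finite_letters[OF assms(1)] by simp
  consider "r < rank n a" | "r = rank n a" | "rank n s \<le> r" using assms(4) by linarith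
  then show ?thesis
  proof cases
    case 1
    then have "{y \<in> move a s A. rank n y \<le> r} = {y \<in> A. rank n y \<le> r}"
      using True assms(4) by (auto simp: move_def)
    then show ?thesis using 1 by (simp add: cnt_def)
  next
    case 2
    then have "{y \<in> move a s A. rank n y \<le> r} = {y \<in> A. rank n y \<le> r} - {a}"
      using True assms(4) by (auto simp: move_def)
    moreover have "a \<in> {y \<in> A. rank n y \<le> r}" using 2 True by simp
    ultimately have "card {y \<in> A. rank n y \<le> r} = Suc (card {y \<in> move a s A. rank n y \<le> r})"
      using card.remove[OF fin] by simp
    then show ?thesis using 2 True by (simp add: cnt_def)
  next
    case 3
    have "{y \<in> move a s A. rank n y \<le> r} = insert s ({y \<in> A. rank n y \<le> r} - {a})"
      using True 3 by (auto simp: move_def)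
    moreover have "a \<in> {y \<in> A. rank n y \<le> r}" using 3 True assms(4) by simp
    ultimately have "card {y \<in> move a s A. rank n y \<le> r} = card {y \<in> A. rank n y \<le> r}"
      using card.remove[OF fin, of a] True fin by simp
    then show ?thesis using 3 True assms(4) by (simp add: cnt_def)
  qed
qed (auto simp: move_def)

lemma move_subset: "A \<subseteq> set (letters n) \<Longrightarrow> s \<in> set (letters n) \<Longrightarrow> move a s A \<subseteq> set (letters n)"
  by (auto simp: move_def)

text \<open>
  The two halves of the lifting property of the Bruhat order: the only count that drops is the one
  at \<open>a\<close>, and equality there would put \<open>B\<close> in the excluded configuration.
\<close>

lemma dominates_move_left:
  assumes "dominates n A B" "\<not> (a \<in> B \<and> s \<notin> B)"
    and L: "A \<subseteq> set (letters n)" "B \<subseteq> set (letters n)" "a \<in> set (letters n)" "s \<in> set (letters n)"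
    and s: "rank n s = rank n a + 1"
  shows "dominates n (move a s A) B"
  unfolding dominates_def
proof
  fix r
  have le: "cnt n B r \<le> cnt n A r" for r using assms(1) by (simp add: dominates_def)
  show "cnt n B r \<le> cnt n (move a s A) r"
  proof (cases "a \<in> A \<and> s \<notin> A \<and> r = rank n a")
    case True
    then have m: "cnt n A r = cnt n (move a s A) r + 1" using cnt_move[OF L(1,3,4) s, of r] by simp
    \<comment> \<open>Suppose \<open>A\<close> and \<open>B\<close> had equal counts at
      \<open>r\<close>. As \<open>a\<close> is in \<open>A\<close>, comparing the counts at
      \<open>r - 1\<close> forces \<open>a\<close> into \<open>B\<close>; as \<open>s\<close> is not
      in \<open>A\<close>, comparing those at \<open>r + 1\<close> keeps \<open>s\<close> out of
      \<open>B\<close>. This is the excluded case.\<close>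
    show ?thesis
      using m True assms(2) le[of r] le[of "r - 1"] le[of "r + 1"] s
        cnt_at[OF L(1,3)] cnt_at[OF L(2,3)] cnt_at[OF L(1,4)] cnt_at[OF L(2,4)]
      by (auto split: if_splits)
  next
    case False
    then show ?thesis using cnt_move[OF L(1,3,4) s, of r] le[of r] by (auto split: if_splits)
  qed
qed

lemma dominates_move_right:
  assumes "dominates n A (move a s B)" "\<not> (s \<in> A \<and> a \<notin> A)"
    and L: "A \<subseteq> set (letters n)" "B \<subseteq> set (letters n)" "a \<in> set (letters n)" "s \<in> set (letters n)"
    and s: "rank n s = rank n a + 1"
  shows "dominates n A B"
  unfolding dominates_def
proof
  fix r
  have le: "cnt n (move a s B) r \<le> cnt n A r" for r using assms(1) by (simp add: dominates_def)
  note m = cnt_move[OF L(2,3,4) s]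
  show "cnt n B r \<le> cnt n A r"
  proof (cases "a \<in> B \<and> s \<notin> B \<and> r = rank n a")
    case True
    show ?thesis
      using m[of r] m[of "r - 1"] m[of "r + 1"] True assms(2) le[of r] le[of "r - 1"] le[of "r + 1"] s
        cnt_at[OF L(1,3)] cnt_at[OF L(2,3)] cnt_at[OF L(1,4)] cnt_at[OF L(2,4)]
      by (auto split: if_splits)
  next
    case False
    then show ?thesis using m[of r] le[of r] by (auto split: if_splits)
  qed
qed

lemma dominates_move:
  assumes "A \<subseteq> set (letters n)" "a \<in> set (letters n)" "s \<in> set (letters n)" "rank n s = rank n a + 1"
  shows "dominates n A (move a s A)"
  unfolding dominates_def using cnt_move[OF assms] by (metis le_add1)

text \<open>A simple reflection of type C permutes the alphabet: for \<open>i < n\<close> it is a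
  product of two commuting transpositions of neighbouring letters, for \<open>i = n\<close> a single
  one.\<close>

definition step :: "nat \<Rightarrow> int \<Rightarrow> int set \<Rightarrow> int set" where
  "step n i A = (if i < int n then move (- (i + 1)) (- i) (move i (i + 1) A) else move i (- i) A)"

text \<open>For \<open>i\<close> in \<open>{1..int n}\<close> this holds exactly when
  \<open>step n i\<close> changes \<open>A\<close>; its negation is the side condition under which
  the lifting property applies. \<open>raisable\<close> is the same for the opposite
  direction.\<close>

definition lowerable :: "nat \<Rightarrow> int \<Rightarrow> int set \<Rightarrow> bool" where
  "lowerable n i A \<longleftrightarrow> (if i < int n then i \<in> A \<and> i + 1 \<notin> A \<or> - (i + 1) \<in> A \<and> - i \<notin> A
     else i \<in> A \<and> - i \<notin> A)"

definition raisable :: "nat \<Rightarrow> int \<Rightarrow> int set \<Rightarrow> bool" where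
  "raisable n i A \<longleftrightarrow> (if i < int n then i + 1 \<in> A \<and> i \<notin> A \<or> - i \<in> A \<and> - (i + 1) \<notin> A
     else - i \<in> A \<and> i \<notin> A)"

lemma letters_step:
  assumes "i \<in> {1..int n}"
  shows "i \<in> set (letters n)" "- i \<in> set (letters n)"
    and "i < int n \<Longrightarrow> i + 1 \<in> set (letters n)" "i < int n \<Longrightarrow> - (i + 1) \<in> set (letters n)"
    and "rank n (i + 1) = rank n i + 1" "i < int n \<Longrightarrow> rank n (- i) = rank n (- (i + 1)) + 1"
    and "\<not> i < int n \<Longrightarrow> rank n (- i) = rank n i + 1"
  using assms by (auto simp: set_letters rank_def)

lemma dominates_step_left:
  assumes "dominates n A B" "\<not> lowerable n i B" "A \<subseteq> set (letters n)" "B \<subseteq> set (letters n)" "i \<in> {1..int n}"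
  shows "dominates n (step n i A) B"
proof (cases "i < int n")
  case True
  note L = letters_step[OF assms(5)]
  have "dominates n (move i (i + 1) A) B"
    by (rule dominates_move_left) (use assms True L in \<open>auto simp: lowerable_def\<close>)
  then have "dominates n (move (- (i + 1)) (- i) (move i (i + 1) A)) B"
    by (rule dominates_move_left) (use assms True L move_subset in \<open>auto simp: lowerable_def\<close>)
  then show ?thesis using True by (simp add: step_def)
next
  case False
  have "dominates n (move i (- i) A) B"
    by (rule dominates_move_left) (use assms False letters_step[OF assms(5)] in \<open>auto simp: lowerable_def\<close>)
  then show ?thesis using False by (simp add: step_def)
qed

lemma dominates_step_right:
  assumes "dominates n A (step n i B)" "\<not> raisable n i A" "A \<subseteq> set (letters n)" "B \<subseteq> set (letters n)" "i \<in> {1..int n}"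
  shows "dominates n A B"
proof (cases "i < int n")
  case True
  note L = letters_step[OF assms(5)]
  have "dominates n A (move (- (i + 1)) (- i) (move i (i + 1) B))" using assms(1) True by (simp add: step_def)
  then have "dominates n A (move i (i + 1) B)"
    by (rule dominates_move_right) (use assms True L move_subset in \<open>auto simp: raisable_def\<close>)
  then show ?thesis
    by (rule dominates_move_right) (use assms True L in \<open>auto simp: raisable_def\<close>)
next
  case False
  then have "dominates n A (move i (- i) B)" using assms(1) by (simp add: step_def)
  then show ?thesis
    by (rule dominates_move_right) (use assms False letters_step[OF assms(5)] in \<open>auto simp: raisable_def\<close>)
qed

lemma dominates_step:
  assumes "A \<subseteq> set (letters n)" "i \<in> {1..int n}"
  shows "dominates n A (step n i A)"
proof (cases "i < int n")
  case True
  note L = letters_step[OF assms(2)]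
  have "dominates n A (move i (i + 1) A)" by (rule dominates_move) (use assms True L in auto)
  also have "dominates n (move i (i + 1) A) (move (- (i + 1)) (- i) (move i (i + 1) A))"
    by (rule dominates_move) (use assms True L move_subset in auto)
  finally show ?thesis using True by (simp add: step_def)
next
  case False
  then show ?thesis using assms letters_step[OF assms(2)] by (auto simp: step_def intro!: dominates_move)
qed

section \<open>Locality of the matching and its effect on split columns\<close>

lemma pend_taken_cong:
  assumes "\<And>k. k \<in> set ks \<Longrightarrow> (k \<in> S' \<longleftrightarrow> k \<in> S) \<and> (- k \<in> S' \<longleftrightarrow> - k \<in> S)"
  shows "pend S' c ks = pend S c ks \<and> taken S' c ks = taken S c ks"
  using assms by (induction ks arbitrary: c) auto

text \<open>The scan meets \<open>i + 1\<close> and \<open>i\<close> as one block, and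
  \<open>c\<close> is the number of parentheses open on arrival. If the block acts on the counter as
  before, the scan outside the block cannot notice the change.\<close>

lemma partner_set_block:
  assumes "1 \<le> i" "i < int n" and agree: "\<And>x. x \<notin> {i, i + 1, - i, - (i + 1)} \<Longrightarrow> x \<in> S' \<longleftrightarrow> x \<in> S"
    and pend: "\<And>c. pend S' c [i + 1, i] = pend S c [i + 1, i]"
  obtains c where "balanced n S' \<longleftrightarrow> balanced n S"
    "\<And>x. x \<notin> {i, i + 1} \<Longrightarrow> x \<in> partner_set n S' \<longleftrightarrow> x \<in> partner_set n S"
    "\<And>x. x \<in> {i, i + 1} \<Longrightarrow> x \<in> partner_set n S \<longleftrightarrow> x \<in> set (taken S c [i + 1, i])"
    "\<And>x. x \<in> {i, i + 1} \<Longrightarrow> x \<in> partner_set n S' \<longleftrightarrow> x \<in> set (taken S' c [i + 1, i])"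
proof -
  let ?X = "rev [i + 2..int n]" and ?c = "pend S 0 (rev [i + 2..int n])"
  have "[1..int n] = [1..i - 1] @ i # (i + 1) # [i + 2..int n]"
    using assms(1,2) upto_split3[of 1 i "int n"] upto_rec1[of "i + 1" "int n"] by (simp add: add.commute)
  then have d: "desc (int n) = ?X @ [i + 1, i] @ desc (i - 1)" by simp
  have X: "pend S' c ?X = pend S c ?X \<and> taken S' c ?X = taken S c ?X" for c
    by (rule pend_taken_cong) (use assms(1,2) agree in auto)
  have Z: "pend S' c (desc (i - 1)) = pend S c (desc (i - 1)) \<and> taken S' c (desc (i - 1)) = taken S c (desc (i - 1))" for c
    by (rule pend_taken_cong) (use assms(1,2) agree in auto)
  have B: "balanced n S' \<longleftrightarrow> balanced n S"
    unfolding balanced_def d pend_append using X Z pend by simp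
  have P: "partner_set n U = set (taken U 0 ?X) \<union> set (taken U (pend U 0 ?X) [i + 1, i]) \<union>
      set (taken U (pend U (pend U 0 ?X) [i + 1, i]) (desc (i - 1)))" for U
    unfolding partner_set_def d taken_append by auto
  let ?Z = "set (taken S (pend S ?c [i + 1, i]) (desc (i - 1)))"
  have PS: "partner_set n S = set (taken S 0 ?X) \<union> set (taken S ?c [i + 1, i]) \<union> ?Z"
    "partner_set n S' = set (taken S 0 ?X) \<union> set (taken S' ?c [i + 1, i]) \<union> ?Z"
    unfolding P using X Z pend by simp_all
  have out: "x \<notin> set (taken S 0 ?X)" "x \<notin> ?Z" if "x \<in> {i, i + 1}" for x
    using that taken_set[of S 0 ?X] taken_set[of S "pend S ?c [i + 1, i]" "desc (i - 1)"] by auto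
  have mid: "set (taken U ?c [i + 1, i]) \<subseteq> {i, i + 1}" for U
    using taken_set[of U ?c "[i + 1, i]"] by auto
  show thesis
  proof (rule that[OF B])
    show "x \<in> partner_set n S' \<longleftrightarrow> x \<in> partner_set n S" if "x \<notin> {i, i + 1}" for x
      unfolding PS using mid that by blast
    show "x \<in> partner_set n S \<longleftrightarrow> x \<in> set (taken S ?c [i + 1, i])" if "x \<in> {i, i + 1}" for x
      unfolding PS using out that by blast
    show "x \<in> partner_set n S' \<longleftrightarrow> x \<in> set (taken S' ?c [i + 1, i])" if "x \<in> {i, i + 1}" for x
      unfolding PS using out that by blast
  qed
qed

lemma partner_set_last:
  assumes "1 \<le> n" and agree: "\<And>x. x \<notin> {int n, - int n} \<Longrightarrow> x \<in> S' \<longleftrightarrow> x \<in> S"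
    and "vac S (int n) = vac S' (int n)" "dbl S (int n) = dbl S' (int n)"
  shows "balanced n S' \<longleftrightarrow> balanced n S" "partner_set n S' = partner_set n S"
proof -
  have d: "desc (int n) = int n # desc (int n - 1)" using assms(1) by (intro desc_rec) simp
  have Z: "pend S' c (desc (int n - 1)) = pend S c (desc (int n - 1)) \<and>
    taken S' c (desc (int n - 1)) = taken S c (desc (int n - 1))" for c
    by (rule pend_taken_cong) (use agree in auto)
  show "balanced n S' \<longleftrightarrow> balanced n S" "partner_set n S' = partner_set n S"
    unfolding balanced_def partner_set_def d using Z assms(3,4) by auto
qed

text \<open>The scan starts at \<open>n\<close> with nothing open, so there is nothing for
  \<open>n\<close> to close.\<close>

lemma last_not_partner: "int n \<notin> partner_set n S"
proof (cases "n = 0")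
  case False
  then have d: "desc (int n) = int n # desc (int n - 1)" by (intro desc_rec) simp
  show ?thesis
    using taken_set[of S 0 "desc (int n - 1)"] taken_set[of S 1 "desc (int n - 1)"]
    unfolding partner_set_def d by auto
qed (use partner_set_subset[of n S] in auto)

lemma rset_lset_mem:
  assumes "0 < x"
  shows "x \<in> rset n S \<longleftrightarrow> x \<in> S" "- x \<in> rset n S \<longleftrightarrow> - x \<in> S \<and> x \<notin> S \<or> x \<in> partner_set n S"
    "x \<in> lset n S \<longleftrightarrow> x \<in> S \<and> - x \<notin> S \<or> x \<in> partner_set n S" "- x \<in> lset n S \<longleftrightarrow> - x \<in> S"
proof -
  have p: "0 < z" if "z \<in> partner_set n S" for z using that partner_set_subset[of n S] by fastforce
  have "- x \<notin> partner_set n S" using p[of "- x"] assms by auto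
  then show "x \<in> rset n S \<longleftrightarrow> x \<in> S" "- x \<in> rset n S \<longleftrightarrow> - x \<in> S \<and> x \<notin> S \<or> x \<in> partner_set n S"
    "x \<in> lset n S \<longleftrightarrow> x \<in> S \<and> - x \<notin> S \<or> x \<in> partner_set n S" "- x \<in> lset n S \<longleftrightarrow> - x \<in> S"
    using assms p by (auto simp: rset_def lset_def image_iff)
qed

definition eps_zero :: "nat \<Rightarrow> int \<Rightarrow> int set \<Rightarrow> bool" where
  "eps_zero n i S \<longleftrightarrow> (if i < int n then \<not> (i + 1 \<in> S \<and> i \<notin> S) \<and>
       \<not> (- i \<in> S \<and> - (i + 1) \<notin> S \<and> \<not> (i \<in> S \<and> i + 1 \<notin> S))
     else \<not> (- i \<in> S \<and> i \<notin> S))"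

lemma eq_iff_four:
  fixes X Y :: "int set"
  assumes "\<And>x. x \<notin> {i, b, - i, - b} \<Longrightarrow> x \<in> X \<longleftrightarrow> x \<in> Y"
  shows "X = Y \<longleftrightarrow> (i \<in> X \<longleftrightarrow> i \<in> Y) \<and> (b \<in> X \<longleftrightarrow> b \<in> Y) \<and> (- i \<in> X \<longleftrightarrow> - i \<in> Y) \<and> (- b \<in> X \<longleftrightarrow> - b \<in> Y)"
proof -
  have "X = Y \<longleftrightarrow> (\<forall>x\<in>{i, b, - i, - b}. x \<in> X \<longleftrightarrow> x \<in> Y)" using assms by blast
  then show ?thesis by simp
qed

lemma rset_lset_agree:
  assumes "S \<subseteq> set (letters n)" "S' \<subseteq> set (letters n)"
    and "\<And>x. x \<notin> {i, b, - i, - b} \<Longrightarrow> x \<in> S' \<longleftrightarrow> x \<in> S"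
    and "\<And>x. x \<notin> {i, b} \<Longrightarrow> x \<in> partner_set n S' \<longleftrightarrow> x \<in> partner_set n S"
    and x: "x \<notin> {i, b, - i, - b}"
  shows "(x \<in> rset n S' \<longleftrightarrow> x \<in> rset n S) \<and> (x \<in> lset n S' \<longleftrightarrow> x \<in> lset n S)"
proof -
  have mx: "- x \<notin> {i, b, - i, - b}" using x by auto
  note ag = assms(3)[OF x] assms(3)[OF mx] assms(4)[of x] assms(4)[of "- x"]
  consider "0 < x" | "0 < - x" | "x = 0" by linarith
  then show ?thesis
  proof cases
    case 1
    then show ?thesis using ag x by (simp add: rset_lset_mem)
  next
    case 2
    then show ?thesis using ag mx rset_lset_mem[OF 2, of n S] rset_lset_mem[OF 2, of n S'] by simp
  next
    case 3
    then show ?thesis using rset_subset[OF assms(1)] rset_subset[OF assms(2)]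
        lset_subset[OF assms(1)] lset_subset[OF assms(2)] by (auto simp: set_letters)
  qed
qed

text \<open>For \<open>i < n\<close> an \<open>i\<close>-string of columns has length 2 only if it
  shows \<open>{i, - (i + 1)}\<close>, \<open>{i + 1, - (i + 1)}\<close>,
  \<open>{i + 1, - i}\<close> on the four letters. In the middle \<open>i\<close> is a partner, so
  the right column has already moved and the left one has not. Thus the right column can change only
  at the start of a string and the left one only at its end. These side conditions are what the
  lifting property is fed with later.\<close>

lemma f_set_split:
  assumes S: "S \<subseteq> set (letters n)" and i: "i \<in> {1..int n}" and f: "f_set n i S = Some S'"
  shows "S' \<subseteq> set (letters n) \<and> card S' = card S \<and> (balanced n S' \<longleftrightarrow> balanced n S) \<and>
    (rset n S' = rset n S \<or> eps_zero n i S \<and> rset n S' = step n i (rset n S)) \<and>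
    (lset n S' = lset n S \<or> f_set n i S' = None \<and> lset n S' = step n i (lset n S))"
proof -
  have card: "card (insert y (S - {x})) = card S" if "x \<in> S" "y \<notin> S" for x y
    using that finite_letters[OF S] card.remove[of S x] by simp
  show ?thesis
  proof (cases "i < int n")
    case True
    \<comment> \<open>The abbreviation prevents arithmetic on \<open>i + 1\<close>, so that the four
      letters are atoms told apart by \<open>ne\<close>.\<close>
    define b where "b = i + 1"
    have i1: "1 \<le> i" using i by simp
    have pos: "0 < i" "0 < b" using i by (auto simp: b_def)
    have ne: "i \<noteq> b" "b \<noteq> i" "- i \<noteq> b" "- b \<noteq> i" "i \<noteq> - b" "b \<noteq> - i" "- i \<noteq> i" "- b \<noteq> b" "i \<noteq> - i" "b \<noteq> - b"
      using pos by (auto simp: b_def)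
    have L: "i \<in> set (letters n)" "b \<in> set (letters n)" "- i \<in> set (letters n)" "- b \<in> set (letters n)"
      using letters_step[OF i] True by (auto simp: b_def)
    have bi: "i + 1 = b" by (simp add: b_def)
    note D = f_set_def[of n i, unfolded bi] step_def[of n i, unfolded bi] eps_zero_def[of n i, unfolded bi]
    have case12: "i \<in> S \<and> b \<notin> S \<and> \<not> (- i \<in> S \<and> - b \<notin> S) \<and> S' = insert b (S - {i}) \<or>
        \<not> (i \<in> S \<and> b \<notin> S) \<and> - b \<in> S \<and> - i \<notin> S \<and> S' = insert (- i) (S - {- b})"
      using f True unfolding D by (auto split: if_splits)
    have sub: "S' \<subseteq> set (letters n)" using case12 S L by auto
    have cd: "card S' = card S" using case12 card by auto
    have agree: "x \<in> S' \<longleftrightarrow> x \<in> S" if "x \<notin> {i, b, - i, - b}" for x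
      using case12 that by (elim disjE conjE) auto
    have pend: "pend S' c [b, i] = pend S c [b, i]" for c
      using case12 ne by (elim disjE conjE) auto
    obtain c where bal: "balanced n S' \<longleftrightarrow> balanced n S"
      and J: "\<And>x. x \<notin> {i, b} \<Longrightarrow> x \<in> partner_set n S' \<longleftrightarrow> x \<in> partner_set n S"
        "\<And>x. x \<in> {i, b} \<Longrightarrow> x \<in> partner_set n S \<longleftrightarrow> x \<in> set (taken S c [b, i])"
        "\<And>x. x \<in> {i, b} \<Longrightarrow> x \<in> partner_set n S' \<longleftrightarrow> x \<in> set (taken S' c [b, i])"
    proof (rule partner_set_block[of i n S' S, unfolded bi, OF i1 True])
      show "x \<in> S' \<longleftrightarrow> x \<in> S" if "x \<notin> {i, b, - i, - b}" for x by (rule agree[OF that])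
      show "pend S' c [b, i] = pend S c [b, i]" for c by (rule pend)
    qed (rule that)
    note ag = rset_lset_agree[OF S sub agree J(1)]
    have st: "x \<in> step n i A \<longleftrightarrow> x \<in> A" if "x \<notin> {i, b, - i, - b}" for x A
      using that True unfolding D by (auto simp: move_def)
    have eqs: "rset n S' = rset n S \<longleftrightarrow> (i \<in> rset n S' \<longleftrightarrow> i \<in> rset n S) \<and> (b \<in> rset n S' \<longleftrightarrow> b \<in> rset n S) \<and>
        (- i \<in> rset n S' \<longleftrightarrow> - i \<in> rset n S) \<and> (- b \<in> rset n S' \<longleftrightarrow> - b \<in> rset n S)"
      "lset n S' = lset n S \<longleftrightarrow> (i \<in> lset n S' \<longleftrightarrow> i \<in> lset n S) \<and> (b \<in> lset n S' \<longleftrightarrow> b \<in> lset n S) \<and>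
        (- i \<in> lset n S' \<longleftrightarrow> - i \<in> lset n S) \<and> (- b \<in> lset n S' \<longleftrightarrow> - b \<in> lset n S)"
      "rset n S' = step n i (rset n S) \<longleftrightarrow> (i \<in> rset n S' \<longleftrightarrow> i \<in> step n i (rset n S)) \<and> (b \<in> rset n S' \<longleftrightarrow> b \<in> step n i (rset n S)) \<and>
        (- i \<in> rset n S' \<longleftrightarrow> - i \<in> step n i (rset n S)) \<and> (- b \<in> rset n S' \<longleftrightarrow> - b \<in> step n i (rset n S))"
      "lset n S' = step n i (lset n S) \<longleftrightarrow> (i \<in> lset n S' \<longleftrightarrow> i \<in> step n i (lset n S)) \<and> (b \<in> lset n S' \<longleftrightarrow> b \<in> step n i (lset n S)) \<and>
        (- i \<in> lset n S' \<longleftrightarrow> - i \<in> step n i (lset n S)) \<and> (- b \<in> lset n S' \<longleftrightarrow> - b \<in> step n i (lset n S))"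
      by (rule eq_iff_four, use ag st in blast)+
    have stm: "i \<in> step n i A \<longleftrightarrow> i \<in> A \<and> b \<in> A" "b \<in> step n i A \<longleftrightarrow> i \<in> A \<or> b \<in> A"
      "- b \<in> step n i A \<longleftrightarrow> - b \<in> A \<and> - i \<in> A" "- i \<in> step n i A \<longleftrightarrow> - b \<in> A \<or> - i \<in> A" for A
      using True ne unfolding D by (auto simp: move_def)
    note R = eqs stm rset_lset_mem[OF pos(1)] rset_lset_mem[OF pos(2)]
    have "(rset n S' = rset n S \<or> eps_zero n i S \<and> rset n S' = step n i (rset n S)) \<and>
      (lset n S' = lset n S \<or> f_set n i S' = None \<and> lset n S' = step n i (lset n S))"
      using case12
    proof
      assume 1: "i \<in> S \<and> b \<notin> S \<and> \<not> (- i \<in> S \<and> - b \<notin> S) \<and> S' = insert b (S - {i})"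
      then have m: "i \<in> S" "b \<notin> S" "i \<notin> S'" "b \<in> S'" "- i \<in> S' \<longleftrightarrow> - i \<in> S" "- b \<in> S' \<longleftrightarrow> - b \<in> S"
        "\<not> (- i \<in> S \<and> - b \<notin> S)"
        using ne by auto
      \<comment> \<open>All memberships are decided by the letters present and by whether a
        parenthesis is open when the block is entered.\<close>
      show ?thesis unfolding R unfolding D
        using m True ne by (cases "c > 0"; cases "- i \<in> S"; cases "- b \<in> S") (simp_all add: J(2,3))
    next
      assume 2: "\<not> (i \<in> S \<and> b \<notin> S) \<and> - b \<in> S \<and> - i \<notin> S \<and> S' = insert (- i) (S - {- b})"
      then have m: "\<not> (i \<in> S \<and> b \<notin> S)" "- b \<in> S" "- i \<notin> S" "- b \<notin> S'" "- i \<in> S'"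
        "i \<in> S' \<longleftrightarrow> i \<in> S" "b \<in> S' \<longleftrightarrow> b \<in> S"
        using ne by auto
      show ?thesis unfolding R unfolding D
        using m True ne by (cases "c > 0"; cases "i \<in> S"; cases "b \<in> S") (simp_all add: J(2,3))
    qed
    then show ?thesis using sub cd bal by blast
  next
    case False
    then have n: "i = int n" "1 \<le> n" using i by auto
    have S': "int n \<in> S" "- int n \<notin> S" "S' = insert (- int n) (S - {int n})"
      using f n unfolding f_set_def by (auto split: if_splits)
    have sub: "S' \<subseteq> set (letters n)" using S S' n by (auto simp: set_letters)
    have cd: "card S' = card S" using card S' by simp
    have ne: "int n \<noteq> - int n" using n by simp
    have agree: "x \<in> S' \<longleftrightarrow> x \<in> S" if "x \<notin> {int n, - int n}" for x using S'(3) that by auto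
    have J: "balanced n S' \<longleftrightarrow> balanced n S" "partner_set n S' = partner_set n S"
      by (rule partner_set_last[OF n(2) agree]; use S' ne in auto)+
    \<comment> \<open>For \<open>i = n\<close> the block is the single position \<open>n\<close>;
      the lemmas on four letters are used with both positions equal to \<open>n\<close>, hence the
      repetitions.\<close>
    have ag: "(x \<in> rset n S' \<longleftrightarrow> x \<in> rset n S) \<and> (x \<in> lset n S' \<longleftrightarrow> x \<in> lset n S)"
      if "x \<notin> {int n, int n, - int n, - int n}" for x
      by (rule rset_lset_agree[OF S sub _ _ that]) (use agree J in auto)
    have st: "x \<in> step n i A \<longleftrightarrow> x \<in> A" if "x \<notin> {int n, int n, - int n, - int n}" for x A
      using that unfolding step_def n(1) by (auto simp: move_def)
    have eqs: "rset n S' = step n i (rset n S) \<longleftrightarrow> (int n \<in> rset n S' \<longleftrightarrow> int n \<in> step n i (rset n S)) \<and>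
        (int n \<in> rset n S' \<longleftrightarrow> int n \<in> step n i (rset n S)) \<and>
        (- int n \<in> rset n S' \<longleftrightarrow> - int n \<in> step n i (rset n S)) \<and> (- int n \<in> rset n S' \<longleftrightarrow> - int n \<in> step n i (rset n S))"
      "lset n S' = step n i (lset n S) \<longleftrightarrow> (int n \<in> lset n S' \<longleftrightarrow> int n \<in> step n i (lset n S)) \<and>
        (int n \<in> lset n S' \<longleftrightarrow> int n \<in> step n i (lset n S)) \<and>
        (- int n \<in> lset n S' \<longleftrightarrow> - int n \<in> step n i (lset n S)) \<and> (- int n \<in> lset n S' \<longleftrightarrow> - int n \<in> step n i (lset n S))"
      by (rule eq_iff_four, use ag st in blast)+
    have pos: "0 < int n" using n by simp
    have m: "int n \<notin> S'" "- int n \<in> S'" using S' ne by auto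
    have "eps_zero n i S \<and> rset n S' = step n i (rset n S) \<and> f_set n i S' = None \<and> lset n S' = step n i (lset n S)"
      unfolding eqs using m S' n(1) ne last_not_partner[of n]
      by (simp add: step_def move_def rset_lset_mem[OF pos] eps_zero_def f_set_def)
    then show ?thesis using sub cd J(1) by blast
  qed
qed

lemma partner_set_block_ex:
  assumes "1 \<le> i" "i < int n"
  shows "\<exists>c. \<forall>x\<in>{i, i + 1}. x \<in> partner_set n S \<longleftrightarrow> x \<in> set (taken S c [i + 1, i])"
proof (rule partner_set_block[OF assms, of S S])
  fix c
  assume "\<And>x. x \<in> {i, i + 1} \<Longrightarrow> x \<in> partner_set n S \<longleftrightarrow> x \<in> set (taken S c [i + 1, i])"
  then show ?thesis by blast
qed simp_all

text \<open>This supplies the side condition of \<open>dominates_step_left\<close> for the fixed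
  column to the right of a changed one. \<open>not_raisable_rset\<close> does the same for
  \<open>dominates_step_right\<close> and the column to the left.\<close>

lemma not_lowerable_lset:
  assumes S: "S \<subseteq> set (letters n)" and i: "i \<in> {1..int n}" and f: "f_set n i S = None"
  shows "\<not> lowerable n i (lset n S)"
proof (cases "i < int n")
  case True
  have pos: "0 < i" "0 < i + 1" using i by auto
  obtain c where J: "\<forall>x\<in>{i, i + 1}. x \<in> partner_set n S \<longleftrightarrow> x \<in> set (taken S c [i + 1, i])"
    using partner_set_block_ex[OF _ True] pos by force
  show ?thesis
    using f True unfolding lowerable_def f_set_def rset_lset_mem[OF pos(1)] rset_lset_mem[OF pos(2)]
    by (cases "i \<in> S"; cases "i + 1 \<in> S"; cases "- i \<in> S"; cases "- (i + 1) \<in> S"; cases "c > 0") (simp_all add: J)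
next
  case False
  then have n: "i = int n" "0 < int n" using i by auto
  show ?thesis
    using f unfolding lowerable_def f_set_def n(1) rset_lset_mem[OF n(2)]
    by (simp add: last_not_partner split: if_splits)
qed

lemma not_raisable_rset:
  assumes S: "S \<subseteq> set (letters n)" and i: "i \<in> {1..int n}" and e: "eps_zero n i S"
  shows "\<not> raisable n i (rset n S)"
proof (cases "i < int n")
  case True
  have pos: "0 < i" "0 < i + 1" using i by auto
  obtain c where J: "\<forall>x\<in>{i, i + 1}. x \<in> partner_set n S \<longleftrightarrow> x \<in> set (taken S c [i + 1, i])"
    using partner_set_block_ex[OF _ True] pos by force
  show ?thesis
    using e True unfolding raisable_def eps_zero_def rset_lset_mem[OF pos(1)] rset_lset_mem[OF pos(2)]
    by (cases "i \<in> S"; cases "i + 1 \<in> S"; cases "- i \<in> S"; cases "- (i + 1) \<in> S"; cases "c > 0") (simp_all add: J)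
next
  case False
  then have n: "i = int n" "0 < int n" using i by auto
  show ?thesis
    using e unfolding raisable_def eps_zero_def n(1) rset_lset_mem[OF n(2)]
    by (simp add: last_not_partner)
qed

section \<open>Stability of Kashiwara--Nakashima tableaux\<close>

lemma cr_Nil [simp]: "cr [] = []" and cr_Cons: "cr (C # T) = cr T @ C"
  and cr_append: "cr (T @ U) = cr U @ cr T"
  by (simp_all add: cr_def)

text \<open>Columns are read from right to left, so \<open>Y\<close> is read before
  \<open>C\<close>. As \<open>f\<^sub>i\<close> does not act in \<open>Y\<close>, the pluses
  surviving in \<open>Y\<close> are all absorbed by minuses of \<open>C\<close>; this inequality is
  the only trace of the bracketing that is needed further on.\<close>

lemma f_word_cr:
  assumes "f_word n i (cr T) = Some w"
  shows "\<exists>X C C' Y. T = X @ C # Y \<and> f_word n i C = Some C' \<and> w = cr (X @ C' # Y) \<and> phi n i (cr Y) \<le> eps n i C"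
  using assms
proof (induction T arbitrary: w)
  case (Cons C T)
  show ?case
  proof (cases "phi n i (cr T) > eps n i C")
    case True
    then obtain v where v: "f_word n i (cr T) = Some v" "w = v @ C"
      using Cons.prems by (auto simp: cr_Cons f_word_append)
    obtain X D D' Y where *: "T = X @ D # Y" "f_word n i D = Some D'" "v = cr (X @ D' # Y)"
      "phi n i (cr Y) \<le> eps n i D"
      using Cons.IH[OF v(1)] by blast
    have "C # T = (C # X) @ D # Y" "w = cr ((C # X) @ D' # Y)" using * v(2) by (simp_all add: cr_Cons)
    then show ?thesis using * by blast
  next
    case False
    then obtain C' where "f_word n i C = Some C'" "w = cr (C' # T)"
      using Cons.prems by (auto simp: cr_Cons f_word_append)
    then show ?thesis using False by (intro exI[of _ "[]"] exI[of _ C] exI[of _ C'] exI[of _ T]) simp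
  qed
qed simp

text \<open>Mirror image of \<open>f_word_cr\<close>, with the inequality now about the part
  \<open>X\<close> read after \<open>D\<close>. The last conjunct serves the induction, where it
  gives \<open>phi\<close> of the word to which a further column is appended.\<close>

lemma e_word_cr:
  assumes "e_word n i (cr T) = Some w"
  shows "\<exists>X D D' Y. T = X @ D # Y \<and> e_word n i D = Some D' \<and> w = cr (X @ D' # Y) \<and>
    eps n i (cr X) \<le> phi n i D \<and> phi n i (cr (D # Y)) = phi n i D"
  using assms
proof (induction T arbitrary: w)
  case (Cons C T)
  show ?case
  proof (cases "eps n i C > phi n i (cr T)")
    case True
    then obtain C' where "e_word n i C = Some C'" "w = cr (C' # T)"
      using Cons.prems by (auto simp: cr_Cons e_word_append)
    then show ?thesis
      using True by (intro exI[of _ "[]"] exI[of _ C] exI[of _ C'] exI[of _ T]) (simp add: cr_Cons phi_append)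
  next
    case False
    then obtain v where v: "e_word n i (cr T) = Some v" "w = v @ C"
      using Cons.prems by (auto simp: cr_Cons e_word_append)
    obtain X D D' Y where *: "T = X @ D # Y" "e_word n i D = Some D'" "v = cr (X @ D' # Y)"
      "eps n i (cr X) \<le> phi n i D" "phi n i (cr (D # Y)) = phi n i D"
      using Cons.IH[OF v(1)] by blast
    have "phi n i (cr T) = phi n i (cr X) + (phi n i D - eps n i (cr X))"
      using *(1,5) by (simp add: cr_append phi_append)
    then have "eps n i (cr (C # X)) \<le> phi n i D"
      using False *(4) by (simp add: cr_Cons eps_append)
    moreover have "C # T = (C # X) @ D # Y" "w = cr ((C # X) @ D' # Y)" using * v(2) by (simp_all add: cr_Cons)
    ultimately show ?thesis using * by blast
  qed
qed simp

lemma letter_less_uminus: "letter_less (- x) (- y) \<longleftrightarrow> letter_less y x"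
  by (auto simp: letter_less_def)

lemma star_column: "star (column_of n S) = column_of n (uminus ` S)"
proof (rule sorted_letter_less_unique)
  have "sorted_wrt letter_less (column_of n S)" "sorted_wrt letter_less (column_of n (uminus ` S))"
    using is_column_column_of by (auto simp: is_column_def)
  then show "sorted_wrt letter_less (star (column_of n S))" "sorted_wrt letter_less (column_of n (uminus ` S))"
    by (simp_all add: star_def sorted_wrt_map sorted_wrt_rev letter_less_uminus)
  show "set (star (column_of n S)) = set (column_of n (uminus ` S))"
    by (force simp: star_def column_of_def set_letters image_iff)
qed

lemma f_column:
  assumes "is_column n C" "i \<in> {1..int n}" "f_word n i C = Some C'"
  shows "is_column n C'" "f_set n i (set C) = Some (set C')"
proof -
  have S: "set C \<subseteq> set (letters n)" "C = column_of n (set C)" using assms(1) by (simp_all add: is_column_iff)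
  have "f_word n i C = map_option (column_of n) (f_set n i (set C))"
    using f_eps_column(1)[OF assms(2), of "set C"] S(2) by simp
  then obtain S' where S': "f_set n i (set C) = Some S'" "C' = column_of n S'" using assms(3) by (cases "f_set n i (set C)") simp_all
  have "S' \<subseteq> set (letters n)" using f_set_split[OF S(1) assms(2) S'(1)] by blast
  then show "is_column n C'" "f_set n i (set C) = Some (set C')"
    using S' by (simp_all add: is_column_column_of set_column_of)
qed

lemma e_column:
  assumes "is_column n C" "i \<in> {1..int n}" "e_word n i C = Some C'"
  shows "is_column n C'"
proof -
  have st: "is_column n (star D)" if "is_column n D" for D
    using that star_column is_column_column_of by (metis is_column_iff)
  have "f_word n i (star C) = Some (star C')" using assms f_word_star by simp
  then have "is_column n (star C')" using f_column(1)[OF st[OF assms(1)] assms(2)] by blast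
  then show ?thesis using st by fastforce
qed

text \<open>Admissibility is an equivalence here so that the lemma can also be read backwards, for a
  column obtained by \<open>e\<^sub>i\<close>.\<close>

lemma f_admissible:
  assumes "is_column n C" "i \<in> {1..int n}" "f_word n i C = Some C'"
  shows "is_column n C'" "admissible n C' \<longleftrightarrow> admissible n C" "length C' = length C"
    "rset n (set C') = rset n (set C) \<or> eps n i C = 0 \<and> rset n (set C') = step n i (rset n (set C))"
    "lset n (set C') = lset n (set C) \<or> phi n i C' = 0 \<and> lset n (set C') = step n i (lset n (set C))"
proof -
  note C' = f_column[OF assms]
  have S: "set C \<subseteq> set (letters n)" "C = column_of n (set C)" "C' = column_of n (set C')"
    using assms(1) C'(1) by (simp_all add: is_column_iff)
  note sp = f_set_split[OF S(1) assms(2) C'(2)]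
  show "is_column n C'" by (rule C')
  show "admissible n C' \<longleftrightarrow> admissible n C" using C'(1) assms(1) sp by (simp add: admissible_iff)
  show "length C' = length C"
    using sp distinct_card[OF distinct_column[OF assms(1)]] distinct_card[OF distinct_column[OF C'(1)]] by simp
  have "eps n i C = 0 \<longleftrightarrow> eps_zero n i (set C)"
    using f_eps_column(2)[OF assms(2), of "set C"] S(2) by (simp add: eps_zero_def)
  then show "rset n (set C') = rset n (set C) \<or> eps n i C = 0 \<and> rset n (set C') = step n i (rset n (set C))"
    using sp by blast
  have "phi n i C' = 0 \<longleftrightarrow> f_set n i (set C') = None"
    using f_eps_column(1)[OF assms(2), of "set C'"] S(3) f_word_None[of n i C'] by simp
  then show "lset n (set C') = lset n (set C) \<or> phi n i C' = 0 \<and> lset n (set C') = step n i (lset n (set C))"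
    using sp by metis
qed

lemma not_lowerable:
  assumes "admissible n D" "i \<in> {1..int n}" "phi n i D = 0"
  shows "\<not> lowerable n i (lset n (set D))"
proof -
  have D: "set D \<subseteq> set (letters n)" "D = column_of n (set D)"
    using admissibleD(1)[OF assms(1)] by (simp_all add: is_column_iff)
  have "f_set n i (set D) = None"
    using f_eps_column(1)[OF assms(2), of "set D"] D(2) f_word_None[of n i D] assms(3) by simp
  then show ?thesis by (rule not_lowerable_lset[OF D(1) assms(2)])
qed

lemma not_raisable:
  assumes "admissible n D" "i \<in> {1..int n}" "eps n i D = 0"
  shows "\<not> raisable n i (rset n (set D))"
proof -
  have D: "set D \<subseteq> set (letters n)" "D = column_of n (set D)"
    using admissibleD(1)[OF assms(1)] by (simp_all add: is_column_iff)
  have "eps_zero n i (set D)"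
    using f_eps_column(2)[OF assms(2), of "set D"] D(2) assms(3) by (simp add: eps_zero_def)
  then show ?thesis by (rule not_raisable_rset[OF D(1) assms(2)])
qed

lemma has_shape_replace: "length C' = length C \<Longrightarrow> has_shape \<mu> (X @ C # Y) \<Longrightarrow> has_shape \<mu> (X @ C' # Y)"
  by (simp add: has_shape_def)

lemma KN_replace:
  assumes "X @ C # Y \<in> KN n \<mu>" "length C' = length C" "admissible n C'"
    and "\<And>A. A \<in> set X \<Longrightarrow> KN_pair n A C'" "\<And>D. D \<in> set Y \<Longrightarrow> KN_pair n C' D"
  shows "X @ C' # Y \<in> KN n \<mu>"
  using assms has_shape_replace[OF assms(2)] by (auto simp: KN_iff sorted_wrt_append)

lemma admissible_subsets:
  assumes "admissible n C"
  shows "rset n (set C) \<subseteq> set (letters n)" "lset n (set C) \<subseteq> set (letters n)"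
  using admissibleD(2)[OF assms] rset_subset lset_subset by blast+

text \<open>To the left nothing can go wrong, because the left column of \<open>C\<close> can only
  increase. To the right, the right column changes only if \<open>eps n i C = 0\<close>; then the
  neighbour is not lowerable, and lifting preserves the comparison. Columns further right follow by
  transitivity.\<close>

lemma KN_f_closed:
  assumes "T \<in> KN n \<mu>" "i \<in> {1..int n}" "f_word n i (cr T) = Some w"
  shows "\<exists>T'\<in>KN n \<mu>. cr T' = w"
proof -
  obtain X C C' Y where T: "T = X @ C # Y" and f: "f_word n i C = Some C'" and w: "w = cr (X @ C' # Y)"
    and le: "phi n i (cr Y) \<le> eps n i C"
    using f_word_cr[OF assms(3)] by blast
  have adm: "admissible n A" if "A \<in> set T" for A using assms(1) that by (simp add: KN_iff)
  have pair: "\<And>A. A \<in> set X \<Longrightarrow> KN_pair n A C" "\<And>D. D \<in> set Y \<Longrightarrow> KN_pair n C D" "sorted_wrt (KN_pair n) Y"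
    using assms(1) by (auto simp: KN_iff T sorted_wrt_append)
  have C: "admissible n C" using adm T by simp
  note fa = f_admissible[OF admissibleD(1)[OF C] assms(2) f]
  have C': "admissible n C'" using fa(2) C by blast
  have X: "KN_pair n A C'" if "A \<in> set X" for A
    using pair(1)[OF that] fa(5) dominates_trans[OF _ dominates_step[OF admissible_subsets(2)[OF C] assms(2)]]
    unfolding KN_pair_def by metis
  have Y: "KN_pair n C' D" if D: "D \<in> set Y" for D
    using fa(4)
  proof
    assume "rset n (set C') = rset n (set C)"
    then show ?thesis using pair(2)[OF that] by (simp add: KN_pair_def)
  next
    assume r: "eps n i C = 0 \<and> rset n (set C') = step n i (rset n (set C))"
    obtain D0 Y' where Y: "Y = D0 # Y'" using D by (cases Y) auto
    \<comment> \<open>\<open>D0\<close> is the last factor of \<open>cr Y\<close>, so its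
      \<open>phi\<close> is at most that of \<open>cr Y\<close>, which is bounded by
      \<open>eps n i C = 0\<close>.\<close>
    have "phi n i D0 = 0" using le r by (simp add: Y cr_Cons phi_append)
    have D0: "admissible n D0" using adm T Y by simp
    have "dominates n (rset n (set C)) (lset n (set D0))" using pair(2)[of D0] Y by (simp add: KN_pair_def)
    then have "dominates n (rset n (set C')) (lset n (set D0))"
      using r dominates_step_left[OF _ not_lowerable[OF D0 assms(2) \<open>phi n i D0 = 0\<close>]
          admissible_subsets(1)[OF C] admissible_subsets(2)[OF D0] assms(2)] by simp
    then have p: "KN_pair n C' D0" by (simp add: KN_pair_def)
    show ?thesis
    proof (cases "D = D0")
      case False
      then have "KN_pair n D0 D" using pair(3) that Y by simp
      then show ?thesis by (rule KN_pair_trans[OF p _ D0])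
    qed (simp add: p)
  qed
  have "X @ C' # Y \<in> KN n \<mu>" using KN_replace[OF assms(1)[unfolded T] fa(3) C'] X Y by blast
  then show ?thesis using w by blast
qed

text \<open>The roles of left and right are exchanged. Now the critical neighbour is the last column
  of \<open>X\<close>, which is the first factor of \<open>cr X\<close>, so that its
  \<open>eps\<close> is bounded by \<open>phi n i D\<close>.\<close>

lemma KN_e_closed:
  assumes "T \<in> KN n \<mu>" "i \<in> {1..int n}" "e_word n i (cr T) = Some w"
  shows "\<exists>T'\<in>KN n \<mu>. cr T' = w"
proof -
  obtain X D D' Y where T: "T = X @ D # Y" and e: "e_word n i D = Some D'" and w: "w = cr (X @ D' # Y)"
    and le: "eps n i (cr X) \<le> phi n i D"
    using e_word_cr[OF assms(3)] by blast
  have adm: "admissible n A" if "A \<in> set T" for A using assms(1) that by (simp add: KN_iff)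
  have pair: "\<And>A. A \<in> set X \<Longrightarrow> KN_pair n A D" "\<And>E. E \<in> set Y \<Longrightarrow> KN_pair n D E" "sorted_wrt (KN_pair n) X"
    using assms(1) by (auto simp: KN_iff T sorted_wrt_append)
  have D: "admissible n D" using adm T by simp
  have f: "f_word n i D' = Some D" by (rule e_word_inverse[OF assms(2) e])
  note fa = f_admissible[OF e_column[OF admissibleD(1)[OF D] assms(2) e] assms(2) f]
  have D': "admissible n D'" using fa(2) D by blast
  have Y: "KN_pair n D' E" if "E \<in> set Y" for E
    using pair(2)[OF that] fa(4) dominates_trans[OF dominates_step[OF admissible_subsets(1)[OF D'] assms(2)]]
    unfolding KN_pair_def by metis
  have X: "KN_pair n A D'" if A: "A \<in> set X" for A
    using fa(5)
  proof
    assume "lset n (set D) = lset n (set D')"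
    then show ?thesis using pair(1)[OF that] by (simp add: KN_pair_def)
  next
    assume r: "phi n i D = 0 \<and> lset n (set D) = step n i (lset n (set D'))"
    obtain X' A0 where X: "X = X' @ [A0]" using A by (cases X rule: rev_cases) auto
    have "eps n i A0 = 0" using le r by (simp add: X cr_append cr_Cons eps_append)
    have A0: "admissible n A0" using adm T X by simp
    have "dominates n (rset n (set A0)) (step n i (lset n (set D')))" using pair(1)[of A0] X r by (simp add: KN_pair_def)
    then have "dominates n (rset n (set A0)) (lset n (set D'))"
      by (rule dominates_step_right[OF _ not_raisable[OF A0 assms(2) \<open>eps n i A0 = 0\<close>]
          admissible_subsets(1)[OF A0] admissible_subsets(2)[OF D'] assms(2)])
    then have p: "KN_pair n A0 D'" by (simp add: KN_pair_def)
    show ?thesis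
    proof (cases "A = A0")
      case False
      then have "KN_pair n A A0" using pair(3) that X by (simp add: sorted_wrt_append)
      then show ?thesis by (rule KN_pair_trans[OF _ p A0])
    qed (simp add: p)
  qed
  have "X @ D' # Y \<in> KN n \<mu>" using KN_replace[OF assms(1)[unfolded T] fa(3)[symmetric] D'] X Y by blast
  then show ?thesis using w by blast
qed

lemma cr_inj:
  assumes "map length T = map length U" "cr T = cr U"
  shows "T = U"
  using assms
proof (induction T arbitrary: U)
  case (Cons C T)
  then obtain D V where U: "U = D # V" by (cases U) auto
  have "length C = length D" using Cons.prems U by simp
  then have "cr T = cr V" "C = D" using Cons.prems(2) unfolding U cr_Cons by simp_all
  then show ?case using Cons U by simp
qed simp

lemma KN_cr_inj: "T \<in> KN n \<mu> \<Longrightarrow> U \<in> KN n \<mu> \<Longrightarrow> cr T = cr U \<Longrightarrow> T = U"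
  using cr_inj by (auto simp: KN_def has_shape_def)

section \<open>Highest and lowest weight tableaux\<close>

text \<open>When all \<open>eps\<close> vanish, the pairings in \<open>phi_minus_eps\<close> are
  nonnegative, which describes the dominant chamber of type C. The signs are obtained downwards from
  the coordinate \<open>n\<close>.\<close>

lemma dominant:
  assumes "\<forall>i\<in>{1..int n}. eps n i w = 0" "1 \<le> i" "i \<le> int n"
  shows "0 \<le> wt w i" "i < int n \<Longrightarrow> wt w (i + 1) \<le> wt w i"
proof -
  have st: "i < int n \<Longrightarrow> wt w (i + 1) \<le> wt w i" "i = int n \<Longrightarrow> 0 \<le> wt w i" if "i \<in> {1..int n}" for i
    using phi_minus_eps[OF that, of w] assms(1) that by auto
  have "1 \<le> i \<longrightarrow> 0 \<le> wt w i"
    using assms(3)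
  proof (induction i rule: int_le_induct)
    case base
    then show ?case using st(2)[of "int n"] by auto
  next
    case (step i)
    then show ?case using st(1)[of "i - 1"] by auto
  qed
  then show "0 \<le> wt w i" using assms(2) by blast
  show "i < int n \<Longrightarrow> wt w (i + 1) \<le> wt w i" using st(1) assms(2,3) by simp
qed

lemma antidominant:
  assumes "\<forall>i\<in>{1..int n}. phi n i w = 0" "1 \<le> i" "i \<le> int n"
  shows "wt w i \<le> 0" "i < int n \<Longrightarrow> wt w i \<le> wt w (i + 1)"
proof -
  have *: "\<forall>i\<in>{1..int n}. eps n i (star w) = 0" using assms(1) by (simp add: eps_star)
  show "wt w i \<le> 0" "i < int n \<Longrightarrow> wt w i \<le> wt w (i + 1)"
    using dominant[OF * assms(2,3)] by (simp_all add: wt_star)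
qed

lemma wt_distinct:
  assumes "distinct C"
  shows "wt C j = (if j \<in> set C then 1 else 0) - (if - j \<in> set C then 1 else 0)"
proof -
  have "count_list C x = (if x \<in> set C then 1 else 0)" for x
    using assms by (induction C) auto
  then show ?thesis by (simp add: wt_def)
qed

lemma wt_cr: "wt (cr T) j = (\<Sum>C\<leftarrow>T. wt C j)"
  by (induction T) (simp_all add: cr_Cons wt_append)

lemma wt_cr_zero:
  assumes "\<forall>C\<in>set T. C = [1..int (length C)] \<and> int (length C) < j"
  shows "wt (cr T) j = 0"
proof -
  have "wt C j = 0" if "C \<in> set T" for C
  proof -
    define k where "k = length C"
    have "C = [1..int k]" "int k < j" unfolding k_def using bspec[OF assms that] by (rule conjunct1, rule conjunct2)
    then show ?thesis by (simp add: wt_distinct)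
  qed
  then show ?thesis unfolding wt_cr by (induction T) auto
qed

lemma wt_cr_low:
  assumes "\<forall>C\<in>set T. C = [- int (length C)..- 1] \<and> j \<le> int (length C)" "1 \<le> j"
  shows "wt (cr T) j = - int (length T)"
proof -
  have "wt C j = - 1" if "C \<in> set T" for C
  proof -
    define k where "k = length C"
    have "C = [- int k..- 1]" "j \<le> int k" unfolding k_def using bspec[OF assms(1) that] by (rule conjunct1, rule conjunct2)
    then show ?thesis using assms(2) by (simp add: wt_distinct)
  qed
  then show ?thesis unfolding wt_cr by (induction T) auto
qed

abbreviation semistandard_pair :: "int list \<Rightarrow> int list \<Rightarrow> bool" where
  "semistandard_pair C D \<equiv> length D \<le> length C \<and> (\<forall>i<length D. letter_le (C ! i) (D ! i))"

lemma admissibleD_rows: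
  assumes "admissible n C" "p < length C" "q < length C" "C ! p = i" "C ! q = - i" "0 < i"
  shows "int (p + 1) + int (length C - q) \<le> i"
proof -
  have "i \<in> set (letters n)" using assms(2,4) admissibleD(2)[OF assms(1)] nth_mem by blast
  then have "i \<in> {1..int n}" using assms(6) by (simp add: set_letters)
  then show ?thesis using assms(1-5) unfolding admissible_def by blast
qed

text \<open>A prefix of a word has no larger \<open>eps\<close>, so every prefix of a highest weight
  word has a dominant weight. The columns to the right come first in the word, and \<open>C\<close>
  is determined entry by entry. If a column to the right reaches row \<open>h\<close>, the row
  inequality fixes the entry; otherwise the letters beyond \<open>h\<close> still have weight 0, and
  dominance and admissibility leave only \<open>h + 1\<close>.\<close>

lemma highest_columns:
  assumes "sorted_wrt semistandard_pair T" "\<forall>C\<in>set T. admissible n C"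
    and "\<forall>i\<in>{1..int n}. eps n i (cr T) = 0"
  shows "\<forall>C\<in>set T. C = [1..int (length C)]"
  using assms
proof (induction T)
  case (Cons C T)
  have IH: "\<forall>D\<in>set T. D = [1..int (length D)]"
    by (rule Cons.IH) (use Cons.prems in \<open>simp_all add: cr_Cons eps_append\<close>)
  have adm: "admissible n C" using Cons.prems(2) by simp
  have sub: "set C \<subseteq> set (letters n)" and srt: "sorted_wrt letter_less C" and dist: "distinct C"
    using admissibleD[OF adm] distinct_column by (auto simp: is_column_def)
  have nth: "C ! h = int h + 1" if "h < length C" for h
    using that
  proof (induction h rule: less_induct)
    case (less h)
    let ?x = "C ! h" and ?v = "cr T @ take (Suc h) C"
    have IHh: "C ! k = int k + 1" if "k < h" for k using less that by simp
    have x: "?x \<noteq> 0" "\<bar>?x\<bar> \<le> int n" using sub nth_mem[OF less.prems] by (auto simp: set_letters)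
    have tk: "set (take h C) = {1..int h}"
    proof -
      have "take h C = map (\<lambda>k. int k + 1) [0..<h]"
        by (rule nth_equalityI) (use less.prems IHh in auto)
      also have "set \<dots> = (\<lambda>k. int k + 1) ` {0..<h}" by simp
      also have "\<dots> = {1..int h}"
      proof -
        have "y \<in> (\<lambda>k. int k + 1) ` {0..<h}" if "y \<in> {1..int h}" for y
          using that by (intro image_eqI[of _ _ "nat (y - 1)"]) auto
        then show ?thesis by auto
      qed
      finally show ?thesis .
    qed
    have gt: "?x < 0 \<or> int h < ?x"
    proof (cases h)
      case (Suc k)
      then show ?thesis using sorted_wrt_nth_less[OF srt, of k h] IHh[of k] less.prems
        by (auto simp: letter_less_def)
    qed (use x in auto)
    have split: "cr (C # T) = ?v @ drop (Suc h) C" by (simp add: cr_Cons)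
    have dom: "\<forall>i\<in>{1..int n}. eps n i ?v = 0"
      using Cons.prems(3) unfolding split eps_append[of _ _ ?v] by simp
    have wtv: "wt ?v j = wt (cr T) j + (if j \<in> {1..int h} \<union> {?x} then 1 else 0) - (if - j \<in> {1..int h} \<union> {?x} then 1 else 0)" for j
    proof -
      have "set (take (Suc h) C) = {1..int h} \<union> {?x}"
        using less.prems tk by (simp add: take_Suc_conv_app_nth)
      then show ?thesis using dist by (simp add: wt_append wt_distinct)
    qed
    show ?case
    proof (cases "\<exists>D\<in>set T. h < length D")
      case True
      then obtain D where D: "D \<in> set T" "h < length D" by blast
      have "letter_le ?x (D ! h)" using Cons.prems(1) D by auto
      moreover have "D ! h = int h + 1"
      proof -
        define k where "k = length D"
        have "D = [1..int k]" unfolding k_def by (rule bspec[OF IH D(1)])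
        then show ?thesis using D(2) by (simp add: k_def[symmetric])
      qed
      ultimately show ?thesis using gt x by (auto simp: letter_le_def letter_less_def)
    next
      case False
      have z: "wt (cr T) j = 0" if "int h < j" for j
      proof (rule wt_cr_zero, rule ballI, rule conjI)
        fix C assume C: "C \<in> set T"
        show "C = [1..int (length C)]" by (rule bspec[OF IH C])
        have "length C \<le> h" using C False by (meson not_less)
        then show "int (length C) < j" using that by linarith
      qed
      show ?thesis
      proof (cases "0 < ?x")
        case pos: True
        show ?thesis
        proof (rule ccontr)
          assume "?x \<noteq> int h + 1"
          then have g: "int h + 1 < ?x" using gt pos by simp
          then have "wt ?v ?x \<le> wt ?v (?x - 1)" using dominant(2)[OF dom, of "?x - 1"] x by auto
          moreover have "wt ?v ?x = 1" using z[of ?x] g unfolding wtv by auto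
          moreover have "wt ?v (?x - 1) = 0" using z[of "?x - 1"] g unfolding wtv by auto
          ultimately show False by simp
        qed
      next
        case False
        then have neg: "?x < 0" using x by simp
        show ?thesis
        proof (cases "- ?x \<le> int h")
          case True
          \<comment> \<open>Here \<open>k + 1\<close> stands in row \<open>k + 1\<close> and its bar
            has row at least 1 from the bottom, so admissibility would give \<open>k + 2\<close> at
            most \<open>k + 1\<close>.\<close>
          obtain k where k: "- ?x = int (Suc k)" using neg by (metis neg_0_less_iff_less zero_less_imp_eq_int gr0_conv_Suc)
          have kh: "k < h" using True k by simp
          have "int (k + 1) + int (length C - h) \<le> - ?x"
            by (rule admissibleD_rows[OF adm]) (use kh less.prems IHh[OF kh] k neg in auto)
          then show ?thesis using less.prems k by simp
        next
          case F: False
          then have "wt ?v (- ?x) = - 1" using z[of "- ?x"] neg unfolding wtv by auto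
          moreover have "0 \<le> wt ?v (- ?x)" by (rule dominant(1)[OF dom]) (use neg x in auto)
          ultimately show ?thesis by simp
        qed
      qed
    qed
  qed
  have "C = [1..int (length C)]" by (rule nth_equalityI) (simp_all add: nth)
  then show ?case unfolding list.set ball_simps using IH by (rule conjI)
qed simp

text \<open>This is no direct consequence of \<open>highest_columns\<close> through
  \<open>star\<close>, since \<open>star\<close> turns the shape by 180 degrees. Suffixes replace
  prefixes, each column is determined from its bottom entry upwards, and the weight of the columns
  to the left is constant in the relevant range instead of 0.\<close>

lemma lowest_columns:
  assumes "sorted_wrt semistandard_pair T" "\<forall>C\<in>set T. admissible n C"
    and "\<forall>i\<in>{1..int n}. phi n i (cr T) = 0"
  shows "\<forall>C\<in>set T. C = [- int (length C)..- 1]"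
  using assms
proof (induction T rule: rev_induct)
  case (snoc D T)
  have IH: "\<forall>E\<in>set T. E = [- int (length E)..- 1]"
    by (rule snoc.IH) (use snoc.prems in \<open>simp_all add: cr_append cr_Cons phi_append sorted_wrt_append\<close>)
  have adm: "admissible n D" using snoc.prems(2) by simp
  have sub: "set D \<subseteq> set (letters n)" and srt: "sorted_wrt letter_less D" and dist: "distinct D"
    using admissibleD[OF adm] distinct_column by (auto simp: is_column_def)
  let ?d = "length D"
  have nth: "D ! (?d - Suc h) = - int (Suc h)" if "h < ?d" for h
    using that
  proof (induction h rule: less_induct)
    case (less h)
    let ?x = "D ! (?d - Suc h)" and ?v = "drop (?d - Suc h) D @ cr T"
    have IHh: "D ! (?d - Suc k) = - int (Suc k)" if "k < h" for k using less.IH[OF that] less.prems that by simp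
    have x: "?x \<noteq> 0" "\<bar>?x\<bar> \<le> int n" 
    proof -
      have "?x \<in> set D" by (rule nth_mem) (use less.prems in simp)
      then have "?x \<in> set (letters n)" using sub by blast
      then show "?x \<noteq> 0" "\<bar>?x\<bar> \<le> int n" by (simp_all add: set_letters)
    qed
    have dr: "set (drop (?d - h) D) = {- int h..- 1}"
    proof -
      have "drop (?d - h) D = map (\<lambda>k. - int h + int k) [0..<h]"
      proof (rule nth_equalityI)
        fix k assume k: "k < length (drop (?d - h) D)"
        then have k': "k < h" by simp
        have "?d - h + k = ?d - Suc (h - Suc k)" using k' less.prems by simp
        then have "drop (?d - h) D ! k = - int (Suc (h - Suc k))"
          using IHh[of "h - Suc k"] k' less.prems by simp
        then show "drop (?d - h) D ! k = map (\<lambda>k. - int h + int k) [0..<h] ! k" using k' by simp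
      qed (use less.prems in simp)
      also have "set \<dots> = (\<lambda>k. - int h + int k) ` {0..<h}" by simp
      also have "\<dots> = {- int h..- 1}"
      proof -
        have "y \<in> (\<lambda>k. - int h + int k) ` {0..<h}" if "y \<in> {- int h..- 1}" for y
          using that by (intro image_eqI[of _ _ "nat (y + int h)"]) auto
        then show ?thesis by auto
      qed
      finally show ?thesis .
    qed
    have drs: "drop (?d - Suc h) D = ?x # drop (?d - h) D"
      using less.prems Cons_nth_drop_Suc[of "?d - Suc h" D] by (simp add: Suc_diff_Suc)
    have gt: "0 < ?x \<or> int h < - ?x"
    proof (cases h)
      case (Suc k)
      have "letter_less ?x (D ! (?d - Suc k))"
        by (rule sorted_wrt_nth_less[OF srt]) (use less.prems Suc in auto)
      then show ?thesis using IHh[of k] Suc by (auto simp: letter_less_def)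
    qed (use x in auto)
    have split: "cr (T @ [D]) = take (?d - Suc h) D @ ?v" by (simp add: cr_append cr_Cons)
    have dom: "\<forall>i\<in>{1..int n}. phi n i ?v = 0"
      using snoc.prems(3) unfolding split phi_append[of _ _ _ ?v] by simp
    have wtv: "wt ?v j = wt (cr T) j + (if j \<in> insert ?x {- int h..- 1} then 1 else 0) -
        (if - j \<in> insert ?x {- int h..- 1} then 1 else 0)" for j
    proof -
      have "set (drop (?d - Suc h) D) = insert ?x {- int h..- 1}" unfolding drs using dr by simp
      then show ?thesis using dist by (simp add: wt_append wt_distinct)
    qed
    \<comment> \<open>If the entry skipped the letter \<open>- int (Suc h)\<close>, it would push
      the coordinate \<open>- ?x\<close> below its predecessor, against antidominance. This covers
      both the leftmost column, where \<open>T\<close> is empty, and the others.\<close>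
    have neg_step: ?case if neg: "?x < 0" and w: "\<And>j. 1 \<le> j \<Longrightarrow> j \<le> - ?x \<Longrightarrow> wt (cr T) j = - int (length T)"
    proof (rule ccontr)
      assume "?x \<noteq> - int (Suc h)"
      then have g: "int h + 1 < - ?x" using gt neg by simp
      then have "wt ?v (- ?x - 1) \<le> wt ?v (- ?x)" using antidominant(2)[OF dom, of "- ?x - 1"] x by auto
      moreover have "wt ?v (- ?x) = - int (length T) - 1" using w[of "- ?x"] g unfolding wtv by auto
      moreover have "wt ?v (- ?x - 1) = - int (length T)" using w[of "- ?x - 1"] g unfolding wtv by auto
      ultimately show False by simp
    qed
    show ?case
    proof (cases "T = []")
      case True
      show ?thesis
      proof (cases "?x < 0")
        case neg: True
        show ?thesis by (rule neg_step[OF neg]) (simp add: True)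
      next
        case False
        then have pos: "0 < ?x" using x by simp
        show ?thesis
        proof (cases "?x \<le> int h")
          case le: True
          obtain k where k: "?x = int (Suc k)" using pos by (metis zero_less_imp_eq_int gr0_conv_Suc)
          have kh: "k < h" using le k by simp
          have "int (?d - Suc h + 1) + int (?d - (?d - Suc k)) \<le> ?x"
            by (rule admissibleD_rows[OF adm]) (use kh less.prems IHh[OF kh] k in auto)
          then show ?thesis using less.prems k kh by simp
        next
          case gth: False
          then have "wt ?v ?x = 1" using pos True unfolding wtv by auto
          moreover have "wt ?v ?x \<le> 0" by (rule antidominant(1)[OF dom]) (use pos x in auto)
          ultimately show ?thesis by simp
        qed
      qed
    next
      case False
      then obtain T' E where T: "T = T' @ [E]" by (cases T rule: rev_cases) auto
      let ?e = "length E"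
      have de: "?d \<le> ?e" and le: "letter_le (E ! (?d - Suc h)) ?x"
        using snoc.prems(1) less.prems unfolding T by (auto simp: sorted_wrt_append)
      have long: "?e \<le> length F" if "F \<in> set T" for F
        using that snoc.prems(1) unfolding T by (auto simp: sorted_wrt_append)
      have "E ! (?d - Suc h) = - int ?e + int (?d - Suc h)"
      proof -
        have "E \<in> set T" using T by simp
        define k where "k = length E"
        have "E = [- int k..- 1]" unfolding k_def by (rule bspec[OF IH \<open>E \<in> set T\<close>])
        then show ?thesis using de less.prems by (simp add: k_def[symmetric])
      qed
      \<comment> \<open>Barred letters are the largest, so the entry to the right of a barred one is
        barred, and its absolute value does not exceed the length of \<open>E\<close>. Hence all
        columns of \<open>T\<close> contain the bars needed for \<open>wt_cr_low\<close>.\<close>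
      then have neg: "?x < 0" and up: "- ?x \<le> int ?e"
        using le de less.prems by (auto simp: letter_le_def letter_less_def)
      show ?thesis
      proof (rule neg_step[OF neg])
        fix j assume "1 \<le> j" "j \<le> - ?x"
        then show "wt (cr T) j = - int (length T)"
        proof (intro wt_cr_low ballI conjI)
          fix C assume C: "C \<in> set T"
          show "C = [- int (length C)..- 1]" by (rule bspec[OF IH C])
          show "j \<le> int (length C)" using long[OF C] up \<open>j \<le> - ?x\<close> by linarith
        qed
      qed
    qed
  qed
  have "D = [- int ?d..- 1]"
  proof (rule nth_equalityI)
    fix k assume k: "k < ?d"
    then have "?d - Suc (?d - Suc k) = k" by simp
    then show "D ! k = [- int ?d..- 1] ! k" using nth[of "?d - Suc k"] k by simp
  qed simp
  then have "\<forall>C\<in>set [D]. C = [- int (length C)..- 1]" unfolding list.set ball_simps by (intro conjI TrueI)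
  then show ?case unfolding set_append ball_Un using IH by (intro conjI)
qed simp

section \<open>Plactic relations\<close>

text \<open>
  Lecouvey's length-preserving relations for type C, in terms of ranks: the bar is \<open>r \<mapsto> 2m + 1 - r\<close>, and every \<open>f\<^sub>i\<close> with \<open>1 \<le> i \<le> m\<close>
  raises the rank of one letter by 1.
\<close>

definition knuth_ranks :: "int \<Rightarrow> int \<Rightarrow> int \<Rightarrow> int \<Rightarrow> int \<Rightarrow> int \<Rightarrow> int \<Rightarrow> bool" where
  "knuth_ranks m a b c a' b' c' \<longleftrightarrow>
     a' = a \<and> b' = c \<and> c' = b \<and> c \<le> a \<and> a < b \<and> b + c \<noteq> 2 * m + 1 \<or>
     a' = b \<and> b' = a \<and> c' = c \<and> a < c \<and> c \<le> b \<and> a + b \<noteq> 2 * m + 1 \<or>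
     a' = a \<and> b + c = 2 * m + 1 \<and> b' = c + 1 \<and> c' = b - 1 \<and> 1 \<le> c \<and> c < m \<and> c + 1 \<le> a \<and> a \<le> b - 1 \<or>
     c' = c \<and> a + b = 2 * m + 1 \<and> a' = b + 1 \<and> b' = a - 1 \<and> 1 < a \<and> a \<le> m \<and> a \<le> c \<and> c \<le> b"

text \<open>These are the ranks of \<open>i\<close> and of the bar of \<open>i + 1\<close>. For
  \<open>i = m\<close> both equal \<open>m\<close>, so the last index needs no separate treatment;
  the same happens in \<open>minus_rank\<close> with \<open>m + 1\<close>.\<close>

definition plus_rank :: "int \<Rightarrow> int \<Rightarrow> int \<Rightarrow> bool" where
  "plus_rank m i r \<longleftrightarrow> r = i \<or> r = 2 * m - i"

definition minus_rank :: "int \<Rightarrow> int \<Rightarrow> int \<Rightarrow> bool" where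
  "minus_rank m i r \<longleftrightarrow> r = i + 1 \<or> r = 2 * m + 1 - i"

text \<open>\<open>acts1\<close>, \<open>acts2\<close> and \<open>acts3\<close> tell which letter of
  a three-letter word is changed by \<open>f\<^sub>i\<close>, that is, which letter carries the
  leftmost surviving plus.\<close>

definition acts1 where
  "acts1 m i a b c \<longleftrightarrow> plus_rank m i a \<and> \<not> minus_rank m i b \<and> (\<not> minus_rank m i c \<or> plus_rank m i b)"

definition acts2 where
  "acts2 m i a b c \<longleftrightarrow> \<not> acts1 m i a b c \<and> plus_rank m i b \<and> \<not> minus_rank m i c"

definition acts3 where
  "acts3 m i a b c \<longleftrightarrow> \<not> acts1 m i a b c \<and> \<not> acts2 m i a b c \<and> plus_rank m i c"

lemmas acts_defs = acts1_def acts2_def acts3_def plus_rank_def minus_rank_def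

text \<open>In terms of ranks, compatibility with \<open>f\<^sub>i\<close> is a statement of linear
  integer arithmetic in \<open>m\<close>, \<open>i\<close> and the ranks, hence decidable uniformly
  in \<open>m\<close>.\<close>

lemma knuth_acts1:
  assumes "knuth_ranks m a b c a' b' c'" "1 \<le> i" "i \<le> m" "acts1 m i a b c"
  shows "acts1 m i a' b' c' \<and> knuth_ranks m (a + 1) b c (a' + 1) b' c' \<or>
    acts2 m i a' b' c' \<and> knuth_ranks m (a + 1) b c a' (b' + 1) c' \<or>
    acts3 m i a' b' c' \<and> knuth_ranks m (a + 1) b c a' b' (c' + 1)"
  using assms unfolding acts_defs knuth_ranks_def by (smt (z3))

lemma knuth_acts2:
  assumes "knuth_ranks m a b c a' b' c'" "1 \<le> i" "i \<le> m" "acts2 m i a b c"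
  shows "acts1 m i a' b' c' \<and> knuth_ranks m a (b + 1) c (a' + 1) b' c' \<or>
    acts2 m i a' b' c' \<and> knuth_ranks m a (b + 1) c a' (b' + 1) c' \<or>
    acts3 m i a' b' c' \<and> knuth_ranks m a (b + 1) c a' b' (c' + 1)"
  using assms unfolding acts_defs knuth_ranks_def by (smt (z3))

lemma knuth_acts3:
  assumes "knuth_ranks m a b c a' b' c'" "1 \<le> i" "i \<le> m" "acts3 m i a b c"
  shows "acts1 m i a' b' c' \<and> knuth_ranks m a b (c + 1) (a' + 1) b' c' \<or>
    acts2 m i a' b' c' \<and> knuth_ranks m a b (c + 1) a' (b' + 1) c' \<or>
    acts3 m i a' b' c' \<and> knuth_ranks m a b (c + 1) a' b' (c' + 1)"
  using assms unfolding acts_defs knuth_ranks_def by (smt (z3))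

lemma knuth_acts_none:
  assumes "knuth_ranks m a b c a' b' c'" "1 \<le> i" "i \<le> m"
    and "\<not> acts1 m i a b c" "\<not> acts2 m i a b c" "\<not> acts3 m i a b c"
  shows "\<not> acts1 m i a' b' c'" "\<not> acts2 m i a' b' c'" "\<not> acts3 m i a' b' c'"
  using assms unfolding acts_defs knuth_ranks_def by (smt (z3))+

lemma knuth_ranks_star:
  assumes "knuth_ranks m a b c a' b' c'"
  shows "knuth_ranks m (2 * m + 1 - c') (2 * m + 1 - b') (2 * m + 1 - a')
    (2 * m + 1 - c) (2 * m + 1 - b) (2 * m + 1 - a)"
  using assms unfolding knuth_ranks_def by (smt (z3))

lemma knuth_ranks_unique:
  "knuth_ranks m a b c x y z \<Longrightarrow> knuth_ranks m a b c x' y' z' \<Longrightarrow> x = x' \<and> y = y' \<and> z = z'"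
  "knuth_ranks m x y z a b c \<Longrightarrow> knuth_ranks m x' y' z' a b c \<Longrightarrow> x = x' \<and> y = y' \<and> z = z'"
  unfolding knuth_ranks_def by (smt (z3))+

section \<open>Crystal equivalence of words\<close>

definition bisim :: "nat \<Rightarrow> (int list \<Rightarrow> int list \<Rightarrow> bool) \<Rightarrow> bool" where
  "bisim n R \<longleftrightarrow> (\<forall>x y. R x y \<longrightarrow> (\<forall>i\<in>{1..int n}.
     wt x i = wt y i \<and> eps n i x = eps n i y \<and> phi n i x = phi n i y \<and>
     rel_option R (f_word n i x) (f_word n i y) \<and> rel_option R (e_word n i x) (e_word n i y)))"

text \<open>
  A bisimulation that is a partial bijection restricts to an isomorphism of components. Unlike
  isomorphisms, such relations need not be confined to a component, which makes them easy to
  compose and to extend to longer words.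
\<close>

definition crystal_equiv :: "nat \<Rightarrow> int list \<Rightarrow> int list \<Rightarrow> bool" where
  "crystal_equiv n x y \<longleftrightarrow> (\<exists>R. bisim n R \<and> bi_unique R \<and> R x y)"

lemma crystal_equivI: "bisim n R \<Longrightarrow> bi_unique R \<Longrightarrow> R x y \<Longrightarrow> crystal_equiv n x y"
  unfolding crystal_equiv_def by blast

lemma crystal_equiv_refl: "crystal_equiv n x x"
  by (rule crystal_equivI[of n "(=)"]) (auto simp: bisim_def bi_unique_eq option.rel_eq)

lemma crystal_equiv_sym:
  assumes "crystal_equiv n x y"
  shows "crystal_equiv n y x"
proof -
  obtain R where R: "bisim n R" "bi_unique R" "R x y" using assms by (auto simp: crystal_equiv_def)
  show ?thesis
  proof (rule crystal_equivI[of n "R\<inverse>\<inverse>"])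
    show "bisim n R\<inverse>\<inverse>" using R(1) unfolding bisim_def by (simp add: option.rel_conversep)
  qed (use R in \<open>simp_all add: bi_unique_conversep\<close>)
qed

lemma crystal_equiv_trans [trans]:
  assumes "crystal_equiv n x y" "crystal_equiv n y z"
  shows "crystal_equiv n x z"
proof -
  obtain R where R: "bisim n R" "bi_unique R" "R x y" using assms(1) by (auto simp: crystal_equiv_def)
  obtain S where S: "bisim n S" "bi_unique S" "S y z" using assms(2) by (auto simp: crystal_equiv_def)
  show ?thesis
  proof (rule crystal_equivI[of n "R OO S"])
    show "bisim n (R OO S)"
      unfolding bisim_def
    proof (intro allI impI ballI)
      fix u w i assume "(R OO S) u w" and i: "i \<in> {1..int n}"
      then obtain v where v: "R u v" "S v w" by auto
      note b = R(1)[unfolded bisim_def, rule_format, OF v(1) i] S(1)[unfolded bisim_def, rule_format, OF v(2) i]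
      have "rel_option (R OO S) (f_word n i u) (f_word n i w)" "rel_option (R OO S) (e_word n i u) (e_word n i w)"
        unfolding option.rel_compp using b by blast+
      then show "wt u i = wt w i \<and> eps n i u = eps n i w \<and> phi n i u = phi n i w \<and>
        rel_option (R OO S) (f_word n i u) (f_word n i w) \<and> rel_option (R OO S) (e_word n i u) (e_word n i w)"
        using b by simp
    qed
    show "bi_unique (R OO S)" by (rule bi_unique_OO[OF R(2) S(2)])
    show "(R OO S) x z" using R(3) S(3) by blast
  qed
qed

lemma crystal_equivD:
  assumes "crystal_equiv n x y" "i \<in> {1..int n}"
  shows "wt x i = wt y i" "eps n i x = eps n i y" "phi n i x = phi n i y"
    "f_word n i x = Some x' \<Longrightarrow> \<exists>y'. f_word n i y = Some y' \<and> crystal_equiv n x' y'"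
    "e_word n i x = Some x' \<Longrightarrow> \<exists>y'. e_word n i y = Some y' \<and> crystal_equiv n x' y'"
proof -
  obtain R where R: "bisim n R" "bi_unique R" "R x y" using assms by (auto simp: crystal_equiv_def)
  note b = R(1)[unfolded bisim_def, rule_format, OF R(3) assms(2)]
  show "wt x i = wt y i" "eps n i x = eps n i y" "phi n i x = phi n i y" using b by blast+
  show "f_word n i x = Some x' \<Longrightarrow> \<exists>y'. f_word n i y = Some y' \<and> crystal_equiv n x' y'"
    using b crystal_equivI[OF R(1,2)] by (auto simp: option_rel_Some1)
  show "e_word n i x = Some x' \<Longrightarrow> \<exists>y'. e_word n i y = Some y' \<and> crystal_equiv n x' y'"
    using b crystal_equivI[OF R(1,2)] by (auto simp: option_rel_Some1)
qed

lemma crystal_equiv_star: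
  assumes "crystal_equiv n x y"
  shows "crystal_equiv n (star x) (star y)"
proof -
  obtain R where R: "bisim n R" "bi_unique R" "R x y" using assms by (auto simp: crystal_equiv_def)
  let ?S = "\<lambda>u v. R (star u) (star v)"
  show ?thesis
  proof (rule crystal_equivI[of n ?S])
    show "bisim n ?S"
      unfolding bisim_def
    proof (intro allI impI ballI)
      fix u v i assume "R (star u) (star v)" and i: "i \<in> {1..int n}"
      then have "wt (star u) i = wt (star v) i \<and> eps n i (star u) = eps n i (star v) \<and> phi n i (star u) = phi n i (star v) \<and>
        rel_option R (f_word n i (star u)) (f_word n i (star v)) \<and> rel_option R (e_word n i (star u)) (e_word n i (star v))"
        using R(1) unfolding bisim_def by blast
      then show "wt u i = wt v i \<and> eps n i u = eps n i v \<and> phi n i u = phi n i v \<and>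
        rel_option ?S (f_word n i u) (f_word n i v) \<and> rel_option ?S (e_word n i u) (e_word n i v)"
        by (simp add: wt_star eps_star[OF i] phi_star[OF i] f_word_star[OF i] e_word_star[OF i] option.rel_map)
    qed
    have "star u = star v \<longleftrightarrow> u = v" for u v by (metis star_star)
    then show "bi_unique ?S" using R(2) unfolding bi_unique_def by blast
    show "?S (star x) (star y)" using R(3) by simp
  qed
qed

lemma crystal_equiv_append:
  assumes "crystal_equiv n x y"
  shows "crystal_equiv n (u @ x @ v) (u @ y @ v)"
proof -
  obtain R where R: "bisim n R" "bi_unique R" "R x y" using assms by (auto simp: crystal_equiv_def)
  \<comment> \<open>The lengths of the two outer factors are kept fixed so that a word splits in
    only one way; this makes \<open>S\<close> a partial bijection like \<open>R\<close>.\<close>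
  define S where "S a b \<longleftrightarrow> (\<exists>p q x y. a = p @ x @ q \<and> b = p @ y @ q \<and> length p = length u \<and> length q = length v \<and> R x y)" for a b
  have SI: "S (p @ x @ q) (p @ y @ q)" if "length p = length u" "length q = length v" "R x y" for p q x y
    using that unfolding S_def by blast
  have len: "f_word n i w = Some w' \<Longrightarrow> length w' = length w" "e_word n i w = Some w' \<Longrightarrow> length w' = length w" for w w' i
    by (auto simp: f_word_def e_word_def Let_def split: if_splits)
  have left: "rel_option S (map_option (\<lambda>p. p @ x @ q) z) (map_option (\<lambda>p. p @ y @ q) z)"
    if "\<And>p. z = Some p \<Longrightarrow> length p = length u" "length q = length v" "R x y" for z q x y
    using that by (cases z) (auto intro: SI)
  have mid: "rel_option S (map_option (\<lambda>x. p @ x @ q) z) (map_option (\<lambda>y. p @ y @ q) z')"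
    if "length p = length u" "length q = length v" "rel_option R z z'" for z z' p q
    using that by (cases z; cases z') (auto intro: SI)
  have right: "rel_option S (map_option (\<lambda>q. p @ x @ q) z) (map_option (\<lambda>q. p @ y @ q) z)"
    if "length p = length u" "\<And>q. z = Some q \<Longrightarrow> length q = length v" "R x y" for z p x y
    using that by (cases z) (auto intro: SI)
  show ?thesis
  proof (rule crystal_equivI[of n S])
    show "bisim n S"
      unfolding bisim_def
    proof (intro allI impI ballI)
      fix a b i assume "S a b" and i: "i \<in> {1..int n}"
      then obtain p q x y where ab: "a = p @ x @ q" "b = p @ y @ q" and l: "length p = length u" "length q = length v" and r: "R x y"
        unfolding S_def by blast
      note b = R(1)[unfolded bisim_def, rule_format, OF r i]
      have f: "rel_option S (f_word n i a) (f_word n i b)"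
        using b l r unfolding ab f_word_append phi_append eps_append
        by (auto simp: option.map_comp comp_def dest: len intro!: left mid right)
      have e: "rel_option S (e_word n i a) (e_word n i b)"
        using b l r unfolding ab e_word_append phi_append eps_append
        by (auto simp: option.map_comp comp_def dest: len intro!: left mid right)
      show "wt a i = wt b i \<and> eps n i a = eps n i b \<and> phi n i a = phi n i b \<and>
        rel_option S (f_word n i a) (f_word n i b) \<and> rel_option S (e_word n i a) (e_word n i b)"
        using b f e by (simp add: ab wt_append eps_append phi_append)
    qed
    show "bi_unique S"
      unfolding bi_unique_def
    proof (intro conjI allI impI)
      fix a b c assume "S a b" "S a c"
      then show "b = c" using R(2) unfolding S_def bi_unique_def by (auto simp: append_eq_append_conv)
    next
      fix a b c assume "S a c" "S b c"
      then show "a = b" using R(2) unfolding S_def bi_unique_def by (auto simp: append_eq_append_conv)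
    qed
    show "S (u @ x @ v) (u @ y @ v)" by (rule SI) (use R in auto)
  qed
qed

lemma component_step:
  assumes "u \<in> component n w" "i \<in> {1..int n}" "f_word n i u = Some v \<or> e_word n i u = Some v"
  shows "v \<in> component n w"
  unfolding component_def mem_Collect_eq
proof (rule rtranclp.rtrancl_into_rtrancl)
  show "(\<lambda>x y. \<exists>i\<in>{1..int n}. f_word n i x = Some y \<or> e_word n i x = Some y)\<^sup>*\<^sup>* w u"
    using assms(1) by (simp add: component_def)
qed (use assms in blast)

text \<open>A bisimulation follows every path and thus links each element of one component to one of
  the other; being a partial bijection, it is an isomorphism there. Conversely, the graph of an
  isomorphism is a bisimulation because components are closed under the operators.\<close>

lemma crystal_equiv_iff:
  "crystal_equiv n w w' \<longleftrightarrow> (\<exists>\<psi>. crystal_iso n (component n w) (component n w') \<psi> \<and> \<psi> w = w')"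
proof
  assume "crystal_equiv n w w'"
  then obtain R where R: "bisim n R" "bi_unique R" "R w w'" by (auto simp: crystal_equiv_def)
  have uniq: "R x y \<Longrightarrow> R x y' \<Longrightarrow> y = y'" "R x y \<Longrightarrow> R x' y \<Longrightarrow> x = x'" for x x' y y'
    using R(2) unfolding bi_unique_def by blast+
  have fwd: "\<exists>y\<in>component n b. R x y" if "x \<in> component n a" "R a b" "bisim n R" for x a b R
    using that(1) unfolding component_def mem_Collect_eq
  proof (induction rule: rtranclp_induct)
    case base
    then show ?case using that(2) by blast
  next
    case (step x z)
    then obtain y where y: "R x y" "y \<in> component n b" by (auto simp: component_def)
    obtain i where i: "i \<in> {1..int n}" "f_word n i x = Some z \<or> e_word n i x = Some z" using step by blast
    then have "\<exists>y'. R z y' \<and> (f_word n i y = Some y' \<or> e_word n i y = Some y')"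
      using that(3) y(1) unfolding bisim_def by (metis option_rel_Some1)
    then show ?case using component_step[OF y(2) i(1)] by (auto simp: component_def)
  qed
  define \<psi> where "\<psi> x = (THE y. R x y)" for x
  have psi: "\<psi> x = y" if "R x y" for x y unfolding \<psi>_def using that uniq(1) by blast
  have maps: "R x (\<psi> x) \<and> \<psi> x \<in> component n w'" if "x \<in> component n w" for x
    using fwd[OF that R(3,1)] psi by blast
  have "bisim n R\<inverse>\<inverse>" using R(1) unfolding bisim_def by (simp add: option.rel_conversep)
  then have onto: "\<exists>x\<in>component n w. R x y" if "y \<in> component n w'" for y
    using fwd[of y w' "R\<inverse>\<inverse>" w] that R(3) by auto
  have "bij_betw \<psi> (component n w) (component n w')"
  proof (rule bij_betwI')
    show "\<psi> x = \<psi> y \<longleftrightarrow> x = y" if "x \<in> component n w" "y \<in> component n w" for x y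
      using maps[OF that(1)] maps[OF that(2)] uniq(2) by metis
    show "\<exists>x\<in>component n w. y = \<psi> x" if "y \<in> component n w'" for y using onto[OF that] psi by blast
  qed (use maps in blast)
  moreover have "wt (\<psi> u) i = wt u i \<and> eps n i (\<psi> u) = eps n i u \<and> phi n i (\<psi> u) = phi n i u \<and>
      f_word n i (\<psi> u) = map_option \<psi> (f_word n i u) \<and> e_word n i (\<psi> u) = map_option \<psi> (e_word n i u)"
    if "u \<in> component n w" "i \<in> {1..int n}" for u i
  proof -
    have m: "z = map_option \<psi> z'" if "rel_option R z' z" for z z'
      using that psi by (cases z'; cases z) auto
    show ?thesis using R(1) maps[OF that(1)] that(2) m unfolding bisim_def by metis
  qed
  ultimately show "\<exists>\<psi>. crystal_iso n (component n w) (component n w') \<psi> \<and> \<psi> w = w'"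
    using psi[OF R(3)] unfolding crystal_iso_def by blast
next
  assume "\<exists>\<psi>. crystal_iso n (component n w) (component n w') \<psi> \<and> \<psi> w = w'"
  then obtain \<psi> where iso: "crystal_iso n (component n w) (component n w') \<psi>" and w: "\<psi> w = w'" by blast
  define R where "R x y \<longleftrightarrow> x \<in> component n w \<and> y = \<psi> x" for x y
  show "crystal_equiv n w w'"
  proof (rule crystal_equivI[of n R])
    show "bisim n R"
      unfolding bisim_def
    proof (intro allI impI ballI)
      fix x y i assume "R x y" and i: "i \<in> {1..int n}"
      then have x: "x \<in> component n w" "y = \<psi> x" by (auto simp: R_def)
      have c: "f_word n i x = Some z \<Longrightarrow> z \<in> component n w" "e_word n i x = Some z \<Longrightarrow> z \<in> component n w" for z
        using component_step[OF x(1) i] by blast+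
      have m: "wt (\<psi> x) i = wt x i \<and> eps n i (\<psi> x) = eps n i x \<and> phi n i (\<psi> x) = phi n i x \<and>
        f_word n i (\<psi> x) = map_option \<psi> (f_word n i x) \<and> e_word n i (\<psi> x) = map_option \<psi> (e_word n i x)"
        using iso x(1) i unfolding crystal_iso_def by blast
      have "rel_option R (f_word n i x) (f_word n i y)" "rel_option R (e_word n i x) (e_word n i y)"
        using m c unfolding x(2) by (cases "f_word n i x"; cases "e_word n i x"; auto simp: R_def)+
      then show "wt x i = wt y i \<and> eps n i x = eps n i y \<and> phi n i x = phi n i y \<and>
        rel_option R (f_word n i x) (f_word n i y) \<and> rel_option R (e_word n i x) (e_word n i y)"
        using m x(2) by simp
    qed
    have "inj_on \<psi> (component n w)" using iso by (auto simp: crystal_iso_def bij_betw_def)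
    then show "bi_unique R" unfolding bi_unique_def R_def by (auto dest: inj_onD)
    show "R w w'" using w by (simp add: R_def component_def)
  qed
qed

section \<open>Plactic triples form a bisimulation\<close>

definition knuth :: "nat \<Rightarrow> int list \<Rightarrow> int list \<Rightarrow> bool" where
  "knuth n t t' \<longleftrightarrow> (\<exists>a b c a' b' c'. t = [a, b, c] \<and> t' = [a', b', c'] \<and>
     {a, b, c, a', b', c'} \<subseteq> set (letters n) \<and>
     knuth_ranks (int n) (rank n a) (rank n b) (rank n c) (rank n a') (rank n b') (rank n c'))"

lemma letter_sign_rank:
  assumes "x \<in> set (letters n)" "i \<in> {1..int n}"
  shows "letter_sign n i x = Some Plus \<longleftrightarrow> plus_rank (int n) i (rank n x)"
    and "letter_sign n i x = Some Minus \<longleftrightarrow> minus_rank (int n) i (rank n x)"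
  using assms by (auto simp: letter_sign_def plus_rank_def minus_rank_def rank_def set_letters)

lemma rank_f_letter:
  assumes "x \<in> set (letters n)" "i \<in> {1..int n}" "letter_sign n i x = Some Plus"
  shows "f_letter n i x \<in> set (letters n)" "rank n (f_letter n i x) = rank n x + 1"
  using assms by (auto simp: letter_sign_def f_letter_def rank_def set_letters split: if_splits)

lemma rank_uminus: "x \<in> set (letters n) \<Longrightarrow> rank n (- x) = 2 * int n + 1 - rank n x"
  by (auto simp: rank_def set_letters)

lemma uminus_letters: "- x \<in> set (letters n) \<longleftrightarrow> x \<in> set (letters n)"
  by (auto simp: set_letters)

lemma f_word_triple:
  assumes "{a, b, c} \<subseteq> set (letters n)" "i \<in> {1..int n}"
  shows "f_word n i [a, b, c] =
    (if acts1 (int n) i (rank n a) (rank n b) (rank n c) then Some [f_letter n i a, b, c]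
     else if acts2 (int n) i (rank n a) (rank n b) (rank n c) then Some [a, f_letter n i b, c]
     else if acts3 (int n) i (rank n a) (rank n b) (rank n c) then Some [a, b, f_letter n i c] else None)"
proof -
  have "a \<in> set (letters n)" "b \<in> set (letters n)" "c \<in> set (letters n)" using assms(1) by auto
  note s = this[THEN letter_sign_rank(1), OF assms(2)] this[THEN letter_sign_rank(2), OF assms(2)]
  have ex: "\<not> (plus_rank (int n) i r \<and> minus_rank (int n) i r)" for r
    unfolding plus_rank_def minus_rank_def by presburger
  show ?thesis
    unfolding f_word_Cons[of n i a "[b, c]"] pair_word eps_single phi_single f_word_single s
      acts1_def acts2_def acts3_def
    using ex[of "rank n a"] ex[of "rank n b"] ex[of "rank n c"] by auto
qed

lemma knuth_f:
  assumes "knuth n t t'" "i \<in> {1..int n}"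
  shows "rel_option (knuth n) (f_word n i t) (f_word n i t')"
proof -
  obtain a b c a' b' c' where t: "t = [a, b, c]" "t' = [a', b', c']"
    and L: "{a, b, c} \<subseteq> set (letters n)" "{a', b', c'} \<subseteq> set (letters n)"
    and k: "knuth_ranks (int n) (rank n a) (rank n b) (rank n c) (rank n a') (rank n b') (rank n c')"
    using assms(1) unfolding knuth_def by auto
  have i: "1 \<le> i" "i \<le> int n" using assms(2) by auto
  let ?a1 = "acts1 (int n) i (rank n a) (rank n b) (rank n c)"
    and ?a2 = "acts2 (int n) i (rank n a) (rank n b) (rank n c)"
    and ?a3 = "acts3 (int n) i (rank n a) (rank n b) (rank n c)"
    and ?b1 = "acts1 (int n) i (rank n a') (rank n b') (rank n c')"
    and ?b2 = "acts2 (int n) i (rank n a') (rank n b') (rank n c')"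
    and ?b3 = "acts3 (int n) i (rank n a') (rank n b') (rank n c')"
  have fl: "f_letter n i x \<in> set (letters n) \<and> rank n (f_letter n i x) = rank n x + 1"
    if "x \<in> set (letters n)" "plus_rank (int n) i (rank n x)" for x
    using rank_f_letter[OF that(1) assms(2)] letter_sign_rank(1)[OF that(1) assms(2)] that(2) by blast
  have ex: "?a2 \<Longrightarrow> \<not> ?a1" "?a3 \<Longrightarrow> \<not> ?a1 \<and> \<not> ?a2" "?b2 \<Longrightarrow> \<not> ?b1" "?b3 \<Longrightarrow> \<not> ?b1 \<and> \<not> ?b2"
    unfolding acts2_def acts3_def by blast+
  have pl: "?a1 \<Longrightarrow> plus_rank (int n) i (rank n a)" "?a2 \<Longrightarrow> plus_rank (int n) i (rank n b)"
    "?a3 \<Longrightarrow> plus_rank (int n) i (rank n c)" "?b1 \<Longrightarrow> plus_rank (int n) i (rank n a')"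
    "?b2 \<Longrightarrow> plus_rank (int n) i (rank n b')" "?b3 \<Longrightarrow> plus_rank (int n) i (rank n c')"
    by (simp_all add: acts1_def acts2_def acts3_def)
  note F = f_word_triple[OF L(1) assms(2)] f_word_triple[OF L(2) assms(2)]
  consider ?a1 | ?a2 | ?a3 | "\<not> ?a1" "\<not> ?a2" "\<not> ?a3" by blast
  then show ?thesis
  proof cases
    case 1
    with knuth_acts1[OF k i 1] show ?thesis
      unfolding t F using ex fl pl L by (elim disjE conjE) (simp_all add: knuth_def)
  next
    case 2
    with knuth_acts2[OF k i 2] show ?thesis
      unfolding t F using ex fl pl L by (elim disjE conjE) (simp_all add: knuth_def)
  next
    case 3
    with knuth_acts3[OF k i 3] show ?thesis
      unfolding t F using ex fl pl L by (elim disjE conjE) (simp_all add: knuth_def)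
  next
    case 4
    then show ?thesis unfolding t F using knuth_acts_none[OF k i 4] by simp
  qed
qed

lemma knuth_star:
  assumes "knuth n t t'"
  shows "knuth n (star t') (star t)"
proof -
  obtain a b c a' b' c' where t: "t = [a, b, c]" "t' = [a', b', c']"
    and L: "a \<in> set (letters n)" "b \<in> set (letters n)" "c \<in> set (letters n)"
      "a' \<in> set (letters n)" "b' \<in> set (letters n)" "c' \<in> set (letters n)"
    and k: "knuth_ranks (int n) (rank n a) (rank n b) (rank n c) (rank n a') (rank n b') (rank n c')"
    using assms unfolding knuth_def by auto
  show ?thesis
    unfolding knuth_def t star_def
    using knuth_ranks_star[OF k] L by (simp add: rank_uminus uminus_letters)
qed

lemma knuth_star_iff: "knuth n (star t') (star t) \<longleftrightarrow> knuth n t t'"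
  using knuth_star[of n t t'] knuth_star[of n "star t'" "star t"] by auto

text \<open>The relation is reversed by \<open>star\<close>, which exchanges
  \<open>e\<^sub>i\<close> and \<open>f\<^sub>i\<close>, so no second case analysis is
  required.\<close>

lemma knuth_e:
  assumes "knuth n t t'" "i \<in> {1..int n}"
  shows "rel_option (knuth n) (e_word n i t) (e_word n i t')"
proof -
  have "rel_option (knuth n) (f_word n i (star t')) (f_word n i (star t))"
    by (rule knuth_f[OF knuth_star[OF assms(1)] assms(2)])
  then have "rel_option (\<lambda>x y. knuth n (star x) (star y)) (e_word n i t') (e_word n i t)"
    by (simp add: f_word_star[OF assms(2)] option.rel_map)
  then show ?thesis
    by (cases "e_word n i t"; cases "e_word n i t'") (simp_all add: knuth_star_iff)
qed

text \<open>\<open>phi\<close> is the number of times \<open>f\<^sub>i\<close> can be applied, so it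
  is preserved by every relation compatible with \<open>f\<^sub>i\<close>.\<close>

lemma phi_rel:
  assumes R: "\<And>x y. R x y \<Longrightarrow> rel_option R (f_word n i x) (f_word n i y)" and i: "i \<in> {1..int n}"
  shows "R x y \<Longrightarrow> phi n i x = phi n i y"
proof (induction "phi n i x" arbitrary: x y)
  case 0
  then have "f_word n i x = None" by (simp add: f_word_None)
  then have "f_word n i y = None" using R[OF 0(2)] by simp
  then show ?case using 0 by (simp add: f_word_None)
next
  case (Suc k)
  then obtain x' where x': "f_word n i x = Some x'" using f_word_None[of n i x] by fastforce
  then obtain y' where y': "f_word n i y = Some y'" "R x' y'" using R[OF Suc.prems] by (auto simp: option_rel_Some1)
  show ?case using f_word_inverse[OF i x'] f_word_inverse[OF i y'(1)] Suc.hyps(1)[OF _ y'(2)] Suc.hyps(2) by simp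
qed

text \<open>Either the letters are permuted, or a pair \<open>y\<close>, \<open>- y\<close> of
  weight 0 is replaced by another such pair next to a common letter.\<close>

lemma knuth_wt:
  assumes "knuth n t t'" "0 < j"
  shows "wt t j = wt t' j"
proof -
  obtain a b c a' b' c' where t: "t = [a, b, c]" "t' = [a', b', c']"
    and L: "{a, b, c, a', b', c'} \<subseteq> set (letters n)"
    and k: "knuth_ranks (int n) (rank n a) (rank n b) (rank n c) (rank n a') (rank n b') (rank n c')"
    using assms(1) unfolding knuth_def by auto
  have inj: "rank n x = rank n y \<longleftrightarrow> x = y" if "{x, y} \<subseteq> {a, b, c, a', b', c'}" for x y
    using rank_inj[of x n y] L that by auto
  have pair: "x = - y" if "{x, y} \<subseteq> {a, b, c, a', b', c'}" "rank n x + rank n y = 2 * int n + 1" for x y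
    using rank_inj[of x n "- y"] rank_uminus[of y n] uminus_letters[of y n] L that by auto
  have z: "wt [- y] j = - wt [y] j" for y using assms(2) by (simp add: wt_single)
  have "a' = a \<and> b' = c \<and> c' = b \<or> a' = b \<and> b' = a \<and> c' = c \<or> a' = a \<and> b = - c \<and> b' = - c' \<or>
      c' = c \<and> a = - b \<and> a' = - b'"
    using k inj[of a' a] inj[of b' c] inj[of c' b] inj[of a' b] inj[of b' a] inj[of c' c]
      pair[of b c] pair[of b' c'] pair[of a b] pair[of a' b']
    unfolding knuth_ranks_def by (elim disjE conjE) auto
  moreover have "wt [x, y, w] j = wt [x] j + wt [y] j + wt [w] j" for x y w
    using wt_Cons[of x "[y, w]" j] wt_Cons[of y "[w]" j] by simp
  ultimately show ?thesis unfolding t by (elim disjE conjE) (simp_all add: z)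
qed

lemma knuth_crystal_equiv:
  assumes "knuth n t t'"
  shows "crystal_equiv n t t'"
proof (rule crystal_equivI[of n "knuth n"])
  show "bisim n (knuth n)"
    unfolding bisim_def
  proof (intro allI impI ballI)
    fix x y i assume k: "knuth n x y" and i: "i \<in> {1..int n}"
    have p: "phi n i x = phi n i y" using phi_rel[of "knuth n" n i] knuth_f k i by blast
    have w: "wt x i = wt y i" "wt x (i + 1) = wt y (i + 1)" using knuth_wt[OF k] i by auto
    \<comment> \<open>The weight determines the difference of \<open>phi\<close> and
      \<open>eps\<close>.\<close>
    have "eps n i x = eps n i y"
      using phi_minus_eps[OF i, of x] phi_minus_eps[OF i, of y] p w by (simp split: if_splits)
    then show "wt x i = wt y i \<and> eps n i x = eps n i y \<and> phi n i x = phi n i y \<and>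
        rel_option (knuth n) (f_word n i x) (f_word n i y) \<and> rel_option (knuth n) (e_word n i x) (e_word n i y)"
      using p w knuth_f[OF k i] knuth_e[OF k i] by blast
  qed
  show "bi_unique (knuth n)"
    unfolding bi_unique_def
  proof (intro conjI allI impI)
    fix x y z assume *: "knuth n x y" "knuth n x z"
    obtain a b c a1 b1 c1 where 1: "x = [a, b, c]" "y = [a1, b1, c1]" "{a1, b1, c1} \<subseteq> set (letters n)"
      "knuth_ranks (int n) (rank n a) (rank n b) (rank n c) (rank n a1) (rank n b1) (rank n c1)"
      using *(1) unfolding knuth_def by auto
    obtain a2 b2 c2 where 2: "z = [a2, b2, c2]" "{a2, b2, c2} \<subseteq> set (letters n)"
      "knuth_ranks (int n) (rank n a) (rank n b) (rank n c) (rank n a2) (rank n b2) (rank n c2)"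
      using *(2) 1(1) unfolding knuth_def by auto
    show "y = z" using knuth_ranks_unique(1)[OF 1(4) 2(3)] 1(2,3) 2(1,2) rank_inj[of a1 n a2] rank_inj[of b1 n b2] rank_inj[of c1 n c2]
      by simp
  next
    fix x y z assume *: "knuth n x z" "knuth n y z"
    obtain a b c a1 b1 c1 where 1: "z = [a, b, c]" "x = [a1, b1, c1]" "{a1, b1, c1} \<subseteq> set (letters n)"
      "knuth_ranks (int n) (rank n a1) (rank n b1) (rank n c1) (rank n a) (rank n b) (rank n c)"
      using *(1) unfolding knuth_def by auto
    obtain a2 b2 c2 where 2: "y = [a2, b2, c2]" "{a2, b2, c2} \<subseteq> set (letters n)"
      "knuth_ranks (int n) (rank n a2) (rank n b2) (rank n c2) (rank n a) (rank n b) (rank n c)"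
      using *(2) 1(1) unfolding knuth_def by auto
    show "x = y" using knuth_ranks_unique(2)[OF 1(4) 2(3)] 1(2,3) 2(1,2) rank_inj[of a1 n a2] rank_inj[of b1 n b2] rank_inj[of c1 n c2]
      by simp
  qed
qed (rule assms)

text \<open>Two unbarred ranks never add up to \<open>2 * int n + 1\<close>, so the first two
  clauses apply and give the classical Knuth relations.\<close>

lemma knuth_positive:
  assumes "1 \<le> x" "z \<le> int n"
  shows "x \<le> y \<Longrightarrow> y < z \<Longrightarrow> crystal_equiv n [y, z, x] [y, x, z]"
    and "x < y \<Longrightarrow> y \<le> z \<Longrightarrow> crystal_equiv n [x, z, y] [z, x, y]"
proof -
  have r: "rank n y = y" if "1 \<le> y" for y using that by (simp add: rank_def)
  show "crystal_equiv n [y, z, x] [y, x, z]" if "x \<le> y" "y < z"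
    by (rule knuth_crystal_equiv) (use assms that in \<open>auto simp: knuth_def set_letters r knuth_ranks_def\<close>)
  show "crystal_equiv n [x, z, y] [z, x, y]" if "x < y" "y \<le> z"
    by (rule knuth_crystal_equiv) (use assms that in \<open>auto simp: knuth_def set_letters r knuth_ranks_def\<close>)
qed

lemma crystal_equiv_context:
  "crystal_equiv n x y \<Longrightarrow> w = u @ x @ v \<Longrightarrow> w' = u @ y @ v \<Longrightarrow> crystal_equiv n w w'"
  by (simp add: crystal_equiv_append)

section \<open>Commuting the columns of highest weight\<close>

definition top_column :: "nat \<Rightarrow> int list" where
  "top_column a = [1..int a]"

lemma top_column_0 [simp]: "top_column 0 = []"
  and top_column_Suc: "top_column (Suc a) = top_column a @ [int a + 1]"
  using upto_rec2[of 1 "int (Suc a)"] by (simp_all add: top_column_def)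

text \<open>A Knuth move exchanges two letters only beside a suitable third one. Here
  \<open>x\<close> passes \<open>int j + 1\<close> thanks to \<open>int j + 2\<close> on its right,
  and then each smaller letter thanks to the one just passed.\<close>

lemma letter_climbs:
  assumes "x \<le> int n" "int j + 2 \<le> x"
  shows "crystal_equiv n (top_column (Suc j) @ [x, int j + 2]) ([x] @ top_column (Suc (Suc j)))"
  using assms(2)
proof (induction j)
  case 0
  have "crystal_equiv n [1, x, 2] [x, 1, 2]" by (rule knuth_positive) (use 0 assms(1) in auto)
  then show ?case by (simp add: top_column_Suc)
next
  case (Suc j)
  have "crystal_equiv n [int j + 2, x, int j + 3] [x, int j + 2, int j + 3]"
    by (rule knuth_positive) (use Suc.prems assms(1) in auto)
  then have "crystal_equiv n (top_column (Suc (Suc j)) @ [x, int j + 3])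
      (top_column (Suc j) @ [x, int j + 2, int j + 3])"
    by (rule crystal_equiv_context[where u = "top_column (Suc j)" and v = "[]"]) (simp_all add: top_column_Suc)
  also have "crystal_equiv n (top_column (Suc j) @ [x, int j + 2, int j + 3]) ([x] @ top_column (Suc (Suc (Suc j))))"
  proof (rule crystal_equiv_context[where u = "[]" and v = "[int j + 3]"])
    show "crystal_equiv n (top_column (Suc j) @ [x, int j + 2]) ([x] @ top_column (Suc (Suc j)))"
      by (rule Suc.IH) (use Suc.prems in simp)
  qed (simp_all add: top_column_Suc)
  finally show ?case by (simp add: add.commute)
qed

text \<open>While \<open>x\<close> travels left past the letters greater than \<open>x\<close>, the
  witness is the letter standing to the left of the pair. This reduces the claim to a column that
  ends in \<open>x\<close>.\<close>

lemma letter_commutes: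
  assumes "1 \<le> x" "x \<le> a" "a \<le> n"
  shows "crystal_equiv n (top_column a @ [int x]) ([int x] @ top_column a)"
  using assms(2,3)
proof (induction a rule: dec_induct)
  case base
  consider "x = 1" | j where "x = Suc (Suc j)" using assms(1) by (metis One_nat_def Suc_le_D not0_implies_Suc)
  then show ?case
  proof cases
    case 2
    \<comment> \<open>The word now ends in two copies of \<open>x\<close>. The first copy climbs to
      the front and the second takes its place in the column; this is the extreme case
      \<open>x = j + 2\<close>.\<close>
    then show ?thesis using letter_climbs[of "int x" n j] base by (simp add: top_column_Suc add.commute)
  qed (simp add: crystal_equiv_refl top_column_Suc)
next
  case (step a)
  obtain k where k: "a = Suc k" using step assms(1) by (cases a) auto
  have "crystal_equiv n [int a, int a + 1, int x] [int a, int x, int a + 1]"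
    by (rule knuth_positive) (use step assms(1) in auto)
  then have "crystal_equiv n (top_column (Suc a) @ [int x]) (top_column a @ [int x, int a + 1])"
    by (rule crystal_equiv_context[where u = "top_column k" and v = "[]"]) (simp_all add: k top_column_Suc add.commute)
  also have "crystal_equiv n (top_column a @ [int x, int a + 1]) ([int x] @ top_column (Suc a))"
  proof (rule crystal_equiv_context[where u = "[]" and v = "[int a + 1]"])
    show "crystal_equiv n (top_column a @ [int x]) ([int x] @ top_column a)"
      by (rule step.IH) (use step.prems in simp)
  qed (simp_all add: top_column_Suc)
  finally show ?case .
qed

lemma columns_commute:
  assumes "a \<le> n" "b \<le> n"
  shows "crystal_equiv n (top_column a @ top_column b) (top_column b @ top_column a)"
proof -
  have *: "crystal_equiv n (top_column a @ top_column b) (top_column b @ top_column a)" if "b \<le> a" "a \<le> n" for a b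
    using that(1)
  proof (induction b)
    case (Suc b)
    have "crystal_equiv n (top_column a @ top_column (Suc b)) (top_column b @ top_column a @ [int b + 1])"
    proof (rule crystal_equiv_context[where u = "[]" and v = "[int b + 1]"])
      show "crystal_equiv n (top_column a @ top_column b) (top_column b @ top_column a)"
        by (rule Suc.IH) (use Suc.prems in simp)
    qed (simp_all add: top_column_Suc)
    also have "crystal_equiv n \<dots> (top_column (Suc b) @ top_column a)"
    proof (rule crystal_equiv_context[where u = "top_column b" and v = "[]"])
      show "crystal_equiv n (top_column a @ [int (Suc b)]) ([int (Suc b)] @ top_column a)"
        by (rule letter_commutes) (use Suc.prems that(2) in simp_all)
    qed (simp_all add: top_column_Suc add.commute)
    finally show ?case .
  qed (simp add: crystal_equiv_refl)
  show ?thesis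
  proof (cases "b \<le> a")
    case False
    then show ?thesis using crystal_equiv_sym[OF *[of a b]] assms by simp
  qed (use * assms in blast)
qed

lemma columns_reverse:
  assumes "\<forall>a\<in>set xs. a \<le> n"
  shows "crystal_equiv n (concat (map top_column xs)) (concat (map top_column (rev xs)))"
  using assms
proof (induction xs)
  case (Cons a xs)
  let ?U = "\<lambda>xs. concat (map top_column xs)"
  have a: "a \<le> n" using Cons.prems by simp
  have swap: "crystal_equiv n (top_column a @ ?U ys) (?U ys @ top_column a)" if "\<forall>b\<in>set ys. b \<le> n" for ys
    using that
  proof (induction ys)
    case (Cons b ys)
    have "crystal_equiv n (top_column a @ ?U (b # ys)) (top_column b @ top_column a @ ?U ys)"
    proof (rule crystal_equiv_context[where u = "[]" and v = "?U ys"])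
      show "crystal_equiv n (top_column a @ top_column b) (top_column b @ top_column a)"
        by (rule columns_commute) (use Cons.prems a in simp_all)
    qed simp_all
    also have "crystal_equiv n \<dots> (?U (b # ys) @ top_column a)"
    proof (rule crystal_equiv_context[where u = "top_column b" and v = "[]"])
      show "crystal_equiv n (top_column a @ ?U ys) (?U ys @ top_column a)"
        by (rule Cons.IH) (use Cons.prems in simp)
    qed simp_all
    finally show ?case .
  qed (simp add: crystal_equiv_refl)
  have "crystal_equiv n (?U (a # xs)) (top_column a @ ?U (rev xs))"
  proof (rule crystal_equiv_context[where u = "top_column a" and v = "[]"])
    show "crystal_equiv n (?U xs) (?U (rev xs))"
      by (rule Cons.IH) (use Cons.prems in simp)
  qed simp_all
  also have "crystal_equiv n \<dots> (?U (rev xs) @ top_column a)" by (rule swap) (use Cons.prems in simp)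
  finally show ?case by simp
qed (simp add: crystal_equiv_refl)

section \<open>Tableaux in a component\<close>

text \<open>Every \<open>f\<^sub>i\<close> raises one rank by 1, so this grades the crystal: it
  decreases on the way up, and its distance to the bound of \<open>rank_sum_word_le\<close>
  decreases on the way down.\<close>

definition rank_sum_word :: "nat \<Rightarrow> int list \<Rightarrow> nat" where
  "rank_sum_word n w = (\<Sum>x\<leftarrow>w. nat (rank n x))"

lemma rank_sum_word_f:
  assumes "i \<in> {1..int n}" "set w \<subseteq> set (letters n)" "f_word n i w = Some w'"
  shows "rank_sum_word n w' = Suc (rank_sum_word n w) \<and> length w' = length w"
  using assms(2,3)
proof (induction w arbitrary: w')
  case (Cons x v)
  show ?case
  proof (cases "phi n i [x] > eps n i v")
    case True
    then have x: "letter_sign n i x = Some Plus" and w': "w' = f_letter n i x # v"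
      using Cons.prems by (auto simp: f_word_Cons phi_single split: if_splits)
    have "x \<in> set (letters n)" using Cons.prems(1) by simp
    then show ?thesis
      using rank_f_letter[OF _ assms(1) x] rank_bounds[of x n] w' by (simp add: rank_sum_word_def nat_add_distrib)
  next
    case False
    then obtain v' where v: "f_word n i v = Some v'" "w' = x # v'"
      using Cons.prems by (auto simp: f_word_Cons)
    then show ?thesis using Cons.IH[OF _ v(1)] Cons.prems(1) by (simp add: rank_sum_word_def)
  qed
qed simp

lemma rank_sum_word_le:
  "set w \<subseteq> set (letters n) \<Longrightarrow> rank_sum_word n w \<le> 2 * n * length w"
proof (induction w)
  case (Cons x w)
  then have "nat (rank n x) \<le> 2 * n" using rank_bounds[of x n] by (simp add: nat_le_iff)
  then show ?case using Cons by (simp add: rank_sum_word_def)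
qed (simp add: rank_sum_word_def)

lemma KN_letters: "T \<in> KN n \<mu> \<Longrightarrow> set (cr T) \<subseteq> set (letters n)"
  by (auto simp: KN_iff cr_def dest: admissibleD(2))

lemma KN_semistandard:
  assumes "T \<in> KN n \<mu>"
  shows "sorted_wrt semistandard_pair T" "\<forall>C\<in>set T. admissible n C" "map length T = column_lengths \<mu>"
  using assms by (auto simp: KN_def semistandard_def has_shape_def)

lemma KN_highest_eq:
  assumes "T \<in> KN n \<mu>" "\<forall>i\<in>{1..int n}. eps n i (cr T) = 0"
  shows "T = map top_column (map length T)"
proof -
  have "\<forall>C\<in>set T. C = top_column (length C)"
    unfolding top_column_def by (rule highest_columns[OF KN_semistandard(1,2)[OF assms(1)] assms(2)])
  then have "map (\<lambda>C. top_column (length C)) T = map (\<lambda>C. C) T" by (intro map_cong) metis+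
  then show ?thesis by (simp add: comp_def)
qed

text \<open>Instead of computing the split form of the candidate, one climbs from any given tableau:
  the operators \<open>e\<^sub>i\<close> stay within the shape, and by \<open>KN_highest_eq\<close>
  they can only stop at the candidate.\<close>

lemma KN_highest:
  assumes "T \<in> KN n \<mu>"
  shows "map top_column (column_lengths \<mu>) \<in> KN n \<mu>"
  using assms
proof (induction "rank_sum_word n (cr T)" arbitrary: T rule: less_induct)
  case less
  show ?case
  proof (cases "\<forall>i\<in>{1..int n}. eps n i (cr T) = 0")
    case True
    then show ?thesis using KN_highest_eq[OF less.prems True] less.prems KN_semistandard(3)[OF less.prems] by simp
  next
    case False
    then obtain i w where i: "i \<in> {1..int n}" and w: "e_word n i (cr T) = Some w"
      using e_word_None by (metis not_None_eq)
    obtain U where U: "U \<in> KN n \<mu>" "cr U = w" using KN_e_closed[OF less.prems i w] by blast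
    have "f_word n i (cr U) = Some (cr T)" using e_word_inverse[OF i w] U by simp
    then have "rank_sum_word n (cr U) < rank_sum_word n (cr T)"
      using rank_sum_word_f[OF i KN_letters[OF U(1)]] by simp
    then show ?thesis using less.hyps U(1) by blast
  qed
qed

lemma star_top_column: "star (top_column a) = [- int a..- 1]"
proof (induction a)
  case (Suc a)
  have "[- int (Suc a)..- 1] = - int (Suc a) # [- int a..- 1]"
    using upto_rec1[of "- int (Suc a)" "- 1"] by simp
  then show ?case using Suc by (simp add: top_column_Suc star_append del: of_nat_Suc)
qed (simp add: star_def)

text \<open>The columns appear here from left to right, whereas \<open>cr\<close> reads them from
  right to left. This discrepancy is what \<open>columns_reverse\<close> repairs.\<close>

lemma KN_lowest_star:
  assumes "T \<in> KN n \<mu>" "\<forall>i\<in>{1..int n}. phi n i (cr T) = 0"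
  shows "star (cr T) = concat (map top_column (column_lengths \<mu>))"
proof -
  have "\<forall>C\<in>set T. C = [- int (length C)..- 1]"
    by (rule lowest_columns[OF KN_semistandard(1,2)[OF assms(1)] assms(2)])
  then have st: "\<forall>C\<in>set T. star C = top_column (length C)" by (metis star_star star_top_column)
  have "star (cr U) = concat (map star U)" for U
    by (induction U) (simp_all add: cr_Cons star_append)
  moreover have "map star T = map top_column (map length T)" using st by simp
  ultimately show ?thesis by (simp only: KN_semistandard(3)[OF assms(1)])
qed

lemma column_lengths_pos: "a \<in> set (column_lengths \<mu>) \<Longrightarrow> 0 < a"
  by (cases \<mu>) (auto simp: column_lengths_def)

text \<open>In the highest weight tableau a column of length \<open>a\<close> contains the letter
  \<open>a\<close>.\<close>

lemma KN_column_length_le: "T \<in> KN n \<mu> \<Longrightarrow> a \<in> set (column_lengths \<mu>) \<Longrightarrow> a \<le> n"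
proof -
  assume T: "T \<in> KN n \<mu>" and a: "a \<in> set (column_lengths \<mu>)"
  have "admissible n (top_column a)" using KN_highest[OF T] a by (auto simp: KN_def)
  then have "set (top_column a) \<subseteq> set (letters n)" by (rule admissibleD(2))
  moreover have "int a \<in> set (top_column a)" using column_lengths_pos[OF a] by (simp add: top_column_def)
  ultimately show "a \<le> n" by (auto simp: set_letters)
qed

lemma KN_column_lengths_sorted:
  assumes "T \<in> KN n \<mu>"
  shows "sorted_wrt (\<ge>) (column_lengths \<mu>)"
proof -
  have "sorted_wrt (\<lambda>C D. length D \<le> length C) T"
    by (rule sorted_wrt_mono_rel[OF _ KN_semistandard(1)[OF assms]]) simp
  then show ?thesis by (simp flip: KN_semistandard(3)[OF assms] add: sorted_wrt_map)
qed

text \<open>The induction runs towards the lowest weight, where both words are explicit.\<close>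

lemma crystal_equiv_star_KN:
  assumes "T \<in> KN n \<mu>"
  shows "\<exists>U\<in>KN n \<mu>. crystal_equiv n (star (cr T)) (cr U)"
  using assms
proof (induction "2 * n * length (cr T) - rank_sum_word n (cr T)" arbitrary: T rule: less_induct)
  case less
  show ?case
  proof (cases "\<forall>i\<in>{1..int n}. phi n i (cr T) = 0")
    case True
    let ?K = "map top_column (column_lengths \<mu>)"
    have "crystal_equiv n (star (cr T)) (concat (map top_column (rev (column_lengths \<mu>))))"
      unfolding KN_lowest_star[OF less.prems True]
      by (rule columns_reverse) (use KN_column_length_le[OF less.prems] in blast)
    then have "crystal_equiv n (star (cr T)) (cr ?K)" by (simp add: cr_def rev_map)
    then show ?thesis using KN_highest[OF less.prems] by blast
  next
    case False
    then obtain i w where i: "i \<in> {1..int n}" and w: "f_word n i (cr T) = Some w"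
      using f_word_None by (metis not_None_eq)
    obtain V where V: "V \<in> KN n \<mu>" "cr V = w" using KN_f_closed[OF less.prems i w] by blast
    have "rank_sum_word n (cr V) = Suc (rank_sum_word n (cr T))" "length (cr V) = length (cr T)"
      using rank_sum_word_f[OF i KN_letters[OF less.prems] w] V by auto
    then have "2 * n * length (cr V) - rank_sum_word n (cr V) < 2 * n * length (cr T) - rank_sum_word n (cr T)"
      using rank_sum_word_le[OF KN_letters[OF V(1)]] by simp
    then obtain U where U: "U \<in> KN n \<mu>" "crystal_equiv n (star (cr V)) (cr U)"
      using less.hyps V(1) by blast
    \<comment> \<open>Going down from \<open>T\<close> to \<open>V\<close> means going up from
      \<open>star (cr T)\<close> to \<open>star (cr V)\<close>. Applying \<open>f\<^sub>i\<close> to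
      both sides of the equivalence for \<open>V\<close> therefore leads back to
      \<open>T\<close>.\<close>
    have "f_word n i (star (cr V)) = Some (star (cr T))"
      using f_word_inverse[OF i w] V(2) f_word_star[OF i] by simp
    then obtain u where u: "f_word n i (cr U) = Some u" "crystal_equiv n (star (cr T)) u"
      using crystal_equivD(4)[OF U(2) i] by blast
    then show ?thesis using KN_f_closed[OF U(1) i u(1)] by blast
  qed
qed

section \<open>Uniqueness of the tableau and evaluation of \<open>P\<close>\<close>

lemma sorted_eq_by_counts:
  fixes xs ys :: "nat list"
  assumes "sorted_wrt (\<ge>) xs" "sorted_wrt (\<ge>) ys" "0 \<notin> set xs" "0 \<notin> set ys"
    and "\<forall>a\<in>set xs \<union> set ys. a \<le> n"
    and "\<forall>j\<in>{1..n}. length (filter (\<lambda>a. j \<le> a) xs) = length (filter (\<lambda>a. j \<le> a) ys)"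
  shows "xs = ys"
  using assms
proof (induction xs arbitrary: ys)
  case Nil
  show ?case
  proof (cases ys)
    case (Cons y zs)
    then have "y \<in> {1..n}" using Nil.prems by auto
    then have "length (filter (\<lambda>a. y \<le> a) ys) = 0" using Nil.prems(6) by fastforce
    then show ?thesis using Cons by simp
  qed simp
next
  case (Cons x xs)
  have x: "x \<in> {1..n}" using Cons.prems by auto
  have "length (filter (\<lambda>a. x \<le> a) (x # xs)) \<noteq> 0" by simp
  then have "length (filter (\<lambda>a. x \<le> a) ys) \<noteq> 0" unfolding bspec[OF Cons.prems(6) x] .
  then obtain y zs where ys: "ys = y # zs" by (cases ys) auto
  have y: "y \<in> {1..n}" using Cons.prems ys by auto
  have "x \<le> y" using \<open>length (filter (\<lambda>a. x \<le> a) ys) \<noteq> 0\<close> Cons.prems(2) unfolding ys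
    by (auto simp: filter_empty_conv split: if_splits)
  moreover have "length (filter (\<lambda>a. y \<le> a) ys) \<noteq> 0" by (simp add: ys)
  then have "length (filter (\<lambda>a. y \<le> a) (x # xs)) \<noteq> 0" unfolding bspec[OF Cons.prems(6) y] .
  then have "y \<le> x" using Cons.prems(1) by (auto simp: filter_empty_conv split: if_splits)
  ultimately have xy: "x = y" by simp
  have "xs = zs"
  proof (rule Cons.IH)
    show "\<forall>j\<in>{1..n}. length (filter (\<lambda>a. j \<le> a) xs) = length (filter (\<lambda>a. j \<le> a) zs)"
    proof
      fix j assume "j \<in> {1..n}"
      then show "length (filter (\<lambda>a. j \<le> a) xs) = length (filter (\<lambda>a. j \<le> a) zs)"
        using bspec[OF Cons.prems(6), of j] unfolding ys xy by (auto split: if_splits)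
    qed
  qed (use Cons.prems ys in auto)
  then show ?case using xy ys by simp
qed

lemma wt_top_columns:
  assumes "0 < j"
  shows "wt (cr (map top_column xs)) (int j) = int (length (filter (\<lambda>a. j \<le> a) xs))"
proof -
  have "wt (top_column a) (int j) = (if j \<le> a then 1 else 0)" for a
    using assms by (auto simp: top_column_def wt_distinct)
  then show ?thesis unfolding wt_cr by (induction xs) auto
qed

text \<open>Both tableaux climb along the same operators until both are of highest weight. There the
  weight lists the row lengths, and these determine the column lengths as a partition is determined
  by its conjugate. On the way back \<open>f\<^sub>i\<close> is applied to equal words.\<close>

lemma KN_crystal_equiv_eq:
  assumes "T \<in> KN n \<mu>" "U \<in> KN n \<nu>" "crystal_equiv n (cr T) (cr U)"
  shows "T = U"
  using assms
proof (induction "rank_sum_word n (cr T)" arbitrary: T U rule: less_induct)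
  case less
  note T = less.prems(1) and U = less.prems(2) and TU = less.prems(3)
  show ?case
  proof (cases "\<forall>i\<in>{1..int n}. eps n i (cr T) = 0")
    case True
    then have Ueps: "\<forall>i\<in>{1..int n}. eps n i (cr U) = 0" using crystal_equivD(2)[OF TU] by simp
    have eq: "T = map top_column (column_lengths \<mu>)" "U = map top_column (column_lengths \<nu>)"
      using KN_highest_eq[OF T True] KN_highest_eq[OF U Ueps]
      unfolding KN_semistandard(3)[OF T] KN_semistandard(3)[OF U] .
    have "column_lengths \<mu> = column_lengths \<nu>"
    proof (rule sorted_eq_by_counts)
      show "\<forall>j\<in>{1..n}. length (filter (\<lambda>a. j \<le> a) (column_lengths \<mu>)) = length (filter (\<lambda>a. j \<le> a) (column_lengths \<nu>))"
      proof
        fix j assume "j \<in> {1..n}"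
        then have "wt (cr T) (int j) = wt (cr U) (int j)" "0 < j" using crystal_equivD(1)[OF TU] by auto
        then show "length (filter (\<lambda>a. j \<le> a) (column_lengths \<mu>)) = length (filter (\<lambda>a. j \<le> a) (column_lengths \<nu>))"
          unfolding eq using wt_top_columns by simp
      qed
      show "\<forall>a\<in>set (column_lengths \<mu>) \<union> set (column_lengths \<nu>). a \<le> n"
        using KN_column_length_le[OF T] KN_column_length_le[OF U] by blast
    qed (use KN_column_lengths_sorted[OF T] KN_column_lengths_sorted[OF U] column_lengths_pos in blast)+
    then show ?thesis using eq by simp
  next
    case False
    then obtain i w where i: "i \<in> {1..int n}" and w: "e_word n i (cr T) = Some w"
      using e_word_None by (metis not_None_eq)
    obtain u where u: "e_word n i (cr U) = Some u" "crystal_equiv n w u"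
      using crystal_equivD(5)[OF TU i w] by blast
    obtain T' U' where T': "T' \<in> KN n \<mu>" "cr T' = w" and U': "U' \<in> KN n \<nu>" "cr U' = u"
      using KN_e_closed[OF T i w] KN_e_closed[OF U i u(1)] by blast
    have fT: "f_word n i (cr T') = Some (cr T)" and fU: "f_word n i (cr U') = Some (cr U)"
      using e_word_inverse[OF i w] e_word_inverse[OF i u(1)] T' U' by simp_all
    have "T' = U'"
      using less.hyps[of T' U'] rank_sum_word_f[OF i KN_letters[OF T'(1)] fT] T' U' u(2) by simp
    then have "cr T = cr U" "column_lengths \<mu> = column_lengths \<nu>"
      using fT fU KN_semistandard(3)[OF T'(1)] KN_semistandard(3)[OF U'(1)] by simp_all
    then show ?thesis using cr_inj KN_semistandard(3)[OF T] KN_semistandard(3)[OF U] by metis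
  qed
qed

lemma P_eqI:
  assumes "partition_upto n \<mu>" "T \<in> KN n \<mu>" "crystal_equiv n w (cr T)"
  shows "P n w = T"
  unfolding P_def
proof (rule the_equality)
  show "(\<exists>\<nu>. partition_upto n \<nu> \<and> T \<in> KN n \<nu>) \<and>
     (\<exists>\<psi>. crystal_iso n (component n w) (component n (cr T)) \<psi> \<and> \<psi> w = cr T)"
    using assms crystal_equiv_iff by blast
  fix U assume U: "(\<exists>\<nu>. partition_upto n \<nu> \<and> U \<in> KN n \<nu>) \<and>
     (\<exists>\<psi>. crystal_iso n (component n w) (component n (cr U)) \<psi> \<and> \<psi> w = cr U)"
  then obtain \<nu> where \<nu>: "U \<in> KN n \<nu>" by blast
  have "crystal_equiv n w (cr U)" using U crystal_equiv_iff by blast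
  then have "crystal_equiv n (cr U) (cr T)" using assms(3) crystal_equiv_sym crystal_equiv_trans by blast
  then show "U = T" by (rule KN_crystal_equiv_eq[OF \<nu> assms(2)])
qed

section \<open>The map \<open>Ev\<close> and its compatibility with the operators\<close>

lemma KN_Ev:
  assumes "partition_upto n \<mu>" "T \<in> KN n \<mu>"
  shows "Ev n T \<in> KN n \<mu>" "crystal_equiv n (star (cr T)) (cr (Ev n T))"
  using crystal_equiv_star_KN[OF assms(2)] P_eqI[OF assms(1)] unfolding Ev_def by auto

lemma Ev_eqI:
  assumes "partition_upto n \<mu>" "T \<in> KN n \<mu>" "crystal_equiv n (star w) (cr T)" "w = cr U"
  shows "Ev n U = T"
  using P_eqI[OF assms(1-3)] assms(4) by (simp add: Ev_def)

text \<open>Within a fixed shape the column lengths are known, so the reading word determines the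
  tableau and the description in \<open>f_tab\<close> has a single solution.\<close>

lemma f_tab_eq:
  assumes "T \<in> KN n \<mu>" "i \<in> {1..int n}"
  shows "f_word n i (cr T) = None \<Longrightarrow> f_tab n \<mu> i T = None"
    "U \<in> KN n \<mu> \<Longrightarrow> f_word n i (cr T) = Some (cr U) \<Longrightarrow> f_tab n \<mu> i T = Some U"
  by (auto simp: f_tab_def intro: KN_cr_inj)

lemma e_tab_eq:
  assumes "T \<in> KN n \<mu>" "i \<in> {1..int n}"
  shows "e_word n i (cr T) = None \<Longrightarrow> e_tab n \<mu> i T = None"
    "U \<in> KN n \<mu> \<Longrightarrow> e_word n i (cr T) = Some (cr U) \<Longrightarrow> e_tab n \<mu> i T = Some U"
  by (auto simp: e_tab_def intro: KN_cr_inj)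

theorem mainTheorem4:
  fixes n :: nat and \<mu> :: "nat list"
  assumes "n \<ge> 1" and "partition_upto n \<mu>"
  shows "(\<forall>T\<in>KN n \<mu>. Ev n T \<in> KN n \<mu> \<and> Ev n (Ev n T) = T) \<and>
    (\<forall>T\<in>KN n \<mu>. \<forall>i\<in>{1..int n}.
       wt (cr (Ev n T)) i = - wt (cr T) i \<and>
       e_tab n \<mu> i (Ev n T) = map_option (Ev n) (f_tab n \<mu> i T) \<and>
       f_tab n \<mu> i (Ev n T) = map_option (Ev n) (e_tab n \<mu> i T) \<and>
       eps n i (cr (Ev n T)) = phi n i (cr T) \<and>
       phi n i (cr (Ev n T)) = eps n i (cr T))"
proof (intro conjI ballI)
  fix T assume T: "T \<in> KN n \<mu>"
  note Ev = KN_Ev[OF assms(2) T]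
  show "Ev n T \<in> KN n \<mu>" by (rule Ev(1))
  \<comment> \<open>Apply \<open>star\<close> to the equivalence that defines \<open>Ev n T\<close>;
    as \<open>star\<close> is an involution, the roles of the two tableaux are exchanged.\<close>
  have "crystal_equiv n (star (cr (Ev n T))) (cr T)"
    using crystal_equiv_star[OF crystal_equiv_sym[OF Ev(2)]] by simp
  then show "Ev n (Ev n T) = T" using Ev_eqI[OF assms(2) T] by blast
  fix i assume i: "i \<in> {1..int n}"
  note eq = crystal_equivD[OF Ev(2) i]
  show "wt (cr (Ev n T)) i = - wt (cr T) i" using eq(1) by (simp add: wt_star)
  show "eps n i (cr (Ev n T)) = phi n i (cr T)" using eq(2) by (simp add: eps_star[OF i])
  show "phi n i (cr (Ev n T)) = eps n i (cr T)" using eq(3) by (simp add: phi_star[OF i])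
  show "e_tab n \<mu> i (Ev n T) = map_option (Ev n) (f_tab n \<mu> i T)"
  proof (cases "f_word n i (cr T)")
    case None
    then have "e_word n i (cr (Ev n T)) = None"
      using eq(2) by (simp add: e_word_None f_word_None eps_star[OF i])
    then show ?thesis using f_tab_eq(1)[OF T i None] e_tab_eq(1)[OF Ev(1) i] by simp
  next
    case (Some w)
    obtain U where U: "U \<in> KN n \<mu>" "cr U = w" using KN_f_closed[OF T i Some] by blast
    have "e_word n i (star (cr T)) = Some (star w)" using Some by (simp add: e_word_star[OF i])
    then obtain v where v: "e_word n i (cr (Ev n T)) = Some v" "crystal_equiv n (star w) v" using eq(5) by blast
    obtain V where V: "V \<in> KN n \<mu>" "cr V = v" using KN_e_closed[OF Ev(1) i v(1)] by blast
    have "Ev n U = V" by (rule Ev_eqI[OF assms(2) V(1), of w]) (use v V U in simp_all)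
    then show ?thesis
      using f_tab_eq(2)[OF T i U(1)] e_tab_eq(2)[OF Ev(1) i V(1)] Some v U V by simp
  qed
  show "f_tab n \<mu> i (Ev n T) = map_option (Ev n) (e_tab n \<mu> i T)"
  proof (cases "e_word n i (cr T)")
    case None
    then have "f_word n i (cr (Ev n T)) = None"
      using eq(3) by (simp add: e_word_None f_word_None phi_star[OF i])
    then show ?thesis using e_tab_eq(1)[OF T i None] f_tab_eq(1)[OF Ev(1) i] by simp
  next
    case (Some w)
    obtain U where U: "U \<in> KN n \<mu>" "cr U = w" using KN_e_closed[OF T i Some] by blast
    have "f_word n i (star (cr T)) = Some (star w)" using Some by (simp add: f_word_star[OF i])
    then obtain v where v: "f_word n i (cr (Ev n T)) = Some v" "crystal_equiv n (star w) v" using eq(4) by blast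
    obtain V where V: "V \<in> KN n \<mu>" "cr V = v" using KN_f_closed[OF Ev(1) i v(1)] by blast
    have "Ev n U = V" by (rule Ev_eqI[OF assms(2) V(1), of w]) (use v V U in simp_all)
    then show ?thesis
      using e_tab_eq(2)[OF T i U(1)] f_tab_eq(2)[OF Ev(1) i V(1)] Some v U V by simp
  qed
qed

end
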